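(* Let $\alpha > 0$. Consider conformal maps $F : \mathbb{D} \to \Omega$ of the unit disk $\mathbb{D}$ onto Jordan--Lipschitz domains $\Omega$. The scale invariant quantity $$\lambda_1\big(\Omega;\alpha/L(\Omega)\big)\, |F'(0)|^2$$ is maximal if and only if $F$ is linear and $\Omega$ is a disk. That is, for every such $F$ and $\Omega$, $$\lambda_1\big(\Omega;\alpha/L(\Omega)\big)\, |F'(0)|^2 \leq \lambda_1\big(\mathbb{D};\alpha/(2\pi)\big),$$ with equality if and only if $F$ is linear (so that $\Omega$ is a disk).
   Context: $\mathbb{D}$ is the open unit disk in $\mathbb{C} \cong \mathbb{R}^2$. A conformal map of $\mathbb{D}$ onto $\Omega$ is a holomorphic bijection. "Linear" means of the form $F(z) = a_0 + a_1 z$ with complex constants $a_0, a_1$. A Jordan--Lipschitz domain is a simply-connected, bounded planar domain $\Omega \subset \mathbb{R}^2$ whose boundary is a Jordan curve and which has Lipschitz boundary. $L(\Omega)$ denotes the perimeter, i.e. the length of the boundary $\partial\Omega$. For a bounded domain $\Omega \subset \mathbb{R}^2$ with Lipschitz boundary and a real parameter $\beta$, $\lambda_1(\Omega;\beta)$ denotes the first (smallest) eigenvalue of the Robin problem $-\Delta u = \lambda u$ in $\Omega$, $\frac{\partial u}{\partial \nu} + \beta u = 0$ on $\partial\Omega$, where $\nu$ is the outward unit normal. The problem is understood in the weak sense; that is, $$\lambda_1(\Omega;\beta) = \min_{u \in H^1(\Omega)\setminus\{0\}} \frac{\int_\Omega |\nabla u|^2\,dx + \beta \int_{\partial\Omega}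 u^2 \, ds}{\int_\Omega u^2\,dx},$$ where $u$ on $\partial\Omega$ is understood as the trace. *)

theory Defs
  imports "HOL-Analysis.Analysis"
begin

text \<open>
  The plane is the type \<^typ>\<open>complex\<close>, which as a Euclidean space carries the two-dimensional
  Lebesgue measure and the inner product of $R^2$.
\<close>

subsection \<open>Arc length\<close>

text \<open>
  Length and the arc length element $ds$ are given by the one-dimensional Hausdorff measure.
  In dimension one the usual normalising constant is 1, and on a Jordan curve this measure is
  arc length. The covering sets must be bounded because \<^const>\<open>diameter\<close> is only meaningful there.
\<close>

definition hausdorff1_pre :: "real \<Rightarrow> complex set \<Rightarrow> ennreal" where
  "hausdorff1_pre \<delta> A =
     (INF C \<in> {C :: nat \<Rightarrow> complex set.
                A \<subseteq> (\<Union>i. C i) \<and> (\<forall>i. bounded (C i) \<and> diameter (C i) \<le> \<delta>)}.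
        \<Sum>i. ennreal (diameter (C i)))"

definition hausdorff1_outer :: "complex set \<Rightarrow> ennreal" where
  "hausdorff1_outer A = (SUP \<delta> \<in> {0<..}. hausdorff1_pre \<delta> A)"

text \<open>
  Hausdorff outer measure is a metric outer measure, hence countably additive on Borel sets, so
  \<^const>\<open>measure_of\<close> does not degenerate here.
\<close>

definition hausdorff1 :: "complex measure" where
  "hausdorff1 = measure_of UNIV (sets borel) hausdorff1_outer"

definition boundary_measure :: "complex set \<Rightarrow> complex measure" where
  "boundary_measure \<Omega> = restrict_space hausdorff1 (frontier \<Omega>)"

definition perimeter :: "complex set \<Rightarrow> real" where
  "perimeter \<Omega> = measure hausdorff1 (frontier \<Omega>)"

subsection \<open>Jordan--Lipschitz domains\<close>

text \<open>
  Near each boundary point, after a rotation of the coordinates (multiplication by the unit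
  complex number \<open>c\<close>), the set is the region strictly above the graph of a Lipschitz function.
\<close>

definition lipschitz_boundary :: "complex set \<Rightarrow> bool" where
  "lipschitz_boundary \<Omega> \<longleftrightarrow>
     (\<forall>p \<in> frontier \<Omega>. \<exists>r > 0. \<exists>c. \<exists>h :: real \<Rightarrow> real. \<exists>M.
        norm c = 1 \<and> M-lipschitz_on UNIV h \<and>
        \<Omega> \<inter> ball p r = {z \<in> ball p r. h (Re (c * z)) < Im (c * z)})"

definition jordan_curve :: "complex set \<Rightarrow> bool" where
  "jordan_curve J \<longleftrightarrow>
     (\<exists>\<gamma>. simple_path \<gamma> \<and> pathfinish \<gamma> = pathstart \<gamma> \<and> path_image \<gamma> = J)"

definition jordan_lipschitz_domain :: "complex set \<Rightarrow> bool" where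
  "jordan_lipschitz_domain \<Omega> \<longleftrightarrow>
     \<Omega> \<noteq> {} \<and> open \<Omega> \<and> bounded \<Omega> \<and> simply_connected \<Omega> \<and>
     jordan_curve (frontier \<Omega>) \<and> lipschitz_boundary \<Omega>"

subsection \<open>Sobolev functions and traces\<close>

primrec C_k :: "nat \<Rightarrow> (complex \<Rightarrow> real) \<Rightarrow> bool" where
  "C_k 0 f \<longleftrightarrow> continuous_on UNIV f"
| "C_k (Suc k) f \<longleftrightarrow>
     (\<forall>x. f differentiable (at x)) \<and> (\<forall>v. C_k k (\<lambda>x. frechet_derivative f (at x) v))"

definition smooth :: "(complex \<Rightarrow> real) \<Rightarrow> bool" where
  "smooth f \<longleftrightarrow> (\<forall>k. C_k k f)"

definition grad :: "(complex \<Rightarrow> real) \<Rightarrow> complex \<Rightarrow> complex" where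
  "grad f x = Complex (frechet_derivative f (at x) 1) (frechet_derivative f (at x) \<i>)"

definition test_function :: "complex set \<Rightarrow> (complex \<Rightarrow> real) \<Rightarrow> bool" where
  "test_function \<Omega> \<phi> \<longleftrightarrow>
     smooth \<phi> \<and> compact (closure {x. \<phi> x \<noteq> 0}) \<and> closure {x. \<phi> x \<noteq> 0} \<subseteq> \<Omega>"

definition square_integrable ::
  "complex measure \<Rightarrow> (complex \<Rightarrow> 'b::euclidean_space) \<Rightarrow> bool" where
  "square_integrable M f \<longleftrightarrow> f \<in> borel_measurable M \<and> integrable M (\<lambda>x. (norm (f x))\<^sup>2)"

definition tendsto_L2 ::
  "complex measure \<Rightarrow> (nat \<Rightarrow> complex \<Rightarrow> 'b::euclidean_space) \<Rightarrow> (complex \<Rightarrow> 'b) \<Rightarrow> bool" where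
  "tendsto_L2 M f u \<longleftrightarrow>
     (\<lambda>n. \<integral>\<^sup>+ x. ennreal ((norm (f n x - u x))\<^sup>2) \<partial>M) \<longlonglongrightarrow> 0"

text \<open>
  \<open>sobolev_H1 \<Omega> u g\<close>: the function \<open>u\<close> belongs to $H^1(\Omega)$ and \<open>g\<close> is its weak gradient,
  which is determined up to null sets.
\<close>

definition sobolev_H1 :: "complex set \<Rightarrow> (complex \<Rightarrow> real) \<Rightarrow> (complex \<Rightarrow> complex) \<Rightarrow> bool" where
  "sobolev_H1 \<Omega> u g \<longleftrightarrow>
     square_integrable (lebesgue_on \<Omega>) u \<and> square_integrable (lebesgue_on \<Omega>) g \<and>
     (\<forall>\<phi>. test_function \<Omega> \<phi> \<longrightarrow>
        (LINT x|lebesgue_on \<Omega>. u x *\<^sub>R grad \<phi> x) = - (LINT x|lebesgue_on \<Omega>. \<phi> x *\<^sub>R g x))"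

text \<open>
  The trace operator is the continuous extension to $H^1(\Omega)$ of the restriction map
  \<open>\<phi> \<mapsto> \<phi>|\<partial>\<Omega>\<close> on functions smooth up to the boundary, with values in $L^2(\partial\Omega)$.
  \<open>has_trace \<Omega> u g t\<close> describes its graph. If \<open>\<Omega>\<close> is bounded with Lipschitz boundary, then each
  \<open>u\<close> in $H^1(\Omega)$ has such a \<open>t\<close>, and it is unique up to null sets.
\<close>

definition has_trace ::
  "complex set \<Rightarrow> (complex \<Rightarrow> real) \<Rightarrow> (complex \<Rightarrow> complex) \<Rightarrow> (complex \<Rightarrow> real) \<Rightarrow> bool" where
  "has_trace \<Omega> u g t \<longleftrightarrow>
     square_integrable (boundary_measure \<Omega>) t \<and>
     (\<exists>\<phi> :: nat \<Rightarrow> complex \<Rightarrow> real.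
        (\<forall>n. smooth (\<phi> n)) \<and>
        tendsto_L2 (lebesgue_on \<Omega>) \<phi> u \<and>
        tendsto_L2 (lebesgue_on \<Omega>) (\<lambda>n. grad (\<phi> n)) g \<and>
        tendsto_L2 (boundary_measure \<Omega>) \<phi> t)"

subsection \<open>The first Robin eigenvalue\<close>

definition robin_rayleigh ::
  "complex set \<Rightarrow> real \<Rightarrow> (complex \<Rightarrow> real) \<Rightarrow> (complex \<Rightarrow> complex) \<Rightarrow> (complex \<Rightarrow> real) \<Rightarrow> real" where
  "robin_rayleigh \<Omega> \<beta> u g t =
     ((LINT x|lebesgue_on \<Omega>. (norm (g x))\<^sup>2) + \<beta> * (LINT x|boundary_measure \<Omega>. (t x)\<^sup>2))
     / (LINT x|lebesgue_on \<Omega>. (u x)\<^sup>2)"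

text \<open>On a bounded domain with Lipschitz boundary this infimum is a minimum.\<close>

definition robin_lambda1 :: "complex set \<Rightarrow> real \<Rightarrow> real" where
  "robin_lambda1 \<Omega> \<beta> =
     Inf {robin_rayleigh \<Omega> \<beta> u g t | u g t.
            sobolev_H1 \<Omega> u g \<and> has_trace \<Omega> u g t \<and> \<not> (AE x in lebesgue_on \<Omega>. u x = 0)}"

subsection \<open>Conformal maps of the unit disk\<close>

definition conformal_map_of_disk :: "(complex \<Rightarrow> complex) \<Rightarrow> complex set \<Rightarrow> bool" where
  "conformal_map_of_disk F \<Omega> \<longleftrightarrow> F holomorphic_on ball 0 1 \<and> bij_betw F (ball 0 1) \<Omega>"

definition linear_on_disk :: "(complex \<Rightarrow> complex) \<Rightarrow> bool" where
  "linear_on_disk F \<longleftrightarrow> (\<exists>a\<^sub>0 a\<^sub>1. \<forall>z \<in> ball 0 1. F z = a\<^sub>0 + a\<^sub>1 * z)"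

end

theory Submission
  imports Defs "HOL-Complex_Analysis.Complex_Analysis" "HOL-Real_Asymp.Real_Asymp"
begin

text \<open>
  Let \<open>b = \<alpha> / (2 * pi)\<close>. The disk has a positive radial Robin eigenfunction \<open>u\<close> with eigenvalue \<open>l\<close>, given
  by the Bessel function \<open>J\<^sub>0\<close> (\<open>radial_ground_state_exists\<close>). Transplant it to \<open>v = u \<circ> F\<^sup>-\<^sup>1\<close> on \<open>\<Omega>\<close>. The
  Dirichlet integral does not change, because it is conformally invariant. The boundary term does
  not change either: \<open>v\<close> is constant on the frontier, and the parameter \<open>\<alpha> / perimeter \<Omega>\<close>
  times the perimeter is \<open>\<alpha>\<close>. The mass becomes the integral of \<open>u\<^sup>2 * |F'|\<^sup>2\<close> over the disk. Since \<open>u\<close> is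
  radial, only the means of \<open>|F'|\<^sup>2\<close> over circles matter, and these are at least \<open>|F' 0|\<^sup>2\<close>, with
  strict inequality unless \<open>F'\<close> is constant (\<open>circle_mean_square\<close>). Hence the eigenvalue of \<open>\<Omega>\<close> times
  \<open>|F' 0|\<^sup>2\<close> is at most \<open>l\<close>, and it is smaller than \<open>l\<close> if \<open>F\<close> is not linear (\<open>robin_lambda1_conformal_le\<close>).

  It remains to see that \<open>l\<close> is the first eigenvalue of the disk, and that \<open>l / r\<^sup>2\<close> is the one of a disk
  of radius \<open>r\<close> with parameter \<open>b / r\<close>. The upper bound is the previous argument for a linear map. The lower bound
  is Picone's identity: the square of \<open>grad f - f * grad u / u\<close> is nonnegative. For radial \<open>u\<close> it suffices to use this on
  each ray, where it needs nothing more than the fundamental theorem of calculus (\<open>radial_identity\<close>, \<open>robin_lambda1_ball_ge\<close>).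

  The eigenvalue is an infimum over functions with traces, and traces are limits of functions that are smooth on
  the whole plane. The function \<open>v\<close> need not be smooth up to the frontier, so it is approximated from
  inside: the profile of \<open>u\<close> is flattened near the circle by a factor \<open>exp (- e / (a - s))\<close>. The resulting
  functions are constant near the frontier and smooth (\<open>flat_cutoff_smooth\<close>, \<open>radial_trial_function\<close>). The
  Lipschitz condition makes the perimeter finite (\<open>hausdorff1_frontier_finite\<close>), so that constants are square
  integrable on the frontier. Because the trial functions are bounded below by the boundary value of \<open>u\<close>, the gain in
  mass from a nonconstant \<open>F'\<close> is bounded below as well, and the inequality stays strict in the limit.

  The boundary integrals use Hausdorff measure. It is shown to be a Borel measure by Caratheodory's
  criterion, and on circles to be arc length (\<open>emeasure_hausdorff1_circle\<close>).
\<close>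

section \<open>Hausdorff measure as a Borel measure\<close>

lemma outer_measure_Un:
  fixes f :: "'a set \<Rightarrow> ennreal"
  assumes outer: "outer_measure_space UNIV f"
  shows "f (A \<union> B) \<le> f A + f B"
proof -
  have mono: "f A \<le> f B" if "A \<subseteq> B" for A B
    using outer that by (auto simp: outer_measure_space_def increasing_def)
  have sub: "f (\<Union>i. A i) \<le> (\<Sum>i. f (A i))" if "disjoint_family A" for A :: "nat \<Rightarrow> 'a set"
    using outer that by (auto simp: outer_measure_space_def countably_subadditive_def)
  have "f (A \<union> B) \<le> f (\<Union>i::nat. if i = 0 then A else if i = 1 then B - A else {})" (is "_ \<le> f (\<Union>i. ?A i)")
    by (rule mono) (auto split: if_splits intro: exI[of _ "1::nat"])
  also have "\<dots> \<le> (\<Sum>i. f (?A i))" by (rule sub) (auto simp: disjoint_family_on_def)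
  also have "\<dots> = (\<Sum>i<2. f (?A i))"
    using outer by (intro suminf_finite) (auto simp: outer_measure_space_def positive_def)
  also have "\<dots> \<le> f A + f B" by (simp add: numeral_2_eq_2 mono add_left_mono)
  finally show ?thesis .
qed

text \<open>
  Caratheodory's criterion. Cut the part of \<open>X\<close> outside \<open>C\<close> into shells according to the distance from
  \<open>C\<close>. Shells with two different indices of the same parity are a positive distance apart, so the outer
  measures of the even shells sum to at most that of \<open>X\<close>, and likewise for the odd ones. The series over
  all shells therefore converges, and its tail bounds what is lost when \<open>X - C\<close> is replaced by
  the points at distance at least \<open>1 / (n + 1)\<close> from \<open>C\<close>.
\<close>

lemma metric_outer_measure_closed:
  fixes f :: "'a::metric_space set \<Rightarrow> ennreal"
  assumes outer: "outer_measure_space UNIV f"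
    and metric: "\<And>A B d. 0 < d \<Longrightarrow> (\<And>x y. x \<in> A \<Longrightarrow> y \<in> B \<Longrightarrow> d \<le> dist x y) \<Longrightarrow> f A + f B \<le> f (A \<union> B)"
    and "closed C"
  shows "f (X \<inter> C) + f (X - C) \<le> f X"
proof (cases "C = {} \<or> f X = top")
  case True
  then show ?thesis
    using outer by (auto simp: outer_measure_space_def positive_def)
next
  case False
  then have C: "C \<noteq> {}" and fin: "f X < top"
    by (auto simp: less_top)
  have mono: "f A \<le> f B" if "A \<subseteq> B" for A B
    using outer that by (auto simp: outer_measure_space_def increasing_def)
  have sub: "f (\<Union>i. A i) \<le> (\<Sum>i. f (A i))" if "disjoint_family A" for A :: "nat \<Rightarrow> 'a set"
    using outer that by (auto simp: outer_measure_space_def countably_subadditive_def)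
  have sub2: "f (A \<union> B) \<le> f A + f B" for A B
    using outer by (rule outer_measure_Un)
  define A where "A n = {x \<in> X. 1 / real (n + 1) \<le> infdist x C}" for n
  define R where "R k = {x \<in> X. 1 / real (k + 2) \<le> infdist x C \<and> infdist x C < 1 / real (k + 1)}" for k
  have "R j \<inter> R k = {}" if "j < k" for j k
  proof -
    have "1 / real (k + 1) \<le> 1 / real (j + 2)" using that by (intro divide_left_mono) auto
    then show ?thesis by (auto simp: R_def)
  qed
  then have disj: "disjoint_family (\<lambda>k. R (k + n))" for n
    unfolding disjoint_family_on_def by (metis Int_commute add_less_cancel_right linorder_neqE_nat)
  have sep: "f S + f (R m) \<le> f (S \<union> R m)" if S: "\<And>x. x \<in> S \<Longrightarrow> 1 / real m \<le> infdist x C" and "0 < m" for S m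
  proof (rule metric)
    show "0 < 1 / real m - 1 / real (m + 1)" using \<open>0 < m\<close> by (simp add: field_simps add_pos_nonneg)
    fix x y assume "x \<in> S" "y \<in> R m"
    then have "1 / real m \<le> infdist x C" "infdist y C < 1 / real (m + 1)"
      using S by (auto simp: R_def)
    then show "1 / real m - 1 / real (m + 1) \<le> dist x y"
      using infdist_triangle[of x C y] by simp
  qed
  \<comment> \<open>Shells of the same parity keep a positive distance from one another.\<close>
  have parity: "(\<Sum>i<n. f (R (2 * i + p))) \<le> f X" for n p
  proof -
    have "(\<Sum>i<n. f (R (2 * i + p))) \<le> f (\<Union>i<n. R (2 * i + p))"
    proof (induction n)
      case 0
      then show ?case by simp
    next
      case (Suc n)
      have "(\<Sum>i<Suc n. f (R (2 * i + p))) \<le> f (\<Union>i<n. R (2 * i + p)) + f (R (2 * n + p))"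
        using Suc by (simp add: add_right_mono)
      also have "\<dots> \<le> f ((\<Union>i<n. R (2 * i + p)) \<union> R (2 * n + p))"
      proof (cases "n = 0")
        case True
        then show ?thesis using outer by (simp add: outer_measure_space_def positive_def)
      next
        case False
        show ?thesis
        proof (rule sep)
          fix x assume "x \<in> (\<Union>i<n. R (2 * i + p))"
          then obtain i where i: "i < n" "x \<in> R (2 * i + p)" by auto
          have "1 / real (2 * n + p) \<le> 1 / real (2 * i + p + 2)"
            using i by (intro divide_left_mono) auto
          then show "1 / real (2 * n + p) \<le> infdist x C"
            using i(2) by (auto simp: R_def)
        qed (use False in auto)
      qed
      also have "\<dots> = f (\<Union>i<Suc n. R (2 * i + p))"
        by (simp add: lessThan_Suc Un_commute)
      finally show ?case .
    qed
    also have "\<dots> \<le> f X" by (rule mono) (auto simp: R_def)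
    finally show ?thesis .
  qed
  have RX: "f (R k) < top" for k
    using mono[of "R k" X] fin by (auto simp: R_def)
  define r where "r k = enn2real (f (R k))" for k
  have r: "\<And>k. 0 \<le> r k" "\<And>k. f (R k) = ennreal (r k)"
    using RX by (auto simp: r_def)
  have "summable r"
  proof (rule summableI_nonneg_bounded)
    fix n
    have "ennreal (\<Sum>k<n. r k) = (\<Sum>k<n. f (R k))" using r by simp
    also have "\<dots> \<le> (\<Sum>k<2 * n. f (R k))" by (rule sum_mono2) auto
    also have "\<dots> = (\<Sum>i<n. f (R (2 * i + 0))) + (\<Sum>i<n. f (R (2 * i + 1)))"
      by (induction n) (auto simp: algebra_simps)
    also have "\<dots> \<le> f X + f X" by (intro add_mono parity)
    also have "\<dots> = ennreal (2 * enn2real (f X))"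
      using fin by (metis ennreal_enn2real enn2real_nonneg ennreal_plus mult_2)
    finally show "(\<Sum>k<n. r k) \<le> 2 * enn2real (f X)"
      by (subst (asm) ennreal_le_iff) auto
  qed (use r in auto)
  have step: "f (X \<inter> C) + f (X - C) \<le> f X + ennreal (\<Sum>k. r (k + n))" for n
  proof -
    have "X - C \<subseteq> A n \<union> (\<Union>k. R (k + n))"
    proof
      fix x assume x: "x \<in> X - C"
      then have "0 < infdist x C"
        using \<open>closed C\<close> C by (simp add: infdist_pos_not_in_closed)
      show "x \<in> A n \<union> (\<Union>k. R (k + n))"
      proof (cases "x \<in> A n")
        case False
        with x have lt: "infdist x C < 1 / real (n + 1)" by (auto simp: A_def)
        obtain m where m: "1 / real (Suc m) < infdist x C"
          using \<open>0 < infdist x C\<close> by (metis nat_approx_posE)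
        define l where "l = (LEAST l. 1 / real (l + 1) \<le> infdist x C)"
        have l: "1 / real (l + 1) \<le> infdist x C"
          unfolding l_def by (rule LeastI[of _ m]) (use m in auto)
        have "\<not> l \<le> n"
        proof
          assume "l \<le> n"
          then have "1 / real (n + 1) \<le> 1 / real (l + 1)" by (intro divide_left_mono) auto
          with l lt show False by linarith
        qed
        then obtain k where k: "l = Suc (k + n)"
          by (metis add.commute less_iff_Suc_add not_le)
        have "\<not> 1 / real (k + n + 1) \<le> infdist x C"
          using not_less_Least[of "k + n" "\<lambda>l. 1 / real (l + 1) \<le> infdist x C"] k l_def by auto
        then have "x \<in> R (k + n)" using l k x by (auto simp: R_def)
        then show ?thesis by auto
      qed auto
    qed
    then have "f (X - C) \<le> f (A n \<union> (\<Union>k. R (k + n)))" by (rule mono)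
    also have "\<dots> \<le> f (A n) + (\<Sum>k. f (R (k + n)))"
      using sub2 sub[OF disj] by (meson add_left_mono order_trans)
    also have "(\<Sum>k. f (R (k + n))) = ennreal (\<Sum>k. r (k + n))"
      unfolding r(2) using r(1) \<open>summable r\<close> by (intro suminf_ennreal2) (auto simp: summable_iff_shift)
    finally have "f (X \<inter> C) + f (X - C) \<le> (f (X \<inter> C) + f (A n)) + ennreal (\<Sum>k. r (k + n))"
      by (simp add: add.assoc add_left_mono)
    also have "f (X \<inter> C) + f (A n) \<le> f ((X \<inter> C) \<union> A n)"
    proof (rule metric)
      fix x y assume "x \<in> X \<inter> C" "y \<in> A n"
      then show "1 / real (n + 1) \<le> dist x y"
        using infdist_triangle[of y C x] by (auto simp: A_def dist_commute)
    qed simp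
    also have "\<dots> \<le> f X" by (rule mono) (auto simp: A_def)
    finally show ?thesis by (simp add: add_right_mono)
  qed
  show ?thesis
  proof (rule ennreal_le_epsilon)
    fix e :: real assume "0 < e"
    with suminf_exist_split2[OF \<open>summable r\<close>] obtain n where "norm (\<Sum>k. r (k + n)) < e"
      by (metis (no_types, lifting) LIMSEQ_D diff_zero order_refl)
    then have "ennreal (\<Sum>k. r (k + n)) \<le> ennreal e" by (intro ennreal_leI) auto
    with step[of n] show "f (X \<inter> C) + f (X - C) \<le> f X + ennreal e"
      by (meson add_left_mono order_trans)
  qed
qed

lemma hausdorff1_pre_le:
  assumes "A \<subseteq> (\<Union>i. C i)" "\<And>i. bounded (C i)" "\<And>i. diameter (C i) \<le> \<delta>"
  shows "hausdorff1_pre \<delta> A \<le> (\<Sum>i. ennreal (diameter (C i)))"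
  unfolding hausdorff1_pre_def using assms by (intro INF_lower) auto

lemma hausdorff1_pre_greatest:
  assumes "\<And>C. A \<subseteq> (\<Union>i. C i) \<Longrightarrow> (\<And>i. bounded (C i)) \<Longrightarrow> (\<And>i. diameter (C i) \<le> \<delta>) \<Longrightarrow>
             x \<le> (\<Sum>i. ennreal (diameter (C i)))"
  shows "x \<le> hausdorff1_pre \<delta> A"
  unfolding hausdorff1_pre_def using assms by (intro INF_greatest) auto

lemma hausdorff1_pre_antimono: "\<delta> \<le> \<delta>' \<Longrightarrow> hausdorff1_pre \<delta>' A \<le> hausdorff1_pre \<delta> A"
  by (rule hausdorff1_pre_greatest) (auto intro!: hausdorff1_pre_le intro: order_trans)

lemma hausdorff1_pre_le_outer: "0 < \<delta> \<Longrightarrow> hausdorff1_pre \<delta> A \<le> hausdorff1_outer A"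
  unfolding hausdorff1_outer_def by (rule SUP_upper) auto

lemma hausdorff1_outer_least:
  "(\<And>\<delta>. 0 < \<delta> \<Longrightarrow> hausdorff1_pre \<delta> A \<le> x) \<Longrightarrow> hausdorff1_outer A \<le> x"
  unfolding hausdorff1_outer_def by (rule SUP_least) auto

lemma hausdorff1_pre_approx:
  assumes "hausdorff1_pre \<delta> A < y"
  obtains C where "A \<subseteq> (\<Union>i. C i)" "\<And>i. bounded (C i)" "\<And>i. diameter (C i) \<le> \<delta>"
    "(\<Sum>i. ennreal (diameter (C i))) < y"
  using assms unfolding hausdorff1_pre_def INF_less_iff by blast

lemma hausdorff1_pre_subadditive:
  fixes A :: "nat \<Rightarrow> complex set"
  shows "hausdorff1_pre \<delta> (\<Union>i. A i) \<le> (\<Sum>i. hausdorff1_pre \<delta> (A i))"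
proof (rule ennreal_le_epsilon)
  fix e :: real assume fin: "(\<Sum>i. hausdorff1_pre \<delta> (A i)) < top" and "0 < e"
  define w where "w i = e * (1/2) ^ Suc i" for i
  have w: "0 < w i" for i using \<open>0 < e\<close> by (simp add: w_def)
  have wsum: "w sums e"
    unfolding w_def using sums_mult[OF power_half_series, of e] by simp
  have "\<exists>C. A i \<subseteq> (\<Union>j. C j) \<and> (\<forall>j. bounded (C j)) \<and> (\<forall>j. diameter (C j) \<le> \<delta>) \<and>
          (\<Sum>j. ennreal (diameter (C j))) \<le> hausdorff1_pre \<delta> (A i) + ennreal (w i)" for i
  proof -
    have "hausdorff1_pre \<delta> (A i) < top"
      using fin ennreal_suminf_lessD by blast
    then have "hausdorff1_pre \<delta> (A i) < hausdorff1_pre \<delta> (A i) + ennreal (w i)"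
      using w[of i] by (simp add: ennreal_less_zero_iff)
    then show ?thesis
      by (rule hausdorff1_pre_approx) (metis less_imp_le)
  qed
  then obtain C where C: "\<And>i. A i \<subseteq> (\<Union>j. C i j)" "\<And>i j. bounded (C i j)"
      "\<And>i j. diameter (C i j) \<le> \<delta>"
      "\<And>i. (\<Sum>j. ennreal (diameter (C i j))) \<le> hausdorff1_pre \<delta> (A i) + ennreal (w i)"
    by metis
  define D where "D k = (case prod_decode k of (i, j) \<Rightarrow> C i j)" for k
  have "hausdorff1_pre \<delta> (\<Union>i. A i) \<le> (\<Sum>k. ennreal (diameter (D k)))"
  proof (rule hausdorff1_pre_le)
    have CD: "C i j \<subseteq> (\<Union>k. D k)" for i j
    proof -
      have "D (prod_encode (i, j)) = C i j" by (simp add: D_def)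
      then show ?thesis by (metis UN_upper UNIV_I)
    qed
    show "(\<Union>i. A i) \<subseteq> (\<Union>k. D k)"
    proof (rule UN_least)
      fix i
      have "A i \<subseteq> (\<Union>j. C i j)" by (rule C(1))
      also have "\<dots> \<subseteq> (\<Union>k. D k)" by (rule UN_least) (rule CD)
      finally show "A i \<subseteq> (\<Union>k. D k)" .
    qed
    show "bounded (D k)" "diameter (D k) \<le> \<delta>" for k
      using C(2,3) by (simp_all add: D_def split: prod.split)
  qed
  also have "\<dots> = (\<Sum>k. (\<lambda>(i, j). ennreal (diameter (C i j))) (prod_decode k))"
    by (rule suminf_cong) (simp add: D_def split: prod.split)
  also have "\<dots> = (\<Sum>i. \<Sum>j. ennreal (diameter (C i j)))"
    by (rule suminf_ennreal_2dimen[where g = "\<lambda>i. \<Sum>j. ennreal (diameter (C i j))"]) simp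
  also have "\<dots> \<le> (\<Sum>i. hausdorff1_pre \<delta> (A i) + ennreal (w i))"
    using C(4) by (intro suminf_le) auto
  also have "\<dots> = (\<Sum>i. hausdorff1_pre \<delta> (A i)) + (\<Sum>i. ennreal (w i))"
    by (rule suminf_add[symmetric]) auto
  also have "(\<Sum>i. ennreal (w i)) = ennreal e"
    using w wsum by (intro suminf_ennreal_eq) (auto intro: less_imp_le)
  finally show "hausdorff1_pre \<delta> (\<Union>i. A i) \<le> (\<Sum>i. hausdorff1_pre \<delta> (A i)) + ennreal e" .
qed

lemma hausdorff1_outer_measure_space: "outer_measure_space UNIV hausdorff1_outer"
  unfolding outer_measure_space_def
proof (intro conjI)
  have "hausdorff1_outer {} \<le> 0"
  proof (rule hausdorff1_outer_least)
    show "hausdorff1_pre \<delta> {} \<le> 0" if "0 < \<delta>" for \<delta>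
      using hausdorff1_pre_le[of "{}" "\<lambda>_. {}" \<delta>] that by simp
  qed
  then show "positive UNIV hausdorff1_outer" by (simp add: positive_def)
  have "hausdorff1_outer A \<le> hausdorff1_outer B" if "A \<subseteq> B" for A B
  proof (rule hausdorff1_outer_least)
    fix \<delta> :: real assume "0 < \<delta>"
    have "hausdorff1_pre \<delta> A \<le> hausdorff1_pre \<delta> B"
      by (rule hausdorff1_pre_greatest) (use that in \<open>auto intro!: hausdorff1_pre_le\<close>)
    also have "\<dots> \<le> hausdorff1_outer B" by (rule hausdorff1_pre_le_outer) fact
    finally show "hausdorff1_pre \<delta> A \<le> hausdorff1_outer B" .
  qed
  then show "increasing UNIV hausdorff1_outer" by (simp add: increasing_def)
  show "countably_subadditive UNIV hausdorff1_outer"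
    unfolding countably_subadditive_def
  proof (intro allI impI)
    fix A :: "nat \<Rightarrow> complex set"
    show "hausdorff1_outer (\<Union>i. A i) \<le> (\<Sum>i. hausdorff1_outer (A i))"
    proof (rule hausdorff1_outer_least)
      fix \<delta> :: real assume "0 < \<delta>"
      have "hausdorff1_pre \<delta> (\<Union>i. A i) \<le> (\<Sum>i. hausdorff1_pre \<delta> (A i))"
        by (rule hausdorff1_pre_subadditive)
      also have "\<dots> \<le> (\<Sum>i. hausdorff1_outer (A i))"
        by (rule suminf_le) (auto intro: hausdorff1_pre_le_outer \<open>0 < \<delta>\<close>)
      finally show "hausdorff1_pre \<delta> (\<Union>i. A i) \<le> (\<Sum>i. hausdorff1_outer (A i))" .
    qed
  qed
qed

lemma hausdorff1_outer_separated:
  assumes "0 < d" and d: "\<And>x y. x \<in> A \<Longrightarrow> y \<in> B \<Longrightarrow> d \<le> dist x y"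
  shows "hausdorff1_outer A + hausdorff1_outer B \<le> hausdorff1_outer (A \<union> B)"
proof -
  have pre: "hausdorff1_pre \<delta> A + hausdorff1_pre \<delta> B \<le> hausdorff1_pre \<delta> (A \<union> B)" if "0 < \<delta>" "\<delta> < d" for \<delta>
  proof (rule hausdorff1_pre_greatest)
    fix C :: "nat \<Rightarrow> complex set"
    assume C: "A \<union> B \<subseteq> (\<Union>i. C i)" "\<And>i. bounded (C i)" "\<And>i. diameter (C i) \<le> \<delta>"
    \<comment> \<open>A covering set of diameter less than \<open>d\<close> cannot meet both \<open>A\<close> and \<open>B\<close>.\<close>
    define CA where "CA i = (if C i \<inter> A = {} then {} else C i)" for i
    define CB where "CB i = (if C i \<inter> A = {} then C i else {})" for i
    have A: "A \<subseteq> (\<Union>i. CA i)" unfolding CA_def using C(1) by fastforce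
    have B: "B \<subseteq> (\<Union>i. CB i)"
    proof
      fix y assume y: "y \<in> B"
      then obtain i where i: "y \<in> C i" using C(1) by auto
      have "C i \<inter> A = {}"
      proof (rule ccontr)
        assume "C i \<inter> A \<noteq> {}"
        then obtain x where "x \<in> C i" "x \<in> A" by auto
        then have "d \<le> dist x y" "dist x y \<le> \<delta>"
          using d y i C(2,3)[of i] diameter_bounded_bound[of "C i" x y] by fastforce+
        with \<open>\<delta> < d\<close> show False by simp
      qed
      with i show "y \<in> (\<Union>i. CB i)" by (auto simp: CB_def)
    qed
    have "hausdorff1_pre \<delta> A + hausdorff1_pre \<delta> B
        \<le> (\<Sum>i. ennreal (diameter (CA i))) + (\<Sum>i. ennreal (diameter (CB i)))"
      using C that by (intro add_mono hausdorff1_pre_le A B) (auto simp: CA_def CB_def)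
    also have "\<dots> = (\<Sum>i. ennreal (diameter (CA i)) + ennreal (diameter (CB i)))"
      by (rule suminf_add) auto
    also have "\<dots> = (\<Sum>i. ennreal (diameter (C i)))"
      by (rule suminf_cong) (auto simp: CA_def CB_def)
    finally show "hausdorff1_pre \<delta> A + hausdorff1_pre \<delta> B \<le> (\<Sum>i. ennreal (diameter (C i)))" .
  qed
  have "hausdorff1_outer A + hausdorff1_outer B = (SUP \<delta>\<in>{0<..}. hausdorff1_pre \<delta> A + hausdorff1_pre \<delta> B)"
    unfolding hausdorff1_outer_def
  proof (rule SUP_add_directed_ennreal[symmetric])
    show "\<exists>k\<in>{0<..}. hausdorff1_pre i A + hausdorff1_pre j B \<le> hausdorff1_pre k A + hausdorff1_pre k B"
      if "i \<in> {0<..}" "j \<in> {0<..}" for i j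
      using that by (intro bexI[of _ "min i j"] add_mono hausdorff1_pre_antimono) auto
  qed
  also have "\<dots> \<le> hausdorff1_outer (A \<union> B)"
  proof (rule SUP_least)
    fix \<delta> :: real assume "\<delta> \<in> {0<..}"
    define \<delta>' where "\<delta>' = min \<delta> (d / 2)"
    have \<delta>': "0 < \<delta>'" "\<delta>' < d" "\<delta>' \<le> \<delta>" using \<open>0 < d\<close> \<open>\<delta> \<in> {0<..}\<close> by (auto simp: \<delta>'_def)
    have "hausdorff1_pre \<delta> A + hausdorff1_pre \<delta> B \<le> hausdorff1_pre \<delta>' A + hausdorff1_pre \<delta>' B"
      using \<delta>' by (intro add_mono hausdorff1_pre_antimono)
    also have "\<dots> \<le> hausdorff1_pre \<delta>' (A \<union> B)" by (rule pre) fact+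
    also have "\<dots> \<le> hausdorff1_outer (A \<union> B)" by (rule hausdorff1_pre_le_outer) fact
    finally show "hausdorff1_pre \<delta> A + hausdorff1_pre \<delta> B \<le> hausdorff1_outer (A \<union> B)" .
  qed
  finally show ?thesis .
qed

lemma sets_hausdorff1 [simp, measurable_cong]: "sets hausdorff1 = sets borel"
  unfolding hausdorff1_def by (metis sets.sets_measure_of_eq space_borel)

lemma space_hausdorff1 [simp]: "space hausdorff1 = UNIV"
  unfolding hausdorff1_def by simp

text \<open>
  The closed sets split every set additively and generate the Borel sets. This is what allows the
  value of \<^const>\<open>hausdorff1\<close> on a Borel set to be computed from coverings.
\<close>

lemma hausdorff1_measure_space: "measure_space UNIV (sets borel) hausdorff1_outer"
proof (rule measure_down)
  interpret sigma_algebra "UNIV :: complex set" "UNIV" by (rule sigma_algebra_Pow[of UNIV, simplified])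
  let ?L = "lambda_system UNIV UNIV hausdorff1_outer"
  show m: "measure_space UNIV ?L hausdorff1_outer"
    by (rule caratheodory_lemma) (rule hausdorff1_outer_measure_space)
  show "sigma_algebra (UNIV :: complex set) (sets borel)"
    by (metis sets.sigma_algebra_axioms space_borel)
  have sa: "sigma_algebra UNIV ?L" using m by (simp add: measure_space_def)
  have "C \<in> ?L" if "closed C" for C :: "complex set"
  proof -
    have "hausdorff1_outer (X \<inter> C) + hausdorff1_outer (X - C) = hausdorff1_outer X" for X
    proof (rule antisym)
      show "hausdorff1_outer (X \<inter> C) + hausdorff1_outer (X - C) \<le> hausdorff1_outer X"
        by (rule metric_outer_measure_closed[OF hausdorff1_outer_measure_space _ that])
           (rule hausdorff1_outer_separated)
      show "hausdorff1_outer X \<le> hausdorff1_outer (X \<inter> C) + hausdorff1_outer (X - C)"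
        using outer_measure_Un[OF hausdorff1_outer_measure_space, of "X \<inter> C" "X - C"]
        by (simp add: Int_Diff_Un)
    qed
    then show ?thesis by (auto simp: lambda_system_eq)
  qed
  then have "Collect closed \<subseteq> ?L" by auto
  then have "sigma_sets UNIV (Collect closed) \<subseteq> ?L"
    using sigma_algebra.sigma_sets_subset[OF sa] by blast
  then show "sets borel \<subseteq> ?L"
    by (simp add: borel_eq_closed)
qed

lemma emeasure_hausdorff1:
  "A \<in> sets borel \<Longrightarrow> emeasure hausdorff1 A = hausdorff1_outer A"
  using hausdorff1_measure_space
  by (subst emeasure_measure_of[OF hausdorff1_def]) (auto simp: measure_space_def)

section \<open>Length of curves and finiteness of the perimeter\<close>

text \<open>
  The images of \<open>n\<close> equal subintervals have diameter at most \<open>L * (b - a) / n\<close> each.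
\<close>

lemma hausdorff1_outer_lipschitz_image:
  assumes lip: "L-lipschitz_on {a..b} f" and "a \<le> b"
  shows "hausdorff1_outer (f ` {a..b :: real}) \<le> ennreal (L * (b - a))"
proof (rule hausdorff1_outer_least)
  fix \<delta> :: real assume "0 < \<delta>"
  have L: "0 \<le> L" using lip by (rule lipschitz_on_nonneg)
  obtain n :: nat where n: "L * (b - a) / \<delta> < real n" using reals_Archimedean2 by blast
  have "0 \<le> L * (b - a) / \<delta>" using L \<open>a \<le> b\<close> \<open>0 < \<delta>\<close> by simp
  with n have n0: "0 < n" by (simp add: order_le_less_trans[of 0])
  define h where "h = (b - a) / real n"
  have h0: "0 \<le> h" using \<open>a \<le> b\<close> by (simp add: h_def)
  have Lh: "L * h \<le> \<delta>" using n n0 \<open>0 < \<delta>\<close> by (simp add: h_def field_simps)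
  define I where "I i = {a + real i * h .. a + real (Suc i) * h} \<inter> {a..b}" for i
  define C where "C i = (if i < n then f ` I i else {})" for i
  have dist_C: "norm (x - y) \<le> L * h" if "x \<in> C i" "y \<in> C i" for x y i
  proof -
    have "x \<in> f ` I i" "y \<in> f ` I i"
      using that by (auto simp: C_def split: if_splits)
    then obtain s t where st: "s \<in> I i" "t \<in> I i" "x = f s" "y = f t" by blast
    then have "dist x y \<le> L * dist s t" using lip by (auto simp: I_def lipschitz_on_def)
    also have "\<dots> \<le> L * h" using st L by (intro mult_left_mono) (auto simp: I_def dist_real_def algebra_simps)
    finally show ?thesis by (simp add: dist_norm)
  qed
  have diam: "diameter (C i) \<le> L * h" for i
    by (rule diameter_le) (use L h0 dist_C in auto)
  have bdd: "bounded (C i)" for i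
  proof -
    have "bounded (f ` {a..b})"
      using lipschitz_on_continuous_on[OF lip] by (intro compact_imp_bounded compact_continuous_image) auto
    then show ?thesis by (rule bounded_subset) (auto simp: C_def I_def)
  qed
  have "hausdorff1_pre \<delta> (f ` {a..b}) \<le> (\<Sum>i. ennreal (diameter (C i)))"
  proof (rule hausdorff1_pre_le)
    show "f ` {a..b} \<subseteq> (\<Union>i. C i)"
    proof clarsimp
      fix x assume x: "a \<le> x" "x \<le> b"
      show "\<exists>i. f x \<in> C i"
      proof (cases "h = 0 \<or> x = b")
        case True
        have "x = a + real n * h" "x = b" 
          using True x n0 \<open>a \<le> b\<close> by (auto simp: h_def)
        then have "x \<in> I (n - 1)" using n0 h0 x by (auto simp: I_def of_nat_diff algebra_simps)
        then show ?thesis using n0 by (intro exI[of _ "n - 1"]) (auto simp: C_def)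
      next
        case False
        then have hp: "0 < h" and xb: "x < b" using h0 x by auto
        define i where "i = nat \<lfloor>(x - a) / h\<rfloor>"
        have nn: "0 \<le> (x - a) / h" using x hp by simp
        have i: "real i \<le> (x - a) / h" "(x - a) / h < real i + 1"
          using nn by (auto simp: i_def)
        have "(x - a) / h < real n" using xb hp n0 by (simp add: h_def field_simps)
        then have "i < n" using i by linarith
        moreover have "x \<in> I i" using i hp x by (auto simp: I_def field_simps)
        ultimately show ?thesis by (auto simp: C_def)
      qed
    qed
  qed (use bdd diam Lh in \<open>auto intro: order_trans\<close>)
  also have "\<dots> = (\<Sum>i<n. ennreal (diameter (C i)))"
    by (rule suminf_finite) (auto simp: C_def)
  also have "\<dots> \<le> (\<Sum>i<n. ennreal (L * h))"
    by (intro sum_mono ennreal_leI diam)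
  also have "\<dots> = ennreal (real n * (L * h))"
    using L h0 by (subst sum_ennreal) auto
  also have "real n * (L * h) = L * (b - a)" using n0 by (simp add: h_def)
  finally show "hausdorff1_pre \<delta> (f ` {a..b}) \<le> ennreal (L * (b - a))" .
qed

text \<open>
  The counterpart for lower bounds: a covering set of diameter \<open>d\<close> pulls back to a set contained in an
  interval of length \<open>d / \<kappa>\<close>, so that every covering of the image yields a covering of \<open>T\<close>.
\<close>

lemma hausdorff1_outer_expanding_image:
  fixes f :: "real \<Rightarrow> complex"
  assumes T: "T \<in> sets lborel" and "0 < \<kappa>"
    and exp: "\<And>x y. x \<in> T \<Longrightarrow> y \<in> T \<Longrightarrow> \<kappa> * \<bar>x - y\<bar> \<le> dist (f x) (f y)"
  shows "ennreal \<kappa> * emeasure lborel T \<le> hausdorff1_outer (f ` T)"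
proof -
  have "ennreal \<kappa> * emeasure lborel T \<le> hausdorff1_pre 1 (f ` T)"
  proof (rule hausdorff1_pre_greatest)
    fix C :: "nat \<Rightarrow> complex set"
    assume C: "f ` T \<subseteq> (\<Union>i. C i)" "\<And>i. bounded (C i)"
    define P where "P i = {x \<in> T. f x \<in> C i}" for i
    have dP: "\<bar>x - y\<bar> \<le> diameter (C i) / \<kappa>" if "x \<in> P i" "y \<in> P i" for x y i
    proof -
      have "\<kappa> * \<bar>x - y\<bar> \<le> dist (f x) (f y)" using that by (intro exp) (auto simp: P_def)
      also have "\<dots> \<le> diameter (C i)"
        using that C(2) by (intro diameter_bounded_bound) (auto simp: P_def)
      finally show ?thesis using \<open>0 < \<kappa>\<close> by (simp add: field_simps)
    qed
    have dC: "0 \<le> diameter (C i)" for i using C(2) by (rule diameter_ge_0)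
    define J where "J i = (if P i = {} then {} else {Sup (P i) - diameter (C i) / \<kappa> .. Sup (P i)})" for i
    have PJ: "P i \<subseteq> J i" for i
    proof
      fix x assume x: "x \<in> P i"
      have "bdd_above (P i)"
        using dP[OF _ x] by (intro bdd_aboveI[of _ "x + diameter (C i) / \<kappa>"]) (smt (verit))
      then have "x \<le> Sup (P i)" using x by (rule cSup_upper[rotated])
      moreover have "Sup (P i) \<le> x + diameter (C i) / \<kappa>"
        using dP[OF _ x] x by (intro cSup_least) (auto, smt (verit))
      ultimately show "x \<in> J i" using x by (auto simp: J_def)
    qed
    have eJ: "emeasure lborel (J i) \<le> ennreal (diameter (C i) / \<kappa>)" for i
      using dC[of i] \<open>0 < \<kappa>\<close> by (auto simp: J_def)
    have "emeasure lborel T \<le> emeasure lborel (\<Union>i. J i)"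
    proof (rule emeasure_mono)
      show "T \<subseteq> (\<Union>i. J i)" using C(1) PJ by (force simp: P_def)
    qed (auto simp: J_def)
    also have "\<dots> \<le> (\<Sum>i. emeasure lborel (J i))"
      by (rule emeasure_subadditive_countably) (auto simp: J_def)
    also have "\<dots> \<le> (\<Sum>i. ennreal (diameter (C i) / \<kappa>))" by (intro suminf_le eJ) auto
    finally have "ennreal \<kappa> * emeasure lborel T \<le> ennreal \<kappa> * (\<Sum>i. ennreal (diameter (C i) / \<kappa>))"
      by (rule mult_left_mono) simp
    also have "\<dots> = (\<Sum>i. ennreal \<kappa> * ennreal (diameter (C i) / \<kappa>))" by simp
    also have "\<dots> = (\<Sum>i. ennreal (diameter (C i)))"
      using \<open>0 < \<kappa>\<close> by (intro suminf_cong) (simp flip: ennreal_mult')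
    finally show "ennreal \<kappa> * emeasure lborel T \<le> (\<Sum>i. ennreal (diameter (C i)))" .
  qed
  also have "\<dots> \<le> hausdorff1_outer (f ` T)" by (rule hausdorff1_pre_le_outer) simp
  finally show ?thesis .
qed


lemma continuous_image_atLeastLessThan_borel:
  fixes f :: "real \<Rightarrow> 'a::t2_space"
  assumes "continuous_on UNIV f"
  shows "f ` {a..<b} \<in> sets borel"
proof -
  have "{a..<b} = (\<Union>n. {a..b - 1 / real (Suc n)})"
  proof (intro set_eqI iffI)
    fix x assume "x \<in> {a..<b}"
    moreover from this obtain n where "1 / real (Suc n) < b - x"
      using nat_approx_posE[of "b - x"] by auto
    ultimately show "x \<in> (\<Union>n. {a..b - 1 / real (Suc n)})"
      by (intro UN_I[of n]) auto
  next
    fix x assume "x \<in> (\<Union>n. {a..b - 1 / real (Suc n)})"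
    then obtain n where "a \<le> x" "x \<le> b - 1 / real (Suc n)" by auto
    moreover have "0 < 1 / real (Suc n)" by simp
    ultimately show "x \<in> {a..<b}" unfolding atLeastLessThan_iff by linarith
  qed
  then have "f ` {a..<b} = (\<Union>n. f ` {a..b - 1 / real (Suc n)})" by auto
  moreover have "closed (f ` {a..b - 1 / real (Suc n)})" for n
    using assms by (intro compact_imp_closed compact_continuous_image) (auto intro: continuous_on_subset)
  ultimately show ?thesis by auto
qed

text \<open>
  A graph over a bounded interval is the image of that interval under \<open>x \<mapsto> x + \<i> * h x\<close>, rotated back by \<open>c\<close>.
\<close>

lemma hausdorff1_finite_graph:
  assumes "M-lipschitz_on UNIV h" and "norm c = 1"
  shows "hausdorff1_outer {z. Im (c * z) = h (Re (c * z)) \<and> \<bar>Re (c * z) - m\<bar> \<le> r} < top"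
proof (cases "0 \<le> r")
  case True
  have c0: "c \<noteq> 0" using assms(2) by auto
  define f where "f x = Complex x (h x) / c" for x
  have "(1 + M)-lipschitz_on {m - r..m + r} f"
  proof (rule lipschitz_onI)
    fix x y :: real
    have "dist (f x) (f y) = cmod (Complex x (h x) / c - Complex y (h y) / c)"
      by (simp add: dist_norm f_def)
    also have "\<dots> = cmod (Complex (x - y) (h x - h y))"
      using assms(2) by (simp flip: diff_divide_distrib add: norm_divide complex_diff)
    also have "\<dots> \<le> \<bar>x - y\<bar> + \<bar>h x - h y\<bar>"
      using cmod_le[of "Complex (x - y) (h x - h y)"] by simp
    also have "\<bar>h x - h y\<bar> \<le> M * \<bar>x - y\<bar>"
      using lipschitz_onD[OF assms(1), of x y] by (simp add: dist_real_def)
    finally show "dist (f x) (f y) \<le> (1 + M) * dist x y" by (simp add: dist_real_def algebra_simps)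
  qed (use lipschitz_on_nonneg[OF assms(1)] in auto)
  then have "hausdorff1_outer (f ` {m - r..m + r}) \<le> ennreal ((1 + M) * (m + r - (m - r)))"
    by (rule hausdorff1_outer_lipschitz_image) (use True in auto)
  moreover have "{z. Im (c * z) = h (Re (c * z)) \<and> \<bar>Re (c * z) - m\<bar> \<le> r} \<subseteq> f ` {m - r..m + r}"
  proof
    fix z assume z: "z \<in> {z. Im (c * z) = h (Re (c * z)) \<and> \<bar>Re (c * z) - m\<bar> \<le> r}"
    have "z = f (Re (c * z))"
    proof -
      have "Complex (Re (c * z)) (h (Re (c * z))) = c * z" using z by (simp add: complex_eq_iff)
      then show ?thesis using c0 by (simp add: f_def)
    qed
    moreover have "Re (c * z) \<in> {m - r..m + r}" using z by (auto simp: abs_le_iff)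
    ultimately show "z \<in> f ` {m - r..m + r}" by blast
  qed
  ultimately show ?thesis
    using hausdorff1_outer_measure_space
    by (meson ennreal_less_top increasingD le_less_trans outer_measure_space_def UNIV_I)
next
  case False
  then have e: "{z. Im (c * z) = h (Re (c * z)) \<and> \<bar>Re (c * z) - m\<bar> \<le> r} = {}" by auto
  show ?thesis using hausdorff1_outer_measure_space
    unfolding e by (simp add: outer_measure_space_def positive_def)
qed

text \<open>
  Near each of its points the frontier lies on a Lipschitz graph: a point strictly above the graph is
  interior to \<open>\<Omega>\<close>, and one strictly below is exterior. Compactness leaves finitely many graphs.
\<close>

lemma hausdorff1_frontier_finite:
  assumes lip: "lipschitz_boundary \<Omega>" and "open \<Omega>" "bounded \<Omega>"
  shows "emeasure hausdorff1 (frontier \<Omega>) < top"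
proof -
  have cpt: "compact (frontier \<Omega>)"
    using \<open>bounded \<Omega>\<close> by (rule compact_frontier_bounded)
  have mono: "hausdorff1_outer A \<le> hausdorff1_outer B" if "A \<subseteq> B" for A B
    using hausdorff1_outer_measure_space that by (auto simp: outer_measure_space_def increasing_def)
  have "\<exists>r>0. hausdorff1_outer (frontier \<Omega> \<inter> ball p r) < top" if p: "p \<in> frontier \<Omega>" for p
  proof -
    obtain r c h M where r: "0 < r" and c: "norm c = 1" and h: "M-lipschitz_on UNIV (h :: real \<Rightarrow> real)"
      and eq: "\<Omega> \<inter> ball p r = {z \<in> ball p r. h (Re (c * z)) < Im (c * z)}"
      using lip p unfolding lipschitz_boundary_def by blast
    have cont: "continuous_on UNIV h" using h by (rule lipschitz_on_continuous_on)
    have "frontier \<Omega> \<inter> ball p r \<subseteq> {z. Im (c * z) = h (Re (c * z)) \<and> \<bar>Re (c * z) - Re (c * p)\<bar> \<le> r}"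
    proof
      fix z assume z: "z \<in> frontier \<Omega> \<inter> ball p r"
      have zO: "z \<notin> \<Omega>" using z \<open>open \<Omega>\<close> by (auto simp: frontier_def interior_open)
      then have "\<not> h (Re (c * z)) < Im (c * z)" using eq z by blast
      moreover have "\<not> Im (c * z) < h (Re (c * z))"
      proof
        assume lt: "Im (c * z) < h (Re (c * z))"
        let ?U = "ball p r \<inter> {w. Im (c * w) < h (Re (c * w))}"
        have "open {w. Im (c * w) < h (Re (c * w))}"
          by (intro open_Collect_less continuous_intros continuous_on_compose2[OF cont]) auto
        then have "open ?U" by auto
        moreover have "z \<in> ?U" using z lt by auto
        moreover have "?U \<inter> \<Omega> = {}" using eq by (auto simp del: mem_ball dest: less_asym)
        ultimately have "z \<notin> closure \<Omega>"
          by (metis (no_types, lifting) closure_iff_nhds_not_empty disjoint_iff order_refl inf_commute)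
        with z show False by (auto simp: frontier_def)
      qed
      moreover have "\<bar>Re (c * z) - Re (c * p)\<bar> \<le> cmod (c * z - c * p)"
        using abs_Re_le_cmod[of "c * z - c * p"] by simp
      moreover have "cmod (c * z - c * p) = cmod (z - p)"
        using c by (metis mult_1 norm_mult right_diff_distrib)
      moreover have "cmod (z - p) \<le> r" using z by (simp add: dist_norm norm_minus_commute)
      ultimately show "z \<in> {z. Im (c * z) = h (Re (c * z)) \<and> \<bar>Re (c * z) - Re (c * p)\<bar> \<le> r}"
        by auto
    qed
    then have "hausdorff1_outer (frontier \<Omega> \<inter> ball p r)
        \<le> hausdorff1_outer {z. Im (c * z) = h (Re (c * z)) \<and> \<bar>Re (c * z) - Re (c * p)\<bar> \<le> r}" by (rule mono)
    also have "\<dots> < top" using h c by (rule hausdorff1_finite_graph)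
    finally show ?thesis using r by auto
  qed
  then obtain R where R: "\<And>p. p \<in> frontier \<Omega> \<Longrightarrow> 0 < R p"
      "\<And>p. p \<in> frontier \<Omega> \<Longrightarrow> hausdorff1_outer (frontier \<Omega> \<inter> ball p (R p)) < top" by metis
  have "frontier \<Omega> \<subseteq> (\<Union>p\<in>frontier \<Omega>. ball p (R p))" using R(1) by auto
  then obtain K where K: "K \<subseteq> frontier \<Omega>" "finite K" "frontier \<Omega> \<subseteq> (\<Union>p\<in>K. ball p (R p))"
    using compactE_image[OF cpt, of "frontier \<Omega>" "\<lambda>p. ball p (R p)"] by auto
  have "hausdorff1_outer (\<Union>p\<in>K. frontier \<Omega> \<inter> ball p (R p)) < top"
    using K(2,1)
  proof (induction K)
    case empty
    then show ?case using hausdorff1_outer_measure_space by (simp add: outer_measure_space_def positive_def)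
  next
    case (insert p K)
    have "hausdorff1_outer (\<Union>p\<in>insert p K. frontier \<Omega> \<inter> ball p (R p))
      \<le> hausdorff1_outer (frontier \<Omega> \<inter> ball p (R p)) + hausdorff1_outer (\<Union>p\<in>K. frontier \<Omega> \<inter> ball p (R p))"
      using outer_measure_Un[OF hausdorff1_outer_measure_space] by simp
    also have "\<dots> < top" using insert R(2)[of p] by (simp add: less_top[symmetric])
    finally show ?case .
  qed
  moreover have "frontier \<Omega> \<subseteq> (\<Union>p\<in>K. frontier \<Omega> \<inter> ball p (R p))" using K by auto
  ultimately have "hausdorff1_outer (frontier \<Omega>) < top"
    by (rule le_less_trans[OF mono, rotated])
  then show ?thesis by (simp add: emeasure_hausdorff1)
qed

section \<open>Arc length on circles\<close>

text \<open>
  A chord compared with its arc: \<open>2 * sin t\<close> is at least \<open>2 * t * cos h\<close> for \<open>t\<close> between \<open>0\<close> and \<open>h\<close>, by the mean value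
  theorem. The factor \<open>cos h\<close> tends to \<open>1\<close> for short arcs.
\<close>

lemma dist_cis_ge:
  assumes "\<bar>x - y\<bar> \<le> 2 * h" "0 \<le> h" "h \<le> pi / 2"
  shows "cos h * \<bar>x - y\<bar> \<le> cmod (cis x - cis y)"
proof -
  define t where "t = \<bar>x - y\<bar> / 2"
  have t: "0 \<le> t" "t \<le> h" using assms by (auto simp: t_def)
  have "cos h * t \<le> sin t"
  proof (cases "t = 0")
    case False
    then obtain \<xi> where \<xi>: "0 < \<xi>" "\<xi> < t" "sin t - sin 0 = (t - 0) * cos \<xi>"
      using MVT2[of 0 t sin cos] t by (auto intro: DERIV_sin)
    have "cos h \<le> cos \<xi>" using \<xi> t assms by (subst cos_mono_le_eq) auto
    then show ?thesis using \<xi>(3) t by (simp add: mult_left_mono mult.commute)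
  qed auto
  have "(cmod (cis x - cis y))\<^sup>2 = (cos x - cos y)\<^sup>2 + (sin x - sin y)\<^sup>2"
    by (simp add: cmod_power2)
  also have "\<dots> = 2 - 2 * cos (x - y)"
    using sin_cos_squared_add[of x] sin_cos_squared_add[of y]
    by (simp add: cos_diff power2_eq_square algebra_simps)
  also have "cos (x - y) = cos (2 * t)" by (simp add: t_def abs_if cos_diff)
  also have "2 - 2 * cos (2 * t) = (2 * sin t)\<^sup>2"
    by (simp add: cos_double_sin power2_eq_square)
  finally have "cmod (cis x - cis y) = \<bar>2 * sin t\<bar>"
    by (metis abs_norm_cancel real_sqrt_abs)
  with \<open>cos h * t \<le> sin t\<close> show ?thesis by (simp add: t_def)
qed

lemma sphere_eq_cis_image:
  assumes "0 \<le> (r::real)"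
  shows "sphere c r = (\<lambda>t. c + of_real r * cis t) ` {0..<2 * pi}"
proof (intro set_eqI iffI)
  fix z assume z: "z \<in> sphere c r"
  define t where "t = Arg2pi (z - c)"
  have "z - c = of_real (cmod (z - c)) * cis t"
    unfolding t_def using Arg2pi[of "z - c"] by (simp add: is_Arg_def cis_conv_exp)
  moreover have "cmod (z - c) = r" using z by (simp add: dist_norm norm_minus_commute)
  ultimately have "z = c + of_real r * cis t" by (simp add: algebra_simps)
  moreover have "t \<in> {0..<2 * pi}" using Arg2pi[of "z - c"] by (simp add: t_def)
  ultimately show "z \<in> (\<lambda>t. c + of_real r * cis t) ` {0..<2 * pi}" by blast
qed (use assms in \<open>auto simp: dist_norm norm_mult\<close>)

lemma inj_on_cis: "inj_on cis {0..<2 * pi}"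
proof (rule inj_onI)
  fix x y assume "x \<in> {0..<2 * pi}" "y \<in> {0..<2 * pi}" "cis x = cis y"
  moreover have "Arg2pi (cis t) = t" if "t \<in> {0..<2 * pi}" for t
    using that by (intro Arg2pi_unique[of 1]) (auto simp: cis_conv_exp)
  ultimately show "x = y" by metis
qed

context
  fixes c :: complex and r :: real
  assumes r: "0 < r"
begin

text \<open>
  The parametrisation of the circle expands distances by nearly \<open>r\<close> only on short arcs. The
  circle is therefore cut into \<open>n\<close> arcs, on which the factor is \<open>r * cos (pi / n)\<close>, and \<open>n\<close> tends to infinity.
\<close>

lemma hausdorff1_circle_ge:
  assumes E: "E \<in> sets borel"
  shows "ennreal r * emeasure lborel {t \<in> {0..<2 * pi}. c + of_real r * cis t \<in> E}
           \<le> emeasure hausdorff1 (E \<inter> sphere c r)"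
proof -
  define f where "f t = c + of_real r * cis t" for t
  have contf: "continuous_on UNIV f" unfolding f_def by (intro continuous_intros)
  have [measurable]: "f \<in> borel_measurable borel" using contf by (rule borel_measurable_continuous_onI)
  have inj: "inj_on f {0..<2 * pi}"
    using inj_on_cis r by (auto simp: f_def inj_on_def)
  define T where "T = {t \<in> {0..<2 * pi}. f t \<in> E}"
  have T: "T \<in> sets lborel" unfolding T_def using E by measurable
  have main: "ennreal (r * cos (pi / real n)) * emeasure lborel T \<le> emeasure hausdorff1 (E \<inter> sphere c r)"
    if n: "3 \<le> n" for n :: nat
  proof -
    define h where "h = 2 * pi / real n"
    have h: "0 < h" using n by (simp add: h_def)
    have nh: "real n * h = 2 * pi" using n by (simp add: h_def)
    define J where "J j = {real j * h..<real (Suc j) * h}" for j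
    have Jsub: "J j \<subseteq> {0..<2 * pi}" if "j < n" for j
    proof -
      have "real (Suc j) * h \<le> real n * h" using that h by (intro mult_right_mono) auto
      then show ?thesis using h nh by (auto simp: J_def)
    qed
    have Jdisj: "disjoint_family_on J {..<n}"
    proof -
      have "J i \<inter> J j = {}" if "i < j" for i j
      proof -
        have "real (Suc i) * h \<le> real j * h" using that h by (intro mult_right_mono) auto
        then show ?thesis by (auto simp: J_def)
      qed
      then show ?thesis unfolding disjoint_family_on_def by (metis Int_commute linorder_neqE_nat)
    qed
    have Jun: "(\<Union>j<n. J j) = {0..<2 * pi}"
    proof (intro antisym subsetI)
      fix x assume x: "x \<in> {0..<2 * pi}"
      define j where "j = nat \<lfloor>x / h\<rfloor>"
      have nn: "0 \<le> x / h" using x h by simp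
      have j: "real j \<le> x / h" "x / h < real j + 1" using nn by (auto simp: j_def)
      have "x / h < real n" using x h nh by (simp add: field_simps)
      then have "j < n" using j by linarith
      moreover have "x \<in> J j" using j h by (auto simp: J_def field_simps)
      ultimately show "x \<in> (\<Union>j<n. J j)" by auto
    qed (use Jsub in blast)
    have cosp: "0 < cos (pi / real n)"
    proof (rule cos_gt_zero)
      show "pi / real n < pi / 2" using n by (intro divide_strict_left_mono) auto
    qed (use n in auto)
    have piece: "ennreal (r * cos (pi / real n)) * emeasure lborel (T \<inter> J j)
        \<le> emeasure hausdorff1 (E \<inter> f ` J j)" if j: "j < n" for j
    proof -
      have "ennreal (r * cos (pi / real n)) * emeasure lborel (T \<inter> J j) \<le> hausdorff1_outer (f ` (T \<inter> J j))"
      proof (rule hausdorff1_outer_expanding_image)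
        show "T \<inter> J j \<in> sets lborel" using T by (auto simp: J_def)
        show "0 < r * cos (pi / real n)" using r cosp by simp
        fix x y assume xy: "x \<in> T \<inter> J j" "y \<in> T \<inter> J j"
        have "cos (pi / real n) * \<bar>x - y\<bar> \<le> cmod (cis x - cis y)"
        proof (rule dist_cis_ge)
          show "\<bar>x - y\<bar> \<le> 2 * (pi / real n)" 
          proof -
            have "2 * (pi / real n) = h" by (simp add: h_def)
            then show ?thesis using xy by (auto simp: J_def algebra_simps abs_le_iff)
          qed
          show "pi / real n \<le> pi / 2" using n by (intro divide_left_mono) auto
        qed simp
        then have "r * cos (pi / real n) * \<bar>x - y\<bar> \<le> r * cmod (cis x - cis y)"
          using r by (simp add: mult.assoc)
        also have "\<dots> = dist (f x) (f y)"
          using r by (simp add: dist_norm f_def norm_mult flip: right_diff_distrib)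
        finally show "r * cos (pi / real n) * \<bar>x - y\<bar> \<le> dist (f x) (f y)" .
      qed
      also have "f ` (T \<inter> J j) = E \<inter> f ` J j" using Jsub[OF j] by (auto simp: T_def)
      also have "hausdorff1_outer (E \<inter> f ` J j) = emeasure hausdorff1 (E \<inter> f ` J j)"
        using E continuous_image_atLeastLessThan_borel[OF contf] by (subst emeasure_hausdorff1) (auto simp: J_def)
      finally show ?thesis .
    qed
    have "emeasure lborel T = emeasure lborel (\<Union>j<n. T \<inter> J j)"
      using Jun by (intro arg_cong[where f = "emeasure lborel"]) (auto simp: T_def)
    also have "\<dots> = (\<Sum>j<n. emeasure lborel (T \<inter> J j))"
    proof (rule sum_emeasure[symmetric])
      show "disjoint_family_on (\<lambda>j. T \<inter> J j) {..<n}"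
        using Jdisj unfolding disjoint_family_on_def by blast
    qed (use T in \<open>auto simp: J_def\<close>)
    finally have "ennreal (r * cos (pi / real n)) * emeasure lborel T
        = (\<Sum>j<n. ennreal (r * cos (pi / real n)) * emeasure lborel (T \<inter> J j))"
      by (simp add: sum_distrib_left)
    also have "\<dots> \<le> (\<Sum>j<n. emeasure hausdorff1 (E \<inter> f ` J j))"
      by (intro sum_mono piece) auto
    also have "\<dots> = emeasure hausdorff1 (\<Union>j<n. E \<inter> f ` J j)"
    proof (rule sum_emeasure)
      show "(\<lambda>j. E \<inter> f ` J j) ` {..<n} \<subseteq> sets hausdorff1"
        using E continuous_image_atLeastLessThan_borel[OF contf] by (auto simp: J_def)
      show "disjoint_family_on (\<lambda>j. E \<inter> f ` J j) {..<n}"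
        unfolding disjoint_family_on_def
      proof (intro ballI impI)
        fix i j assume ij: "i \<in> {..<n}" "j \<in> {..<n}" "i \<noteq> j"
        then have "J i \<inter> J j = {}" using Jdisj by (auto simp: disjoint_family_on_def)
        then have "f ` J i \<inter> f ` J j = {}"
          using ij Jsub inj_on_image_Int[OF inj, of "J i" "J j"] by auto
        then show "E \<inter> f ` J i \<inter> (E \<inter> f ` J j) = {}" by blast
      qed
    qed simp
    also have "\<dots> \<le> emeasure hausdorff1 (E \<inter> sphere c r)"
      using E r by (intro emeasure_mono) (auto simp: f_def dist_norm norm_mult)
    finally show ?thesis .
  qed
  have Tfin: "emeasure lborel T < top"
  proof -
    have "emeasure lborel T \<le> emeasure lborel {0..<2 * pi}" by (intro emeasure_mono) (auto simp: T_def)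
    then show ?thesis by (simp add: le_less_trans)
  qed
  then obtain v where v: "0 \<le> v" "emeasure lborel T = ennreal v" by (cases "emeasure lborel T") auto
  have lim: "(\<lambda>n. ennreal (r * cos (pi / real n) * v)) \<longlonglongrightarrow> ennreal (r * cos 0 * v)"
    by (intro tendsto_ennrealI tendsto_mult tendsto_const tendsto_cos) real_asymp
  have "ennreal (r * cos 0 * v) \<le> emeasure hausdorff1 (E \<inter> sphere c r)"
  proof (rule LIMSEQ_le_const2[OF lim], rule exI[of _ 3], intro allI impI)
    fix n :: nat assume "3 \<le> n"
    from main[OF this] show "ennreal (r * cos (pi / real n) * v) \<le> emeasure hausdorff1 (E \<inter> sphere c r)"
      using v(1) by (simp add: v(2) ennreal_mult''[symmetric] ennreal_mult')
  qed
  then have "ennreal r * emeasure lborel T \<le> emeasure hausdorff1 (E \<inter> sphere c r)"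
    using r v by (simp add: ennreal_mult)
  then show ?thesis unfolding T_def f_def .
qed

lemma hausdorff1_sphere_le: "emeasure hausdorff1 (sphere c r) \<le> ennreal (2 * pi * r)"
proof -
  have "r-lipschitz_on {0..2 * pi} (\<lambda>t. c + of_real r * cis t)"
  proof (rule lipschitz_onI)
    fix x y :: real
    have "cmod (cis x - cis y) \<le> \<bar>x - y\<bar>"
    proof -
      have "cmod (exp (\<i> * complex_of_real x) - exp (\<i> * complex_of_real y)) \<le> 1 * cmod (\<i> * complex_of_real x - \<i> * complex_of_real y)"
        by (rule field_differentiable_bound[of "{z. Re z = 0}" exp exp])
           (auto intro: DERIV_subset[OF DERIV_exp] simp: convex_def)
      then show ?thesis by (simp add: cis_conv_exp norm_mult flip: right_diff_distrib of_real_diff)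
    qed
    then show "dist (c + of_real r * cis x) (c + of_real r * cis y) \<le> r * dist x y"
      using r by (simp add: dist_norm norm_mult flip: right_diff_distrib)
  qed (use r in auto)
  then have "hausdorff1_outer ((\<lambda>t. c + of_real r * cis t) ` {0..2 * pi}) \<le> ennreal (r * (2 * pi - 0))"
    by (rule hausdorff1_outer_lipschitz_image) simp
  moreover have "(\<lambda>t. c + of_real r * cis t) ` {0..2 * pi} = sphere c r"
  proof
    show "sphere c r \<subseteq> (\<lambda>t. c + of_real r * cis t) ` {0..2 * pi}"
      using r by (subst sphere_eq_cis_image) auto
  qed (use r in \<open>auto simp: dist_norm norm_mult\<close>)
  ultimately show ?thesis by (subst emeasure_hausdorff1) (auto simp: mult_ac)
qed

text \<open>
  The lower bound holds for \<open>E\<close> and for its complement. The two bounds add up to \<open>2 * pi * r\<close>, which is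
  also an upper bound for the measure of the whole circle, so neither inequality can be strict.
\<close>

lemma emeasure_hausdorff1_circle:
  assumes E: "E \<in> sets borel"
  shows "emeasure hausdorff1 (E \<inter> sphere c r)
           = ennreal r * emeasure lborel {t \<in> {0..<2 * pi}. c + of_real r * cis t \<in> E}"
proof -
  let ?\<nu> = "\<lambda>E. ennreal r * emeasure lborel {t \<in> {0..<2 * pi}. c + of_real r * cis t \<in> E}"
  let ?\<mu> = "\<lambda>E. emeasure hausdorff1 (E \<inter> sphere c r)"
  have [measurable]: "(\<lambda>t. c + of_real r * cis t) \<in> borel_measurable borel"
    by (intro borel_measurable_continuous_onI continuous_intros)
  have E': "- E \<in> sets borel" using E by auto
  note E[measurable] E'[measurable]
  have "?\<mu> E + ?\<mu> (- E) = emeasure hausdorff1 ((E \<inter> sphere c r) \<union> (- E \<inter> sphere c r))"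
    using E by (intro plus_emeasure) auto
  also have "(E \<inter> sphere c r) \<union> (- E \<inter> sphere c r) = sphere c r" by auto
  also have "emeasure hausdorff1 (sphere c r) \<le> ennreal (2 * pi * r)" by (rule hausdorff1_sphere_le)
  also have "\<dots> = ennreal r * emeasure lborel {0..<2 * pi}"
    using r by (simp add: ennreal_mult[symmetric] mult.commute)
  also have "emeasure lborel {0..<2 * pi} = emeasure lborel ({t \<in> {0..<2 * pi}. c + of_real r * cis t \<in> E}
      \<union> {t \<in> {0..<2 * pi}. c + of_real r * cis t \<in> - E})"
    by (intro arg_cong[where f = "emeasure lborel"]) auto
  also have "\<dots> = emeasure lborel {t \<in> {0..<2 * pi}. c + of_real r * cis t \<in> E}
      + emeasure lborel {t \<in> {0..<2 * pi}. c + of_real r * cis t \<in> - E}"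
    by (intro plus_emeasure[symmetric]) (auto, measurable)
  also have "ennreal r * \<dots> = ?\<nu> E + ?\<nu> (- E)" by (rule distrib_left)
  finally have sum: "?\<mu> E + ?\<mu> (- E) \<le> ?\<nu> E + ?\<nu> (- E)" .
  have fin: "?\<mu> (- E) < top"
  proof -
    have "?\<mu> (- E) \<le> emeasure hausdorff1 (sphere c r)" by (intro emeasure_mono) auto
    also have "\<dots> < top" using hausdorff1_sphere_le by (rule le_less_trans) simp
    finally show ?thesis .
  qed
  have "?\<mu> E + ?\<mu> (- E) \<le> ?\<nu> E + ?\<mu> (- E)"
    using sum hausdorff1_circle_ge[OF E'] by (meson add_left_mono order_trans)
  then have "?\<mu> E \<le> ?\<nu> E" using fin[THEN less_imp_neq] by simp
  with hausdorff1_circle_ge[OF E] show ?thesis by (rule antisym[rotated])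
qed

lemma emeasure_hausdorff1_sphere: "emeasure hausdorff1 (sphere c r) = ennreal (2 * pi * r)"
proof -
  have "{t \<in> {0..<2 * pi}. c + of_real r * cis t \<in> UNIV} = {0..<2 * pi}" by auto
  then show ?thesis
    using emeasure_hausdorff1_circle[of UNIV] r by (simp add: ennreal_mult[symmetric] mult.commute)
qed

lemma perimeter_ball: "perimeter (ball c r) = 2 * pi * r"
  using r by (simp add: perimeter_def frontier_ball measure_def emeasure_hausdorff1_sphere)

lemma nn_integral_boundary_measure_ball:
  assumes g[measurable]: "g \<in> borel_measurable borel"
  shows "(\<integral>\<^sup>+z. g z \<partial>boundary_measure (ball c r))
       = ennreal r * (\<integral>\<^sup>+t\<in>{0..<2 * pi}. g (c + of_real r * cis t) \<partial>lborel)"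
proof -
  have [measurable]: "(\<lambda>t. c + of_real r * cis t) \<in> borel_measurable borel"
    by (intro borel_measurable_continuous_onI continuous_intros)
  have "density hausdorff1 (indicator (sphere c r))
      = distr (density lborel (\<lambda>t. ennreal r * indicator {0..<2 * pi} t)) borel (\<lambda>t. c + of_real r * cis t)"
    (is "?M = ?N")
  proof (rule measure_eqI)
    fix E assume "E \<in> sets ?M"
    then have E[measurable]: "E \<in> sets borel" by simp
    have [simp]: "(\<lambda>t. c + of_real r * cis t) -` E \<in> sets borel"
      by (rule measurable_sets_borel[OF _ E]) measurable
    have m: "{t \<in> {0..<2 * pi}. c + of_real r * cis t \<in> E} \<in> sets borel" by measurable
    have "emeasure ?M E = emeasure hausdorff1 (E \<inter> sphere c r)"
    proof (subst emeasure_density)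
      show "indicator (sphere c r) \<in> borel_measurable hausdorff1"
        by (rule borel_measurable_indicator) simp
    qed (auto simp flip: indicator_inter_arith simp: Int_commute)
    also have "\<dots> = ennreal r * emeasure lborel {t \<in> {0..<2 * pi}. c + of_real r * cis t \<in> E}"
      by (rule emeasure_hausdorff1_circle) fact
    also have "\<dots> = ennreal r * (\<integral>\<^sup>+t. indicator {t \<in> {0..<2 * pi}. c + of_real r * cis t \<in> E} t \<partial>lborel)"
      using m by simp
    also have "\<dots> = (\<integral>\<^sup>+t. ennreal r * indicator {t \<in> {0..<2 * pi}. c + of_real r * cis t \<in> E} t \<partial>lborel)"
      using m by (intro nn_integral_cmult[symmetric]) simp
    also have "\<dots> = emeasure ?N E"
      by (subst emeasure_distr, simp, simp, subst emeasure_density)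
         (auto intro!: nn_integral_cong simp: indicator_def)
    finally show "emeasure ?M E = emeasure ?N E" .
  qed simp
  then have "(\<integral>\<^sup>+z. g z \<partial>?M) = (\<integral>\<^sup>+z. g z \<partial>?N)" by simp
  moreover have "(\<integral>\<^sup>+z. g z \<partial>?M) = (\<integral>\<^sup>+z. g z \<partial>boundary_measure (ball c r))"
  proof (subst nn_integral_density)
    show "indicator (sphere c r) \<in> borel_measurable hausdorff1"
      by (rule borel_measurable_indicator) simp
  qed (use r in \<open>simp_all add: boundary_measure_def frontier_ball nn_integral_restrict_space mult.commute\<close>)
  moreover have "(\<integral>\<^sup>+z. g z \<partial>?N) = ennreal r * (\<integral>\<^sup>+t\<in>{0..<2 * pi}. g (c + of_real r * cis t) \<partial>lborel)"
  proof -
    have "(\<integral>\<^sup>+z. g z \<partial>?N) = (\<integral>\<^sup>+t. ennreal r * indicator {0..<2 * pi} t * g (c + of_real r * cis t) \<partial>lborel)"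
      by (subst nn_integral_distr, simp, simp, subst nn_integral_density) simp_all
    also have "\<dots> = (\<integral>\<^sup>+t. ennreal r * (g (c + of_real r * cis t) * indicator {0..<2 * pi} t) \<partial>lborel)"
      by (rule nn_integral_cong) (simp add: mult_ac)
    also have "\<dots> = ennreal r * (\<integral>\<^sup>+t\<in>{0..<2 * pi}. g (c + of_real r * cis t) \<partial>lborel)"
      by (rule nn_integral_cmult) measurable
    finally show ?thesis .
  qed
  ultimately show ?thesis by simp
qed

end

section \<open>Conformal and polar changes of variables\<close>

text \<open>
  The change of variables theorem speaks about \<open>real ^ 'n\<close>. This identification carries it to the complex plane.
\<close>

lemma lborel_complex_vec2: "lborel = distr lborel borel (\<lambda>v::real^2. Complex (v $ 1) (v $ 2))"
proof (rule lborel_eqI)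
  have [measurable]: "(\<lambda>v::real^2. Complex (v $ 1) (v $ 2)) \<in> borel_measurable borel"
    unfolding Complex_eq by (intro borel_measurable_continuous_onI continuous_intros)
  fix l u :: complex assume le: "\<And>b. b \<in> Basis \<Longrightarrow> l \<bullet> b \<le> u \<bullet> b"
  have le': "Re l \<le> Re u" "Im l \<le> Im u" using le[of 1] le[of \<i>] by (auto simp: Basis_complex_def)
  have "(\<lambda>v::real^2. Complex (v $ 1) (v $ 2)) -` box l u = box (vector [Re l, Im l]) (vector [Re u, Im u])"
    by (auto simp: mem_box_cart in_box_complex_iff forall_2)
  then have "emeasure (distr lborel borel (\<lambda>v::real^2. Complex (v $ 1) (v $ 2))) (box l u)
     = emeasure lborel (box (vector [Re l, Im l]) (vector [Re u, Im u]) :: (real^2) set)"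
    by (subst emeasure_distr) auto
  also have "\<dots> = ennreal (\<Prod>b\<in>(Basis :: (real^2) set). (vector [Re u, Im u] - vector [Re l, Im l]) \<bullet> b)"
    using le' by (intro emeasure_lborel_box) (auto simp: Basis_vec_def inner_axis exhaust_2 UNIV_2)
  also have "(\<Prod>b\<in>(Basis :: (real^2) set). (vector [Re u, Im u] - vector [Re l, Im l]) \<bullet> b) = (\<Prod>b\<in>Basis. (u - l) \<bullet> b)"
    by (simp add: Basis_vec_def UNIV_2 Basis_complex_def inner_axis axis_eq_axis)
  finally show "emeasure (distr lborel borel (\<lambda>v::real^2. Complex (v $ 1) (v $ 2))) (box l u)
      = ennreal (\<Prod>b\<in>Basis. (u - l) \<bullet> b)" .
qed simp

text \<open>
  This description of the Lebesgue measure of the plane gives access to Tonelli's theorem.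
\<close>

lemma lborel_complex_pair: "lborel = distr (lborel \<Otimes>\<^sub>M lborel) borel (\<lambda>(x, y). Complex x y)"
  unfolding lborel_prod
proof (rule lborel_eqI)
  have [measurable]: "(\<lambda>(x, y). Complex x y) \<in> borel_measurable borel"
    unfolding Complex_eq split_def by (intro borel_measurable_continuous_onI continuous_intros)
  fix l u :: complex assume le: "\<And>b. b \<in> Basis \<Longrightarrow> l \<bullet> b \<le> u \<bullet> b"
  have le': "Re l \<le> Re u" "Im l \<le> Im u" using le[of 1] le[of \<i>] by (auto simp: Basis_complex_def)
  have "(\<lambda>(x, y). Complex x y) -` box l u = box (Re l, Im l) (Re u, Im u)"
    by (auto simp: in_box_complex_iff mem_box Basis_prod_def)
  then have "emeasure (distr lborel borel (\<lambda>(x, y). Complex x y)) (box l u)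
     = emeasure lborel (box (Re l, Im l) (Re u, Im u))"
    by (subst emeasure_distr) auto
  also have "\<dots> = ennreal (\<Prod>b\<in>Basis. ((Re u, Im u) - (Re l, Im l)) \<bullet> b)"
    using le' by (intro emeasure_lborel_box) (auto simp: Basis_prod_def)
  also have "(\<Prod>b\<in>Basis. ((Re u, Im u) - (Re l, Im l)) \<bullet> b) = (\<Prod>b\<in>Basis. (u - l) \<bullet> b)"
    by (simp add: Basis_prod_def Basis_complex_def)
  finally show "emeasure (distr lborel borel (\<lambda>(x, y). Complex x y)) (box l u)
      = ennreal (\<Prod>b\<in>Basis. (u - l) \<bullet> b)" .
qed simp

lemma change_of_variables_vec_real:
  fixes h :: "real^'n::{finite,wellorder} \<Rightarrow> real"
  assumes "S \<in> sets lebesgue"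
    and "\<And>x. x \<in> S \<Longrightarrow> (g has_derivative g' x) (at x within S)"
    and "inj_on g S"
  shows "(\<lambda>x. \<bar>det (matrix (g' x))\<bar> * h (g x)) absolutely_integrable_on S \<and>
           integral S (\<lambda>x. \<bar>det (matrix (g' x))\<bar> * h (g x)) = b
     \<longleftrightarrow> h absolutely_integrable_on (g ` S) \<and> integral (g ` S) h = b"
  using has_absolute_integral_change_of_variables[OF assms, of "\<lambda>x. vec (h x) :: real^1" "vec b"]
  unfolding absolutely_integrable_on_1_iff integral_on_1_eq
  by simp

lemma absolutely_integrable_nonneg_iff_nn_integral:
  fixes f :: "'a::euclidean_space \<Rightarrow> real"
  assumes f: "(\<lambda>x. f x * indicator S x) \<in> borel_measurable borel" and nn: "\<And>x. x \<in> S \<Longrightarrow> 0 \<le> f x"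
  shows "f absolutely_integrable_on S \<longleftrightarrow> (\<integral>\<^sup>+x\<in>S. ennreal (f x) \<partial>lborel) < top"
    and "f absolutely_integrable_on S \<Longrightarrow>
          (\<integral>\<^sup>+x\<in>S. ennreal (f x) \<partial>lborel) = ennreal (integral S f)"
proof -
  show eq: "(\<integral>\<^sup>+x\<in>S. ennreal (f x) \<partial>lborel) = ennreal (integral S f)"
    if "f absolutely_integrable_on S"
    using that nn by (intro nn_integral_has_integral_lebesgue')
      (auto simp: absolutely_integrable_on_def has_integral_integral)
  have e: "(\<integral>\<^sup>+x\<in>S. ennreal (f x) \<partial>lborel) = (\<integral>\<^sup>+x. ennreal (f x * indicator S x) \<partial>lborel)"
    by (rule nn_integral_cong) (auto simp: indicator_def)
  show "f absolutely_integrable_on S \<longleftrightarrow> (\<integral>\<^sup>+x\<in>S. ennreal (f x) \<partial>lborel) < top"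
  proof
    assume fin: "(\<integral>\<^sup>+x\<in>S. ennreal (f x) \<partial>lborel) < top"
    then obtain r where r: "0 \<le> r" "(\<integral>\<^sup>+x. ennreal (f x * indicator S x) \<partial>lborel) = ennreal r"
      unfolding e by (metis ennreal_cases less_irrefl)
    have "((\<lambda>x. f x * indicator S x) has_integral r) UNIV"
      using nn by (intro nn_integral_has_integral f r) (auto simp: indicator_def)
    moreover have "(\<lambda>x. f x * indicator S x) = (\<lambda>x. if x \<in> S then f x else 0)" by auto
    ultimately have "(f has_integral r) S" by (simp add: has_integral_restrict_UNIV)
    then show "f absolutely_integrable_on S"
      using nn by (intro nonnegative_absolutely_integrable_1) auto
  qed (use eq in auto)
qed

text \<open>
  Stated for nonnegative integrals, so that neither side has to be integrable. The absolute value on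
  the right of the assumption on \<open>J\<close> is the Jacobian determinant of the real-linear map \<open>g' x\<close>.
\<close>

lemma nn_integral_change_of_variables_complex:
  fixes g :: "complex \<Rightarrow> complex" and f :: "complex \<Rightarrow> real"
  assumes "open S" and der: "\<And>x. x \<in> S \<Longrightarrow> (g has_derivative g' x) (at x)" and inj: "inj_on g S"
    and J: "\<And>x. x \<in> S \<Longrightarrow> J x = \<bar>Re (g' x 1) * Im (g' x \<i>) - Im (g' x 1) * Re (g' x \<i>)\<bar>"
    and Jm: "(\<lambda>x. J x * indicator S x) \<in> borel_measurable borel"
    and fm: "(\<lambda>x. f x * indicator (g ` S) x) \<in> borel_measurable borel" and nn: "\<And>x. x \<in> g ` S \<Longrightarrow> 0 \<le> f x"
  shows "(\<integral>\<^sup>+z\<in>g ` S. ennreal (f z) \<partial>lborel)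
       = (\<integral>\<^sup>+z\<in>S. ennreal (J z * f (g z)) \<partial>lborel)"
proof -
  define V where "V v = Complex (v $ 1) (v $ 2)" for v :: "real^2"
  define W where "W z = (vector [Re z, Im z] :: real^2)" for z
  have VW [simp]: "V (W z) = z" and WV [simp]: "W (V v) = v" for z v
    by (auto simp: V_def W_def vec_eq_iff forall_2)
  have linV: "linear V"
    by (rule linearI) (auto simp: V_def complex_eq_iff)
  have linW: "linear W"
    by (rule linearI) (auto simp: W_def vec_eq_iff forall_2)
  have contV: "continuous_on UNIV V" and contW: "continuous_on UNIV W"
    using linV linW by (auto intro: linear_continuous_on simp: linear_conv_bounded_linear)
  have Vm [measurable]: "V \<in> borel_measurable borel" and Wm [measurable]: "W \<in> borel_measurable borel"
    using contV contW by (auto intro: borel_measurable_continuous_onI)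
  have transfer: "(\<integral>\<^sup>+z. k z \<partial>lborel) = (\<integral>\<^sup>+v. k (V v) \<partial>lborel)"
    if [measurable]: "k \<in> borel_measurable borel" for k :: "complex \<Rightarrow> ennreal"
    by (subst lborel_complex_vec2) (simp add: nn_integral_distr V_def[abs_def, symmetric])
  have WS: "W ` S = V -` S" by (auto simp: image_iff) (metis WV)
  have oWS: "open (W ` S)"
    unfolding WS using \<open>open S\<close> contV by (auto simp: continuous_on_open_vimage)
  have contg: "continuous_on S g"
    using der by (intro differentiable_imp_continuous_on)
       (auto simp: differentiable_on_def differentiable_def intro: has_derivative_at_withinI)
  have ogS: "open (g ` S)" using contg \<open>open S\<close> inj by (rule invariance_of_domain)
  define g2 where "g2 = W \<circ> g \<circ> V"
  have g2S: "g2 ` (W ` S) = V -` (g ` S)"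
    unfolding WS[symmetric] g2_def by (auto simp: image_iff) (metis VW WV)
  have bl: "bounded_linear V" "bounded_linear W" using linV linW by (simp_all add: linear_conv_bounded_linear)
  have der2: "(g2 has_derivative (W \<circ> g' (V v) \<circ> V)) (at v within W ` S)" if "v \<in> W ` S" for v
  proof -
    have "V v \<in> S" using that by auto
    have "(V has_derivative V) (at v)" by (rule bounded_linear_imp_has_derivative) (rule bl)
    moreover have "(g has_derivative g' (V v)) (at (V v))" using \<open>V v \<in> S\<close> by (rule der)
    moreover have "(W has_derivative W) (at (g (V v)))" by (rule bounded_linear_imp_has_derivative) (rule bl)
    ultimately have "(g2 has_derivative (W \<circ> g' (V v) \<circ> V)) (at v)"
      unfolding g2_def comp_assoc by (intro diff_chain_at) (auto simp: o_def)
    then show ?thesis by (rule has_derivative_at_withinI)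
  qed
  have inj2: "inj_on g2 (W ` S)"
    using inj unfolding g2_def inj_on_def by (metis VW comp_apply imageE)
  have axis: "V (axis 1 1) = 1" "V (axis 2 1) = \<i>"
    by (auto simp: V_def axis_def complex_eq_iff)
  have det: "\<bar>det (matrix (W \<circ> g' (V v) \<circ> V))\<bar> = J (V v)" if "v \<in> W ` S" for v
  proof -
    have "V v \<in> S" using that WS by blast
    then show ?thesis
      using J[of "V v"] by (simp add: det_2 matrix_def axis) (simp add: W_def mult.commute)
  qed
  have meas_f: "(\<lambda>z. ennreal (f z) * indicator (g ` S) z) \<in> borel_measurable borel"
  proof -
    have "(\<lambda>z. ennreal (f z) * indicator (g ` S) z) = (\<lambda>z. ennreal (f z * indicator (g ` S) z))"
      by (auto simp: indicator_def)
    then show ?thesis using fm by simp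
  qed
  have "continuous_on S g" by fact
  then have gm: "(\<lambda>x. if x \<in> S then g x else 0) \<in> borel_measurable borel"
    using \<open>open S\<close> by (intro borel_measurable_continuous_on_if) (auto intro: borel_open)
  have Jf: "(\<lambda>z. J z * f (g z) * indicator S z) \<in> borel_measurable borel"
  proof -
    have "(\<lambda>z. (J z * indicator S z) * ((\<lambda>x. f x * indicator (g ` S) x) (if z \<in> S then g z else 0))) \<in> borel_measurable borel"
      by (rule borel_measurable_times[OF Jm measurable_compose[OF gm fm]])
    also have "(\<lambda>z. (J z * indicator S z) * ((\<lambda>x. f x * indicator (g ` S) x) (if z \<in> S then g z else 0)))
        = (\<lambda>z. J z * f (g z) * indicator S z)" by (auto simp: indicator_def)
    finally show ?thesis .
  qed
  then have meas_Jf: "(\<lambda>z. ennreal (J z * f (g z)) * indicator S z) \<in> borel_measurable borel"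
  proof -
    have "(\<lambda>z. ennreal (J z * f (g z)) * indicator S z) = (\<lambda>z. ennreal (J z * f (g z) * indicator S z))"
      by (auto simp: indicator_def)
    then show ?thesis using Jf by simp
  qed
  have indV: "indicator A (V v) = indicator (V -` A) v" for A v by (auto simp: indicator_def)
  define L where "L v = \<bar>det (matrix (W \<circ> g' (V v) \<circ> V))\<bar> * f (V (g2 v))" for v
  have L: "L v = J (V v) * f (g (V v))" if "v \<in> W ` S" for v
    using det[OF that] by (simp add: L_def g2_def)
  have cov: "L absolutely_integrable_on (W ` S) \<and> integral (W ` S) L = b \<longleftrightarrow>
     (\<lambda>v. f (V v)) absolutely_integrable_on (V -` (g ` S)) \<and> integral (V -` (g ` S)) (\<lambda>v. f (V v)) = b" for b
    unfolding L_def g2S[symmetric]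
    by (rule change_of_variables_vec_real[OF _ der2 inj2]) (use oWS in auto)
  have m1: "(\<lambda>v. L v * indicator (W ` S) v) \<in> borel_measurable borel"
  proof -
    have "(\<lambda>v. L v * indicator (W ` S) v) = (\<lambda>v. (\<lambda>z. J z * f (g z) * indicator S z) (V v))"
      using L by (auto simp: indicator_def WS)
    then show ?thesis using measurable_compose[OF Vm Jf] by simp
  qed
  have m2: "(\<lambda>v. f (V v) * indicator (V -` (g ` S)) v) \<in> borel_measurable borel"
    using measurable_compose[OF Vm fm] by (simp add: indV)
  have n1: "0 \<le> L v" if "v \<in> W ` S" for v
    using that nn by (auto simp: L_def g2_def)
  have n2: "0 \<le> f (V v)" if "v \<in> V -` (g ` S)" for v
    using that nn by auto
  note A1 = absolutely_integrable_nonneg_iff_nn_integral[of L "W ` S", OF m1 n1]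
  note A2 = absolutely_integrable_nonneg_iff_nn_integral[of "\<lambda>v. f (V v)" "V -` (g ` S)", OF m2 n2]
  have "(\<integral>\<^sup>+v\<in>W ` S. ennreal (L v) \<partial>lborel)
      = (\<integral>\<^sup>+v\<in>V -` (g ` S). ennreal (f (V v)) \<partial>lborel)"
  proof (cases "(\<lambda>v. f (V v)) absolutely_integrable_on (V -` (g ` S))")
    case True
    with cov have "L absolutely_integrable_on (W ` S)"
        "integral (W ` S) L = integral (V -` (g ` S)) (\<lambda>v. f (V v))" by blast+
    with True show ?thesis using A1(2) A2(2) by simp
  next
    case False
    with cov have "\<not> L absolutely_integrable_on (W ` S)" by blast
    with False A1(1) A2(1) show ?thesis by (simp add: not_less top_unique)
  qed
  moreover have "(\<integral>\<^sup>+v\<in>W ` S. ennreal (L v) \<partial>lborel)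
     = (\<integral>\<^sup>+z\<in>S. ennreal (J z * f (g z)) \<partial>lborel)"
    unfolding transfer[OF meas_Jf] indV WS[symmetric]
    by (intro nn_integral_cong) (auto simp: L split: split_indicator)
  moreover have "(\<integral>\<^sup>+v\<in>V -` (g ` S). ennreal (f (V v)) \<partial>lborel)
     = (\<integral>\<^sup>+z\<in>g ` S. ennreal (f z) \<partial>lborel)"
    unfolding transfer[OF meas_f] indV ..
  ultimately show ?thesis by simp
qed

text \<open>
  For a holomorphic map the Cauchy--Riemann equations turn the Jacobian determinant into \<open>|F'|\<^sup>2\<close>.
\<close>

lemma nn_integral_conformal:
  fixes f :: "complex \<Rightarrow> real"
  assumes "open S" and hol: "F holomorphic_on S" and inj: "inj_on F S"
    and fm: "(\<lambda>x. f x * indicator (F ` S) x) \<in> borel_measurable borel" and nn: "\<And>x. x \<in> F ` S \<Longrightarrow> 0 \<le> f x"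
  shows "(\<integral>\<^sup>+z\<in>F ` S. ennreal (f z) \<partial>lborel)
       = (\<integral>\<^sup>+z\<in>S. ennreal ((cmod (deriv F z))\<^sup>2 * f (F z)) \<partial>lborel)"
proof (rule nn_integral_change_of_variables_complex[OF \<open>open S\<close> _ inj _ _ fm nn, where g' = "\<lambda>z. (*) (deriv F z)"])
  show "(F has_derivative (*) (deriv F x)) (at x)" if "x \<in> S" for x
    using holomorphic_derivI[OF hol \<open>open S\<close> that] by (simp add: has_field_derivative_def)
  show "(cmod (deriv F x))\<^sup>2 = \<bar>Re (deriv F x * 1) * Im (deriv F x * \<i>) - Im (deriv F x * 1) * Re (deriv F x * \<i>)\<bar>" for x
    by (simp add: cmod_power2 flip: power2_eq_square)
  have "continuous_on S (\<lambda>x. (cmod (deriv F x))\<^sup>2)"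
    using holomorphic_on_imp_continuous_on[OF holomorphic_deriv[OF hol \<open>open S\<close>]]
    by (intro continuous_intros)
  then have "(\<lambda>x. if x \<in> S then (cmod (deriv F x))\<^sup>2 else 0) \<in> borel_measurable borel"
    using \<open>open S\<close> by (intro borel_measurable_continuous_on_if) (auto intro: borel_open)
  moreover have "(\<lambda>x. if x \<in> S then (cmod (deriv F x))\<^sup>2 else 0) = (\<lambda>x. (cmod (deriv F x))\<^sup>2 * indicator S x)"
    by auto
  ultimately show "(\<lambda>x. (cmod (deriv F x))\<^sup>2 * indicator S x) \<in> borel_measurable borel"
    by (simp only:)
qed

lemma polar_inj_on:
  assumes "0 < (r::real)"
  shows "inj_on (\<lambda>z. c + of_real (r * Re z) * cis (Im z)) {z. 0 < Re z \<and> 0 < Im z \<and> Im z < 2 * pi}"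
proof (rule inj_onI)
  fix z w assume z: "z \<in> {z. 0 < Re z \<and> 0 < Im z \<and> Im z < 2 * pi}" and w: "w \<in> {z. 0 < Re z \<and> 0 < Im z \<and> Im z < 2 * pi}"
    and eq: "c + of_real (r * Re z) * cis (Im z) = c + of_real (r * Re w) * cis (Im w)"
  have eq': "of_real (r * Re z) * cis (Im z) = of_real (r * Re w) * cis (Im w)" using eq by simp
  then have "cmod (of_real (r * Re z) * cis (Im z)) = cmod (of_real (r * Re w) * cis (Im w))"
    by (rule arg_cong)
  then have re: "Re z = Re w" using z w assms by (simp add: norm_mult)
  have A: "Arg2pi (of_real (r * Re v) * cis (Im v)) = Im v" if "0 < Re v" "0 < Im v" "Im v < 2 * pi" for v
    using that assms by (intro Arg2pi_unique[of "r * Re v"]) (auto simp: cis_conv_exp)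
  have "Arg2pi (of_real (r * Re z) * cis (Im z)) = Arg2pi (of_real (r * Re w) * cis (Im w))"
    using eq' by (rule arg_cong)
  then have "Im z = Im w" using A[of z] A[of w] z w by auto
  with re show "z = w" by (simp add: complex_eq_iff)
qed

text \<open>
  Polar coordinates map a rectangle injectively onto the disk without the radius in direction \<open>1\<close>, which
  is a null set. Both orders of integration are needed: the lower bound for the eigenvalue of a disk
  argues on each ray, the mean value property on each circle.
\<close>

lemma nn_integral_polar:
  fixes f :: "complex \<Rightarrow> real"
  assumes fm [measurable]: "f \<in> borel_measurable borel" and nn: "\<And>z. z \<in> ball c r \<Longrightarrow> 0 \<le> f z" and r: "0 < r"
  shows "(\<integral>\<^sup>+z\<in>ball c r. ennreal (f z) \<partial>lborel)
       = (\<integral>\<^sup>+t. (\<integral>\<^sup>+x\<in>{0<..<1}. ennreal (r\<^sup>2 * (x * f (c + of_real (r * x) * cis t))) \<partial>lborel)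
            * indicator {0<..<2*pi} t \<partial>lborel)" (is ?th1)
    and "(\<integral>\<^sup>+z\<in>ball c r. ennreal (f z) \<partial>lborel)
       = (\<integral>\<^sup>+x. (\<integral>\<^sup>+t\<in>{0<..<2*pi}. ennreal (r\<^sup>2 * (x * f (c + of_real (r * x) * cis t))) \<partial>lborel)
            * indicator {0<..<1} x \<partial>lborel)" (is ?th2)
proof -
  define g where "g z = c + of_real (r * Re z) * cis (Im z)" for z
  define S where "S = {z. 0 < Re z \<and> Re z < 1 \<and> 0 < Im z \<and> Im z < 2 * pi}"
  have "S = {z. 0 < Re z} \<inter> {z. Re z < 1} \<inter> {z. 0 < Im z} \<inter> {z. Im z < 2 * pi}" by (auto simp: S_def)
  then have "open S"
    by (auto intro!: open_Int open_halfspace_Re_gt open_halfspace_Re_lt open_halfspace_Im_gt open_halfspace_Im_lt)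
  have inj: "inj_on g S"
    unfolding g_def by (rule inj_on_subset[OF polar_inj_on[OF r]]) (auto simp: S_def)
  define g' where "g' z h = of_real (r * Re h) * cis (Im z) + of_real (r * Re z) * (of_real (Im h) * (\<i> * cis (Im z)))" for z h
  have der: "(g has_derivative g' z) (at z)" for z
  proof -
    have c: "((\<lambda>z. cis (Im z)) has_derivative (\<lambda>h. of_real (Im h) * (\<i> * cis (Im z)))) (at z)"
      using has_derivative_cis[OF has_derivative_Im[OF has_derivative_ident]]
      by (simp add: scaleR_conv_of_real)
    show ?thesis unfolding g_def[abs_def] g'_def[abs_def]
      by (rule derivative_eq_intros c refl | simp add: algebra_simps)+
  qed
  have contg: "continuous_on UNIV g" unfolding g_def by (intro continuous_intros)
  have [measurable]: "g \<in> borel_measurable borel" using contg by (rule borel_measurable_continuous_onI)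
  have gS: "g ` S \<subseteq> ball c r"
  proof
    fix w assume "w \<in> g ` S"
    then obtain z where z: "z \<in> S" "w = g z" by auto
    then have "r * Re z < r * 1" using r by (intro mult_strict_left_mono) (auto simp: S_def)
    with z r show "w \<in> ball c r" by (auto simp: g_def dist_norm norm_mult S_def)
  qed
  have ball_sub: "ball c r \<subseteq> g ` S \<union> {z. z \<bullet> \<i> = Im c}"
  proof
    fix w assume w: "w \<in> ball c r"
    show "w \<in> g ` S \<union> {z. z \<bullet> \<i> = Im c}"
    proof (cases "Im w = Im c")
      case False
      let ?z = "Complex (cmod (w - c) / r) (Arg2pi (w - c))"
      have "w - c = of_real (cmod (w - c)) * cis (Arg2pi (w - c))"
        using Arg2pi[of "w - c"] by (simp add: is_Arg_def cis_conv_exp)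
      then have "w = g ?z" using r by (simp add: g_def algebra_simps)
      moreover have "Arg2pi (w - c) \<noteq> 0"
        using False by (auto simp: Arg2pi_eq_0 complex_is_Real_iff)
      then have "?z \<in> S"
        using False w r Arg2pi[of "w - c"] by (auto simp: S_def dist_norm norm_minus_commute order_less_le)
      ultimately show ?thesis by blast
    qed auto
  qed
  have ogS: "open (g ` S)"
    by (rule invariance_of_domain[OF continuous_on_subset[OF contg]]) (use \<open>open S\<close> inj in auto)
  have "negligible {z::complex. z \<bullet> \<i> = Im c}"
    by (rule negligible_standard_hyperplane) (simp add: Basis_complex_def)
  then have "AE z in lborel. z \<notin> {z::complex. z \<bullet> \<i> = Im c}"
    unfolding negligible_iff_null_sets
    by (subst AE_completion_iff[symmetric]) (rule AE_not_in)
  then have "AE z in lborel. ennreal (f z) * indicator (ball c r) z = ennreal (f z) * indicator (g ` S) z"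
    by eventually_elim (use gS ball_sub in \<open>auto simp: indicator_def\<close>)
  then have "(\<integral>\<^sup>+z\<in>ball c r. ennreal (f z) \<partial>lborel) = (\<integral>\<^sup>+z\<in>g ` S. ennreal (f z) \<partial>lborel)"
    by (rule nn_integral_cong_AE)
  also have "\<dots> = (\<integral>\<^sup>+z\<in>S. ennreal ((r\<^sup>2 * Re z) * f (g z)) \<partial>lborel)"
  proof (rule nn_integral_change_of_variables_complex[OF \<open>open S\<close> der inj])
    fix z assume z: "z \<in> S"
    have "Re (g' z 1) * Im (g' z \<i>) - Im (g' z 1) * Re (g' z \<i>) = r\<^sup>2 * Re z * ((cos (Im z))\<^sup>2 + (sin (Im z))\<^sup>2)"
      by (simp add: g'_def power2_eq_square algebra_simps
            del: sin_cos_squared_add sin_cos_squared_add2 sin_cos_squared_add3)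
    then show "r\<^sup>2 * Re z = \<bar>Re (g' z 1) * Im (g' z \<i>) - Im (g' z 1) * Re (g' z \<i>)\<bar>"
      using z by (simp add: S_def)
  next
    show "(\<lambda>x. r\<^sup>2 * Re x * indicator S x) \<in> borel_measurable borel"
      using \<open>open S\<close> by (intro borel_measurable_times borel_measurable_indicator) auto
    show "(\<lambda>x. f x * indicator (g ` S) x) \<in> borel_measurable borel"
      using ogS by (intro borel_measurable_times borel_measurable_indicator) auto
  qed (use nn gS in auto)
  also have "\<dots> = (\<integral>\<^sup>+z. (\<lambda>z. ennreal ((r\<^sup>2 * Re z) * f (g z)) * indicator S z) z \<partial>distr (lborel \<Otimes>\<^sub>M lborel) borel (\<lambda>(x, y). Complex x y))"
    by (subst lborel_complex_pair) simp
  also have "\<dots> = (\<integral>\<^sup>+p. ennreal ((r\<^sup>2 * fst p) * f (c + of_real (r * fst p) * cis (snd p))) *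
        (indicator {0<..<1} (fst p) * indicator {0<..<2*pi} (snd p)) \<partial>(lborel \<Otimes>\<^sub>M lborel))"
  proof -
    have T: "(\<lambda>(x, y). Complex x y) \<in> lborel \<Otimes>\<^sub>M lborel \<rightarrow>\<^sub>M borel"
      unfolding lborel_prod Complex_eq split_def by (simp, intro borel_measurable_continuous_onI continuous_intros)
    have k: "(\<lambda>z. ennreal (r\<^sup>2 * Re z * f (g z)) * indicator S z) \<in> borel_measurable borel"
      using \<open>open S\<close> by (intro borel_measurable_times_ennreal borel_measurable_indicator) auto
    show ?thesis
      by (subst nn_integral_distr[OF T], simp add: k)
         (auto intro!: nn_integral_cong simp: g_def S_def indicator_def split: prod.splits)
  qed
  finally have main: "(\<integral>\<^sup>+z\<in>ball c r. ennreal (f z) \<partial>lborel) = \<dots>" .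
  have [measurable]: "(\<lambda>p. c + of_real (r * fst p) * cis (snd p)) \<in> borel_measurable (lborel \<Otimes>\<^sub>M lborel)"
    unfolding lborel_prod by (simp, intro borel_measurable_continuous_onI continuous_intros)
  have [measurable]: "(\<lambda>p. ennreal ((r\<^sup>2 * fst p) * f (c + of_real (r * fst p) * cis (snd p))) *
        (indicator {0<..<1} (fst p) * indicator {0<..<2*pi} (snd p))) \<in> borel_measurable (lborel \<Otimes>\<^sub>M lborel)"
    by measurable
  show ?th1 unfolding main
    by (subst lborel_pair.nn_integral_snd[symmetric], measurable)
       (auto intro!: nn_integral_cong simp: indicator_def mult.assoc)
  show ?th2 unfolding main
    by (subst lborel.nn_integral_fst[symmetric], measurable)
       (auto intro!: nn_integral_cong simp: indicator_def mult.assoc)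
qed

section \<open>The radial ground state of the disk\<close>

text \<open>
  The entire function with these coefficients is \<open>J\<^sub>0(sqrt z)\<close>, where \<open>J\<^sub>0\<close> is the Bessel function.
\<close>

definition bessel_coeff :: "nat \<Rightarrow> complex" where
  "bessel_coeff k = of_real ((- 1 / 4) ^ k / (fact k)\<^sup>2)"

definition bessel :: "complex \<Rightarrow> complex" where
  "bessel z = (\<Sum>k. bessel_coeff k * z ^ k)"

lemma bessel_coeff_summable: "summable (\<lambda>k. bessel_coeff k * z ^ k)"
proof (rule summable_comparison_test[OF _ summable_exp[of "cmod z"]], intro exI allI impI)
  fix k :: nat
  have "1 * 1 \<le> (4::real) ^ k * fact k" by (intro mult_mono) auto
  then have "1 / ((4::real) ^ k * (fact k)\<^sup>2) \<le> inverse (fact k)"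
    by (simp add: field_simps power2_eq_square)
  then have "1 / ((4::real) ^ k * (fact k)\<^sup>2) * cmod z ^ k \<le> inverse (fact k) * cmod z ^ k"
    by (intro mult_right_mono) auto
  then show "norm (bessel_coeff k * z ^ k) \<le> inverse (fact k) * cmod z ^ k"
    by (simp add: bessel_coeff_def norm_mult norm_power norm_divide power_divide)
qed

lemma bessel_has_derivative:
  "(bessel has_field_derivative (\<Sum>k. diffs bessel_coeff k * z ^ k)) (at z)"
  unfolding bessel_def[abs_def]
  by (rule termdiffs_strong_converges_everywhere) (rule bessel_coeff_summable)

lemma deriv_bessel: "deriv bessel z = (\<Sum>k. diffs bessel_coeff k * z ^ k)"
  using bessel_has_derivative by (rule DERIV_imp_deriv)

text \<open>
  Bessel's equation. With \<open>z = l * r\<^sup>2\<close> it says that \<open>J\<^sub>0(sqrt l * r)\<close>, as a radial function in the plane,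
  satisfies \<open>- \<Delta> u = l * u\<close>. The proof compares coefficients.
\<close>

lemma bessel_ode: "((\<lambda>z. z * deriv bessel z) has_field_derivative - bessel z / 4) (at z)"
proof -
  define p where "p k = of_nat k * bessel_coeff k" for k
  have d: "diffs p k = - bessel_coeff k / 4" for k
  proof -
    have "bessel_coeff (Suc k) = - bessel_coeff k / (4 * (of_nat (Suc k))\<^sup>2)"
      by (simp add: bessel_coeff_def power_mult_distrib)
    then show ?thesis by (simp add: diffs_def p_def power2_eq_square del: of_nat_Suc)
  qed
  have sp: "summable (\<lambda>k. p k * w ^ k)" and zp: "w * deriv bessel w = (\<Sum>k. p k * w ^ k)" for w
  proof -
    have s: "summable (\<lambda>k. diffs bessel_coeff k * w ^ k)"
      by (rule termdiff_converges_all) (rule bessel_coeff_summable)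
    then have s': "(\<lambda>k. w * (diffs bessel_coeff k * w ^ k)) sums (w * deriv bessel w)"
      unfolding deriv_bessel by (intro sums_mult summable_sums)
    have e: "(\<lambda>k. w * (diffs bessel_coeff k * w ^ k)) = (\<lambda>k. p (Suc k) * w ^ Suc k)"
      by (simp add: fun_eq_iff p_def diffs_def mult_ac)
    have "(\<lambda>k. p k * w ^ k) sums (w * deriv bessel w + p 0 * w ^ 0)"
      using s' unfolding e by (rule sums_Suc)
    then have "(\<lambda>k. p k * w ^ k) sums (w * deriv bessel w)" by (simp add: p_def)
    then show "summable (\<lambda>k. p k * w ^ k)" "w * deriv bessel w = (\<Sum>k. p k * w ^ k)"
      by (auto simp: sums_iff)
  qed
  have "((\<lambda>w. \<Sum>k. p k * w ^ k) has_field_derivative (\<Sum>k. diffs p k * z ^ k)) (at z)"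
    by (rule termdiffs_strong_converges_everywhere) (rule sp)
  moreover have "(\<Sum>k. diffs p k * z ^ k) = - bessel z / 4"
  proof -
    have "(\<lambda>k. (- 1 / 4) * (bessel_coeff k * z ^ k)) sums ((- 1 / 4) * bessel z)"
      unfolding bessel_def by (intro sums_mult summable_sums bessel_coeff_summable)
    then show ?thesis by (simp add: d sums_iff)
  qed
  ultimately show ?thesis by (simp add: zp)
qed

lemma bessel_0: "bessel 0 = 1"
  using powser_zero[of bessel_coeff] by (simp add: bessel_def bessel_coeff_def[of 0])

text \<open>
  The argument \<open>8\<close> lies beyond the first zero of \<open>J\<^sub>0(sqrt z)\<close>. The first five terms of the series add
  up to \<open>- 7 / 36\<close>, and the others are dominated by a geometric series with sum \<open>1 / 225\<close>.
\<close>

lemma bessel_8_neg: "Re (bessel 8) < 0"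
proof -
  define s where "s k = (- 2) ^ k / (fact k :: real)\<^sup>2" for k
  have "(\<lambda>k. Re (bessel_coeff k * 8 ^ k)) sums Re (bessel 8)"
    unfolding bessel_def by (intro sums_Re summable_sums bessel_coeff_summable)
  moreover have "Re (bessel_coeff k * 8 ^ k) = s k" for k
  proof -
    have "bessel_coeff k * 8 ^ k = of_real ((- 1 / 4) ^ k / (fact k)\<^sup>2 * 8 ^ k)"
      by (simp add: bessel_coeff_def)
    also have "(- 1 / 4) ^ k / (fact k)\<^sup>2 * 8 ^ k = s k"
      by (simp add: s_def flip: power_mult_distrib)
    finally show ?thesis by simp
  qed
  ultimately have s: "s sums Re (bessel 8)" by simp
  have b: "\<bar>s (k + 5)\<bar> \<le> (1 / 450) * (1 / 2) ^ k" for k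
  proof (induction k)
    case 0
    then show ?case by (simp add: s_def fact_numeral)
  next
    case (Suc k)
    have "\<bar>s (Suc k + 5)\<bar> = \<bar>s (k + 5)\<bar> * (2 / (real k + 6)\<^sup>2)"
    proof -
      have "s (Suc k + 5) = s (k + 5) * (- 2 / (real k + 6)\<^sup>2)"
        using fact_Suc[of "k + 5", where 'a = real]
        by (simp add: s_def power_mult_distrib power_add)
      then show ?thesis by (simp add: abs_mult)
    qed
    also have "\<dots> \<le> ((1 / 450) * (1 / 2) ^ k) * (1 / 2)"
    proof (intro mult_mono Suc)
      have "(6::real)\<^sup>2 \<le> (real k + 6)\<^sup>2" by (intro power_mono) auto
      then show "2 / (real k + 6)\<^sup>2 \<le> 1 / 2" by (simp add: field_simps)
    qed auto
    finally show ?case by simp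
  qed
  have geo: "(\<lambda>k. (1 / 450) * (1 / 2) ^ k) sums ((1 / 450) * (1 / (1 - 1 / 2 :: real)))"
    by (intro sums_mult geometric_sums) simp
  have tail: "(\<lambda>k. s (k + 5)) sums (Re (bessel 8) - (\<Sum>i<5. s i))"
    using s by (simp add: sums_iff_shift)
  have "Re (bessel 8) - (\<Sum>i<5. s i) \<le> (1 / 450) * (1 / (1 - 1 / 2))"
    by (rule sums_le[OF _ tail geo]) (rule order_trans[OF abs_ge_self b])
  moreover have "(\<Sum>i<5. s i) = - 7 / 36"
    by (simp add: s_def eval_nat_numeral)
  ultimately show ?thesis by simp
qed

lemma has_real_derivative_Re_of_real:
  assumes "(E has_field_derivative D) (at (of_real x))"
  shows "((\<lambda>x. Re (E (of_real x))) has_real_derivative Re D) (at x)"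
proof -
  have "((\<lambda>x. E (of_real x)) has_vector_derivative D) (at x)"
    using assms by (rule has_vector_derivative_real_field)
  then have "((\<lambda>x. Re (E (of_real x))) has_vector_derivative Re D) (at x)"
    by (rule bounded_linear.has_vector_derivative[OF bounded_linear_Re])
  then show ?thesis by (simp add: has_real_derivative_iff_has_vector_derivative)
qed

lemma has_real_derivative_Re_entire:
  assumes "E holomorphic_on UNIV"
  shows "((\<lambda>x. Re (E (of_real x))) has_real_derivative Re (deriv E (of_real x))) (at x)"
  using assms by (intro has_real_derivative_Re_of_real holomorphic_derivI) auto

text \<open>
  Write \<open>U\<close> for the real part of \<open>E\<close> on the real axis. The assumptions say that \<open>u z = U (|z|\<^sup>2)\<close> is a
  positive, radially nonincreasing solution of \<open>- \<Delta> u = l * u\<close> in the unit disk with \<open>\<partial>u/\<partial>\<nu> + b * u = 0\<close> on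
  the circle: in the variable \<open>s = r\<^sup>2\<close> the Laplacian is \<open>4 * (s * U')'\<close>, and the normal derivative on
  the circle is \<open>2 * U' 1\<close>. Using \<open>s\<close> instead of \<open>r\<close> makes \<open>u\<close> visibly smooth at the origin, and an
  entire \<open>E\<close> keeps all derivatives of functions built from \<open>U\<close> under control.
\<close>

locale radial_ground_state =
  fixes l b :: real and E :: "complex \<Rightarrow> complex"
  assumes l_pos: "0 < l" and b_pos: "0 < b" and entire: "E holomorphic_on UNIV"
    and U_pos: "\<And>s. s \<in> {0..1} \<Longrightarrow> 0 < Re (E (of_real s))"
    and U'_nonpos: "\<And>s. s \<in> {0..1} \<Longrightarrow> Re (deriv E (of_real s)) \<le> 0"
    and robin: "2 * Re (deriv E 1) + b * Re (E 1) = 0"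
    and ode: "\<And>s. ((\<lambda>s. s * Re (deriv E (of_real s))) has_real_derivative - l / 4 * Re (E (of_real s))) (at s)"

text \<open>
  Let \<open>u x = J\<^sub>0(sqrt x)\<close>, and let \<open>t\<close> be its first zero. By Bessel's equation \<open>x * u' x\<close> is negative on
  \<open>(0, t]\<close>, so \<open>2 * x * u' x + b * u x\<close> is positive at \<open>0\<close> and negative at \<open>t\<close>. It vanishes at some \<open>l\<close> in
  between, and \<open>s \<mapsto> u (l * s)\<close> is the required function.
\<close>

lemma radial_ground_state_exists:
  assumes "0 < b"
  shows "\<exists>l E. radial_ground_state l b E"
proof -
  define u where "u x = Re (bessel (of_real x))" for x
  define u' where "u' x = Re (deriv bessel (of_real x))" for x
  have du: "(u has_real_derivative u' x) (at x)" for x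
    unfolding u_def[abs_def] u'_def
    by (rule has_real_derivative_Re_of_real) (use bessel_has_derivative[of "of_real x"] in \<open>simp add: deriv_bessel\<close>)
  have dp: "((\<lambda>x. x * u' x) has_real_derivative - u x / 4) (at x)" for x
    using has_real_derivative_Re_of_real[OF bessel_ode[of "of_real x"]] by (simp add: u_def u'_def)
  have contu: "continuous_on S u" for S
    using DERIV_isCont[OF du] by (simp add: continuous_at_imp_continuous_on)
  have contp: "continuous_on S (\<lambda>x. x * u' x)" for S
    using DERIV_isCont[OF dp] by (simp add: continuous_at_imp_continuous_on)
  have u0: "u 0 = 1" by (simp add: u_def bessel_0)
  have cpt: "compact {x \<in> {0..8}. u x \<le> 0}"
  proof -
    have "closed {x. u x \<le> 0}" using contu[of UNIV] by (intro closed_Collect_le) auto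
    then have "compact ({0..8} \<inter> {x. u x \<le> 0})" by (intro compact_Int_closed) auto
    then show ?thesis by (simp add: Int_def)
  qed
  moreover have "8 \<in> {x \<in> {0..8}. u x \<le> 0}" using bessel_8_neg by (simp add: u_def)
  ultimately obtain t where t: "t \<in> {0..8}" "u t \<le> 0" and tmin: "\<And>x. x \<in> {0..8} \<Longrightarrow> u x \<le> 0 \<Longrightarrow> t \<le> x"
    using compact_attains_inf[OF cpt] by blast
  have t0: "0 < t" using t u0 by (cases "t = 0") auto
  have upos: "0 < u x" if "0 \<le> x" "x < t" for x
    using that t tmin[of x] by force
  have pneg: "x * u' x < 0" if "0 < x" "x \<le> t" for x
  proof -
    have "x * u' x < 0 * u' 0"
    proof (rule DERIV_neg_imp_decreasing_open[OF that(1) _ contp])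
      fix y assume "0 < y" "y < x"
      then show "\<exists>d. ((\<lambda>x. x * u' x) has_real_derivative d) (at y) \<and> d < 0"
        using dp[of y] upos[of y] that by (intro exI[of _ "- u y / 4"]) auto
    qed
    then show ?thesis by simp
  qed
  have "continuous_on {0..t} (\<lambda>x. 2 * (x * u' x) + b * u x)"
    by (intro continuous_intros contp contu)
  moreover have "2 * (t * u' t) + b * u t \<le> 0" 
    using pneg[of t] t0 t(2) \<open>0 < b\<close> by (smt (verit) mult_nonneg_nonpos)
  moreover have "0 \<le> 2 * (0 * u' 0) + b * u 0" using \<open>0 < b\<close> u0 by simp
  ultimately obtain l where l: "0 \<le> l" "l \<le> t" "2 * (l * u' l) + b * u l = 0"
    using IVT2'[of "\<lambda>x. 2 * (x * u' x) + b * u x" t 0 0] t0 by auto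
  have "l \<noteq> 0" using l \<open>0 < b\<close> u0 by auto
  moreover have "l \<noteq> t"
    using l pneg[of t] t0 t(2) \<open>0 < b\<close> by (smt (verit) mult_nonneg_nonpos)
  ultimately have l': "0 < l" "l < t" using l by auto
  define E where "E z = bessel (of_real l * z)" for z
  have dE: "(E has_field_derivative of_real l * deriv bessel (of_real l * z)) (at z)" for z
    unfolding E_def[abs_def]
    by (rule DERIV_chain2[OF bessel_has_derivative[folded deriv_bessel], THEN DERIV_cong])
       (auto intro!: derivative_eq_intros)
  have E': "deriv E z = of_real l * deriv bessel (of_real l * z)" for z
    using dE by (rule DERIV_imp_deriv)
  have Eu: "Re (E (of_real s)) = u (l * s)" "Re (deriv E (of_real s)) = l * u' (l * s)" for s
    by (simp_all add: E_def E' u_def u'_def)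
  have "radial_ground_state l b E"
  proof
    show "0 < l" "0 < b" by fact+
    show "E holomorphic_on UNIV"
      using dE by (auto simp: holomorphic_on_def field_differentiable_def intro: DERIV_subset)
    fix s :: real assume s: "s \<in> {0..1}"
    then have ls: "0 \<le> l * s" "l * s \<le> l" using l'(1) by (auto simp: mult_left_le)
    then show "0 < Re (E (of_real s))" unfolding Eu by (intro upos) (use l' in linarith)+
    show "Re (deriv E (of_real s)) \<le> 0"
    proof (cases "s = 0")
      case True
      have "deriv bessel 0 = - 1 / 4"
        using powser_zero[of "diffs bessel_coeff"]
        by (simp add: deriv_bessel) (simp add: diffs_def bessel_coeff_def)
      then show ?thesis using True l' by (simp add: E')
    next
      case False
      then have "0 < l * s" using s l' by simp
      then show ?thesis unfolding Eu using pneg[of "l * s"] ls l' s by (auto simp: mult_less_0_iff mult_le_0_iff)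
    qed
  next
    show "2 * Re (deriv E 1) + b * Re (E 1) = 0"
      using l(3) Eu[of 1] by simp
    fix s
    have "((\<lambda>s. (l * s) * u' (l * s)) has_real_derivative (- u (l * s) / 4) * l) (at s)"
      by (rule DERIV_chain2[OF dp]) (auto intro!: derivative_eq_intros)
    then show "((\<lambda>s. s * Re (deriv E (of_real s))) has_real_derivative - l / 4 * Re (E (of_real s))) (at s)"
      unfolding Eu by (simp add: mult_ac)
  qed
  then show ?thesis by blast
qed

context radial_ground_state
begin


definition "U s = Re (E (complex_of_real s))"
definition "U' s = Re (deriv E (complex_of_real s))"

lemma dU: "(U has_real_derivative U' s) (at s)"
  unfolding U_def[abs_def] U'_def by (rule has_real_derivative_Re_entire) (rule entire)

lemma cont_U: "continuous_on S U"
  using DERIV_isCont[OF dU] by (simp add: continuous_at_imp_continuous_on)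

lemma cont_U': "continuous_on S U'"
proof -
  have "deriv E holomorphic_on UNIV" using entire by (rule holomorphic_deriv) simp
  then have "continuous_on UNIV (deriv E)" by (rule holomorphic_on_imp_continuous_on)
  then have "continuous_on S (\<lambda>s. deriv E (complex_of_real s))"
    by (rule continuous_on_compose2) (auto intro: continuous_intros)
  then show ?thesis unfolding U'_def[abs_def] by (rule continuous_on_Re)
qed

lemma U_decreasing:
  assumes "0 \<le> s" "s \<le> t" "t \<le> 1"
  shows "U t \<le> U s"
proof (rule DERIV_nonpos_imp_nonincreasing[OF assms(2)])
  fix x assume "s \<le> x" "x \<le> t"
  with assms show "\<exists>y. (U has_real_derivative y) (at x) \<and> y \<le> 0"
    using dU[of x] U'_nonpos[of x] by (intro exI[of _ "U' x"]) (auto simp: U'_def)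
qed

text \<open>
  Picone's identity on a ray. The function \<open>Q r = - 2 * r\<^sup>2 * U' (r\<^sup>2) / U (r\<^sup>2)\<close>, that is \<open>- r * u\<^sub>r / u\<close>,
  solves the Riccati equation \<open>Q' = l * r + Q\<^sup>2 / r\<close>, and \<open>Q 1 = b\<close> by the boundary condition. The
  derivative of \<open>Q * f\<^sup>2\<close> is the negative of the integrand, where the last square is \<open>(f' + Q * f / x)\<^sup>2\<close>.
\<close>

lemma radial_identity:
  assumes df: "\<And>x. x \<in> {0..1} \<Longrightarrow> (f has_real_derivative f' x) (at x)"
  shows "((\<lambda>x. x * (f' x)\<^sup>2 - l * (x * (f x)\<^sup>2) - x * (f' x - 2 * x * U' (x\<^sup>2) / U (x\<^sup>2) * f x)\<^sup>2)
            has_integral - (b * (f 1)\<^sup>2)) {0..1}"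
proof -
  let ?g = "\<lambda>x. x * (f' x)\<^sup>2 - l * (x * (f x)\<^sup>2) - x * (f' x - 2 * x * U' (x\<^sup>2) / U (x\<^sup>2) * f x)\<^sup>2"
  have dp: "((\<lambda>s. s * U' s) has_real_derivative - l / 4 * U s) (at s)" for s
    using ode by (simp add: U_def U'_def)
  have pos: "0 < U s" if "s \<in> {0..1}" for s using U_pos[OF that] by (simp add: U_def)
  have bc: "2 * U' 1 + b * U 1 = 0" using robin by (simp add: U_def U'_def)
  define Q where "Q x = - 2 * (x\<^sup>2 * U' (x\<^sup>2)) / U (x\<^sup>2)" for x
  have "((\<lambda>x. - ?g x) has_integral Q 1 * (f 1)\<^sup>2 - Q 0 * (f 0)\<^sup>2) {0..1}"
  proof (rule fundamental_theorem_of_calculus)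
    fix x :: real assume x: "x \<in> {0..1}"
    then have "x\<^sup>2 \<in> {0..1}" by (simp add: power_le_one)
    then have U0: "U (x\<^sup>2) \<noteq> 0" using pos[of "x\<^sup>2"] by simp
    have d1: "((\<lambda>x. x\<^sup>2 * U' (x\<^sup>2)) has_real_derivative (- l / 4 * U (x\<^sup>2)) * (2 * x)) (at x)"
      by (rule DERIV_chain2[OF dp]) (auto intro!: derivative_eq_intros)
    have d2: "((\<lambda>x. U (x\<^sup>2)) has_real_derivative U' (x\<^sup>2) * (2 * x)) (at x)"
      by (rule DERIV_chain2[OF dU]) (auto intro!: derivative_eq_intros)
    have "((\<lambda>x. Q x * (f x)\<^sup>2) has_real_derivative - ?g x) (at x)"
      unfolding Q_def
      by (rule derivative_eq_intros d1 d2 df[OF x] U0 refl)+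
         (use U0 in \<open>simp add: field_simps power2_eq_square\<close>)
    then show "((\<lambda>x. Q x * (f x)\<^sup>2) has_vector_derivative - ?g x) (at x within {0..1})"
      by (simp add: has_real_derivative_iff_has_vector_derivative has_vector_derivative_at_within)
  qed simp
  moreover have "Q 0 = 0" "Q 1 = b" using bc pos[of 1] by (auto simp: Q_def field_simps)
  ultimately show ?thesis using has_integral_neg_iff by fastforce
qed

text \<open>
  The one-dimensional Robin problem with weight \<open>x\<close> has no Rayleigh quotient below \<open>l\<close>.
\<close>

lemma radial_inequality:
  assumes df: "\<And>x. (f has_real_derivative f' x) (at x)" and cont: "continuous_on {0..1} f'"
  shows "l * integral {0..1} (\<lambda>x. x * (f x)\<^sup>2) \<le> integral {0..1} (\<lambda>x. x * (f' x)\<^sup>2) + b * (f 1)\<^sup>2"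
proof -
  have cf: "continuous_on {0..1} f"
    using DERIV_isCont[OF df] by (simp add: continuous_at_imp_continuous_on)
  have i1: "((\<lambda>x. x * (f' x)\<^sup>2) has_integral integral {0..1} (\<lambda>x. x * (f' x)\<^sup>2)) {0..1}"
    by (intro integrable_integral integrable_continuous_real continuous_intros cont)
  have i2: "((\<lambda>x. x * (f x)\<^sup>2) has_integral integral {0..1} (\<lambda>x. x * (f x)\<^sup>2)) {0..1}"
    by (intro integrable_integral integrable_continuous_real continuous_intros cf)
  have "- (b * (f 1)\<^sup>2) \<le> integral {0..1} (\<lambda>x. x * (f' x)\<^sup>2) - l * integral {0..1} (\<lambda>x. x * (f x)\<^sup>2)"
    by (rule has_integral_le[OF radial_identity[OF df] has_integral_diff[OF i1 has_integral_mult_right[OF i2]]])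
       auto
  then show ?thesis by simp
qed

text \<open>
  For \<open>f = u\<close> the square in Picone's identity vanishes.
\<close>

lemma radial_equality:
  "l * integral {0..1} (\<lambda>x. x * (U (x\<^sup>2))\<^sup>2)
     = integral {0..1} (\<lambda>x. x * (2 * x * U' (x\<^sup>2))\<^sup>2) + b * (U 1)\<^sup>2"
proof -
  have d: "((\<lambda>x. U (x\<^sup>2)) has_real_derivative 2 * x * U' (x\<^sup>2)) (at x)" for x
    by (rule DERIV_chain2[OF dU, THEN DERIV_cong]) (auto intro!: derivative_eq_intros)
  have i1: "((\<lambda>x. x * (2 * x * U' (x\<^sup>2))\<^sup>2) has_integral integral {0..1} (\<lambda>x. x * (2 * x * U' (x\<^sup>2))\<^sup>2)) {0..1}"
    by (intro integrable_integral integrable_continuous_real continuous_intros continuous_on_compose2[OF cont_U', of _ _ UNIV]) auto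
  have i2: "((\<lambda>x. x * (U (x\<^sup>2))\<^sup>2) has_integral integral {0..1} (\<lambda>x. x * (U (x\<^sup>2))\<^sup>2)) {0..1}"
    by (intro integrable_integral integrable_continuous_real continuous_intros continuous_on_compose2[OF cont_U, of _ _ UNIV]) auto
  have "((\<lambda>x. x * (2 * x * U' (x\<^sup>2))\<^sup>2 - l * (x * (U (x\<^sup>2))\<^sup>2)) has_integral
      integral {0..1} (\<lambda>x. x * (2 * x * U' (x\<^sup>2))\<^sup>2) - l * integral {0..1} (\<lambda>x. x * (U (x\<^sup>2))\<^sup>2)) {0..1}"
    by (rule has_integral_diff[OF i1 has_integral_mult_right[OF i2]])
  moreover have "((\<lambda>x. x * (2 * x * U' (x\<^sup>2))\<^sup>2 - l * (x * (U (x\<^sup>2))\<^sup>2)) has_integral - (b * (U (1\<^sup>2))\<^sup>2)) {0..1}"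
  proof (rule has_integral_eq[OF _ radial_identity[OF d]])
    fix x :: real assume "x \<in> {0..1}"
    then have "U (x\<^sup>2) \<noteq> 0" using U_pos[of "x\<^sup>2"] by (auto simp: U_def power_le_one)
    then show "x * (2 * x * U' (x\<^sup>2))\<^sup>2 - l * (x * (U (x\<^sup>2))\<^sup>2) - x * (2 * x * U' (x\<^sup>2) - 2 * x * U' (x\<^sup>2) / U (x\<^sup>2) * U (x\<^sup>2))\<^sup>2
       = x * (2 * x * U' (x\<^sup>2))\<^sup>2 - l * (x * (U (x\<^sup>2))\<^sup>2)" by simp
  qed
  ultimately have "integral {0..1} (\<lambda>x. x * (2 * x * U' (x\<^sup>2))\<^sup>2) - l * integral {0..1} (\<lambda>x. x * (U (x\<^sup>2))\<^sup>2)
      = - (b * (U (1\<^sup>2))\<^sup>2)"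
    by (rule has_integral_unique)
  then show ?thesis by simp
qed

end

section \<open>Smooth cutoff functions\<close>

lemma C_k_const: "C_k k (\<lambda>x. c)"
  by (induction k arbitrary: c) auto

lemma C_k_add: "C_k k f \<Longrightarrow> C_k k g \<Longrightarrow> C_k k (\<lambda>x. f x + g x)"
proof (induction k arbitrary: f g)
  case (Suc k)
  have "frechet_derivative (\<lambda>x. f x + g x) (at x) = (\<lambda>v. frechet_derivative f (at x) v + frechet_derivative g (at x) v)" for x
    using Suc.prems by (intro frechet_derivative_at[symmetric] has_derivative_add)
      (auto simp: frechet_derivative_works[symmetric])
  with Suc show ?case by auto
qed (auto intro: continuous_intros)

lemma C_k_Suc_I:
  assumes "\<And>x. (f has_derivative f' x) (at x)" and "\<And>v. C_k k (\<lambda>x. f' x v)"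
  shows "C_k (Suc k) f"
proof -
  have "frechet_derivative f (at x) = f' x" for x
    using assms(1) by (rule frechet_derivative_at[symmetric])
  then show ?thesis using assms by (auto simp: differentiable_def)
qed

lemma C_k_0_I: "(\<And>x. (f has_derivative f' x) (at x)) \<Longrightarrow> C_k 0 f"
  by (auto intro!: continuous_at_imp_continuous_on has_derivative_continuous)

lemma smoothD:
  assumes "smooth f"
  shows "(f has_derivative frechet_derivative f (at x)) (at x)"
    and "continuous_on S f" and "continuous_on S (\<lambda>x. frechet_derivative f (at x) v)"
proof -
  have 1: "C_k (Suc 0) f" using assms by (simp only: smooth_def)
  then show "(f has_derivative frechet_derivative f (at x)) (at x)"
    by (simp add: frechet_derivative_works[symmetric])
  have "C_k 0 f" using assms by (simp only: smooth_def)
  then show "continuous_on S f" by (auto intro: continuous_on_subset)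
  from 1 show "continuous_on S (\<lambda>x. frechet_derivative f (at x) v)" by (auto intro: continuous_on_subset)
qed

lemma smooth_const: "smooth (\<lambda>x. c)"
  by (simp add: smooth_def C_k_const)

lemma smooth_add: "smooth f \<Longrightarrow> smooth g \<Longrightarrow> smooth (\<lambda>x. f x + g x)"
  by (simp add: smooth_def C_k_add)

text \<open>
  The factor \<open>exp (- e / (a - x))\<close> vanishes to infinite order at \<open>a\<close>, so the extension by \<open>0\<close> is smooth.
  The power of \<open>a - x\<close> in the denominator makes the family closed under differentiation:
  \<open>flat_cutoff_diff\<close> is the numerator of the derivative, whose denominator has exponent \<open>m + 2\<close>.
\<close>

definition flat_cutoff :: "real \<Rightarrow> real \<Rightarrow> nat \<Rightarrow> (complex \<Rightarrow> complex) \<Rightarrow> real \<Rightarrow> real" where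
  "flat_cutoff e a m E x =
     (if x < a then Re (E (of_real x)) * exp (- (e / (a - x))) / (a - x) ^ m else 0)"

definition flat_cutoff_diff :: "real \<Rightarrow> real \<Rightarrow> nat \<Rightarrow> (complex \<Rightarrow> complex) \<Rightarrow> complex \<Rightarrow> complex" where
  "flat_cutoff_diff e a m E z =
     (of_real a - z)\<^sup>2 * deriv E z + of_nat m * (of_real a - z) * E z - of_real e * E z"

lemma flat_cutoff_has_derivative:
  assumes E: "E holomorphic_on UNIV" and e: "0 < e"
  shows "(flat_cutoff e a m E has_real_derivative flat_cutoff e a (m + 2) (flat_cutoff_diff e a m E) x) (at x)"
proof (cases x a rule: linorder_cases)
  case less
  have "((\<lambda>x. Re (E (of_real x)) * exp (- (e / (a - x))) / (a - x) ^ m) has_real_derivative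
      flat_cutoff e a (m + 2) (flat_cutoff_diff e a m E) x) (at x)"
  proof (rule DERIV_cong)
    let ?R = "Re (E (of_real x))" and ?R' = "Re (deriv E (of_real x))" and ?h = "a - x"
    show "((\<lambda>x. Re (E (of_real x)) * exp (- (e / (a - x))) / (a - x) ^ m) has_real_derivative
       ((?R' * exp (- (e / ?h)) + ?R * (exp (- (e / ?h)) * (- (e / ?h\<^sup>2)))) * ?h ^ m
          - ?R * exp (- (e / ?h)) * (- (of_nat m * ?h ^ (m - 1)))) / (?h ^ m * ?h ^ m)) (at x)"
    proof -
      have "((\<lambda>x. R x * exp (- (e / (a - x))) / (a - x) ^ m) has_real_derivative
         ((R' * exp (- (e / ?h)) + R x * (exp (- (e / ?h)) * (- (e / ?h\<^sup>2)))) * ?h ^ m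
          - R x * exp (- (e / ?h)) * (- (of_nat m * ?h ^ (m - 1)))) / (?h ^ m * ?h ^ m)) (at x)"
        if "(R has_real_derivative R') (at x)" for R R'
        using less by (auto intro!: derivative_eq_intros that simp: power2_eq_square)
      then show ?thesis using has_real_derivative_Re_entire[OF E] .
    qed
    have h: "?h \<noteq> 0" using less by simp
    have hm: "of_nat m * ?h ^ (m - 1) * ?h = of_nat m * ?h ^ m"
      by (cases m) auto
    have alg: "((R' * X + R * (X * (- (e / h\<^sup>2)))) * P - R * X * (- M)) / (P * P)
        = X * (R' * h\<^sup>2 - e * R + c * h * R) / (P * h\<^sup>2)"
      if "h \<noteq> 0" "P \<noteq> 0" "M * h = c * P" for R R' X h P M c :: real
    proof -
      have M: "M = c * P / h" using that by (simp add: field_simps)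
      show ?thesis using that(1,2) unfolding M by (simp add: field_simps power2_eq_square)
    qed
    have "((?R' * exp (- (e / ?h)) + ?R * (exp (- (e / ?h)) * (- (e / ?h\<^sup>2)))) * ?h ^ m
          - ?R * exp (- (e / ?h)) * (- (of_nat m * ?h ^ (m - 1)))) / (?h ^ m * ?h ^ m)
        = exp (- (e / ?h)) * (?R' * ?h\<^sup>2 - e * ?R + of_nat m * ?h * ?R) / (?h ^ m * ?h\<^sup>2)"
      using h hm by (intro alg) auto
    also have "?R' * ?h\<^sup>2 - e * ?R + of_nat m * ?h * ?R = Re (flat_cutoff_diff e a m E (of_real x))"
    proof -
      have "(of_real a - complex_of_real x) = of_real ?h" by simp
      then show ?thesis unfolding flat_cutoff_diff_def
        by (simp only:) (simp add: mult.commute flip: of_real_power)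
    qed
    finally show "((?R' * exp (- (e / ?h)) + ?R * (exp (- (e / ?h)) * (- (e / ?h\<^sup>2)))) * ?h ^ m
          - ?R * exp (- (e / ?h)) * (- (of_nat m * ?h ^ (m - 1)))) / (?h ^ m * ?h ^ m)
        = flat_cutoff e a (m + 2) (flat_cutoff_diff e a m E) x"
      using less by (simp add: flat_cutoff_def power_add power2_eq_square mult.commute)
  qed
  then show ?thesis
    by (rule has_field_derivative_transform_within_open[of _ _ _ "{..<a}"]) (use less in \<open>auto simp: flat_cutoff_def\<close>)
next
  case greater
  have "((\<lambda>x. 0) has_real_derivative 0) (at x)" by simp
  then have "(flat_cutoff e a m E has_real_derivative 0) (at x)"
    by (rule has_field_derivative_transform_within_open[of _ _ _ "{a<..}"]) (use greater in \<open>auto simp: flat_cutoff_def\<close>)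
  with greater show ?thesis by (simp add: flat_cutoff_def)
next
  case equal
  \<comment> \<open>Here \<open>exp (- e / h)\<close> beats every power of \<open>h = a - x\<close>.\<close>
  have "((\<lambda>h. exp (- (e / h)) / h ^ Suc m) \<longlongrightarrow> 0) (at_right 0)"
    using e by real_asymp
  then have "((\<lambda>y. exp (- (e / (a - y))) / (a - y) ^ Suc m) \<longlongrightarrow> 0) (at_left a)"
    by (subst filterlim_at_left_to_right, subst filterlim_at_right_to_0) (simp add: algebra_simps)
  moreover have "((\<lambda>y. Re (E (of_real y))) \<longlongrightarrow> Re (E (of_real a))) (at_left a)"
    using DERIV_isCont[OF has_real_derivative_Re_entire[OF E], of a]
    by (simp add: isCont_def filterlim_at_split)
  ultimately have "((\<lambda>y. - (Re (E (of_real y)) * (exp (- (e / (a - y))) / (a - y) ^ Suc m))) \<longlongrightarrow> - (Re (E (of_real a)) * 0)) (at_left a)"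
    by (intro tendsto_minus tendsto_mult)
  then have "((\<lambda>y. - (Re (E (of_real y)) * (exp (- (e / (a - y))) / (a - y) ^ Suc m))) \<longlongrightarrow> 0) (at_left a)"
    by (simp only: mult_zero_right minus_zero)
  then have L: "((\<lambda>y. (flat_cutoff e a m E y - flat_cutoff e a m E a) / (y - a)) \<longlongrightarrow> 0) (at_left a)"
  proof (rule Lim_transform_eventually[OF _ eventually_mono[of "\<lambda>y. y < a"]])
    show "eventually (\<lambda>y. y < a) (at_left a)" by (simp add: eventually_at_filter)
    fix y :: real assume "y < a"
    then have "y - a = - (a - y)" "a - y \<noteq> 0" by auto
    then show "- (Re (E (of_real y)) * (exp (- (e / (a - y))) / (a - y) ^ Suc m))
       = (flat_cutoff e a m E y - flat_cutoff e a m E a) / (y - a)"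
      using \<open>y < a\<close> by (simp add: flat_cutoff_def field_simps)
  qed
  have R: "((\<lambda>y. (flat_cutoff e a m E y - flat_cutoff e a m E a) / (y - a)) \<longlongrightarrow> 0) (at_right a)"
    by (rule Lim_transform_eventually[OF tendsto_const eventually_mono[OF eventually_at_right_less]])
       (simp add: flat_cutoff_def)
  from L R show ?thesis
    unfolding has_field_derivative_iff equal by (simp add: filterlim_at_split flat_cutoff_def)
qed

lemma flat_cutoff_diff_holomorphic:
  assumes "E holomorphic_on UNIV"
  shows "flat_cutoff_diff e a m E holomorphic_on UNIV"
  unfolding flat_cutoff_diff_def[abs_def] using assms
  by (intro holomorphic_intros holomorphic_deriv) auto

text \<open>
  The real polynomials in real parts of holomorphic functions. This class contains \<open>|G|\<^sup>2\<close> for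
  holomorphic \<open>G\<close> and is closed under directional derivatives, which makes an induction on the order
  of differentiability possible.
\<close>

inductive_set re_holomorphic_ring :: "complex set \<Rightarrow> (complex \<Rightarrow> real) set" for \<Omega> where
  Re: "H holomorphic_on \<Omega> \<Longrightarrow> (\<lambda>z. Re (H z)) \<in> re_holomorphic_ring \<Omega>"
| add: "p \<in> re_holomorphic_ring \<Omega> \<Longrightarrow> q \<in> re_holomorphic_ring \<Omega> \<Longrightarrow> (\<lambda>z. p z + q z) \<in> re_holomorphic_ring \<Omega>"
| mult: "p \<in> re_holomorphic_ring \<Omega> \<Longrightarrow> q \<in> re_holomorphic_ring \<Omega> \<Longrightarrow> (\<lambda>z. p z * q z) \<in> re_holomorphic_ring \<Omega>"

lemma re_holomorphic_ring_derivative: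
  assumes "p \<in> re_holomorphic_ring \<Omega>" and "open \<Omega>"
  shows "\<exists>p'. (\<forall>z\<in>\<Omega>. (p has_derivative p' z) (at z)) \<and> (\<forall>v. (\<lambda>z. p' z v) \<in> re_holomorphic_ring \<Omega>)"
  using assms(1)
  proof induction
    case (Re H)
    have "((\<lambda>z. Re (H z)) has_derivative (\<lambda>v. Re (deriv H z * v))) (at z)" if "z \<in> \<Omega>" for z
      using holomorphic_derivI[OF Re \<open>open \<Omega>\<close> that]
      by (intro has_derivative_Re) (simp add: has_field_derivative_def)
    moreover have "(\<lambda>z. Re (deriv H z * v)) \<in> re_holomorphic_ring \<Omega>" for v
      using Re \<open>open \<Omega>\<close> by (intro re_holomorphic_ring.Re holomorphic_intros holomorphic_deriv)
    ultimately show ?case by (intro exI[of _ "\<lambda>z v. Re (deriv H z * v)"]) auto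
  next
    case (add p q)
    then obtain p' q' where pq: "\<And>z. z \<in> \<Omega> \<Longrightarrow> (p has_derivative p' z) (at z)" "\<And>v. (\<lambda>z. p' z v) \<in> re_holomorphic_ring \<Omega>"
       "\<And>z. z \<in> \<Omega> \<Longrightarrow> (q has_derivative q' z) (at z)" "\<And>v. (\<lambda>z. q' z v) \<in> re_holomorphic_ring \<Omega>" by metis
    from pq show ?case
      by (intro exI[of _ "\<lambda>z v. p' z v + q' z v"] conjI ballI allI has_derivative_add re_holomorphic_ring.add) auto
  next
    case (mult p q)
    then obtain p' q' where pq: "\<And>z. z \<in> \<Omega> \<Longrightarrow> (p has_derivative p' z) (at z)" "\<And>v. (\<lambda>z. p' z v) \<in> re_holomorphic_ring \<Omega>"
       "\<And>z. z \<in> \<Omega> \<Longrightarrow> (q has_derivative q' z) (at z)" "\<And>v. (\<lambda>z. q' z v) \<in> re_holomorphic_ring \<Omega>" by metis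
    from pq mult.hyps show ?case
      by (intro exI[of _ "\<lambda>z v. p z * q' z v + p' z v * q z"] conjI ballI allI has_derivative_mult
          re_holomorphic_ring.add re_holomorphic_ring.mult) auto
  qed

lemma cmod_square_in_ring:
  assumes "G holomorphic_on \<Omega>"
  shows "(\<lambda>z. (cmod (G z))\<^sup>2) \<in> re_holomorphic_ring \<Omega>"
proof -
  have "(\<lambda>z. Re (G z) * Re (G z) + Re (- \<i> * G z) * Re (- \<i> * G z)) \<in> re_holomorphic_ring \<Omega>"
    using assms by (intro re_holomorphic_ring.intros holomorphic_intros)
  also have "(\<lambda>z. Re (G z) * Re (G z) + Re (- \<i> * G z) * Re (- \<i> * G z)) = (\<lambda>z. (cmod (G z))\<^sup>2)"
    unfolding cmod_power2 by (simp add: power2_eq_square)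
  finally show ?thesis .
qed

text \<open>
  The functions \<open>flat_cutoff e a m E (q z) * p z\<close> with \<open>p\<close> in the ring, extended by \<open>0\<close>, vanish off a
  compact subset of \<open>\<Omega>\<close>. A directional derivative of such a function is a sum of two others, so all
  of them are in \<^const>\<open>C_k\<close> for every \<open>k\<close>.
\<close>

lemma flat_cutoff_smooth:
  assumes "open \<Omega>" and q: "q \<in> re_holomorphic_ring \<Omega>" and e: "0 < e"
    and K: "compact K" "K \<subseteq> \<Omega>" "\<And>z. z \<in> \<Omega> \<Longrightarrow> q z < a \<Longrightarrow> z \<in> K"
    and E: "E holomorphic_on UNIV"
  shows "smooth (\<lambda>z. if z \<in> \<Omega> then flat_cutoff e a m E (q z) else 0)"
proof -
  define T where "T m E p z = (if z \<in> \<Omega> then flat_cutoff e a m E (q z) * p z else 0)" for m E p z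
  obtain q' where q': "\<And>z. z \<in> \<Omega> \<Longrightarrow> (q has_derivative q' z) (at z)"
      "\<And>v. (\<lambda>z. q' z v) \<in> re_holomorphic_ring \<Omega>"
    using re_holomorphic_ring_derivative[OF q \<open>open \<Omega>\<close>] by blast
  have der: "\<exists>p'. (\<forall>v. p' v \<in> re_holomorphic_ring \<Omega>) \<and>
      (\<forall>z. (T m E p has_derivative (\<lambda>v. T (m + 2) (flat_cutoff_diff e a m E) (\<lambda>z. q' z v * p z) z + T m E (p' v) z)) (at z))"
    if p: "p \<in> re_holomorphic_ring \<Omega>" and E: "E holomorphic_on UNIV" for m E p
  proof -
    obtain p' where p': "\<And>z. z \<in> \<Omega> \<Longrightarrow> (p has_derivative p' z) (at z)"
        "\<And>v. (\<lambda>z. p' z v) \<in> re_holomorphic_ring \<Omega>"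
      using re_holomorphic_ring_derivative[OF p \<open>open \<Omega>\<close>] by blast
    have "(T m E p has_derivative (\<lambda>v. T (m + 2) (flat_cutoff_diff e a m E) (\<lambda>z. q' z v * p z) z + T m E (\<lambda>z. p' z v) z)) (at z)" for z
    proof (cases "z \<in> \<Omega>")
      case True
      have "((\<lambda>z. flat_cutoff e a m E (q z)) has_derivative
            (\<lambda>v. flat_cutoff e a (m + 2) (flat_cutoff_diff e a m E) (q z) * q' z v)) (at z)"
        using flat_cutoff_has_derivative[OF E e, of a m "q z"] unfolding has_field_derivative_def
        by (rule has_derivative_compose[OF q'(1)[OF True]])
      then have "((\<lambda>z. flat_cutoff e a m E (q z) * p z) has_derivative
            (\<lambda>v. flat_cutoff e a m E (q z) * p' z v
               + flat_cutoff e a (m + 2) (flat_cutoff_diff e a m E) (q z) * q' z v * p z)) (at z)"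
        using p'(1)[OF True] by (rule has_derivative_mult)
      then have "(T m E p has_derivative
            (\<lambda>v. flat_cutoff e a m E (q z) * p' z v
               + flat_cutoff e a (m + 2) (flat_cutoff_diff e a m E) (q z) * q' z v * p z)) (at z)"
        by (rule has_derivative_transform_within_open[OF _ \<open>open \<Omega>\<close> True]) (simp add: T_def)
      then show ?thesis using True by (simp add: T_def algebra_simps)
    next
      case False
      then have z: "z \<in> - K" using K(2) by auto
      have "open (- K)" using K(1) by (simp add: compact_imp_closed open_Compl)
      have "((\<lambda>z. 0) has_derivative (\<lambda>v. 0)) (at z)" by simp
      then have "(T m E p has_derivative (\<lambda>v. 0)) (at z)"
      proof (rule has_derivative_transform_within_open[OF _ \<open>open (- K)\<close> z])
        fix w assume "w \<in> - K"
        then have "w \<in> \<Omega> \<Longrightarrow> \<not> q w < a" using K(3)[of w] by auto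
        then show "0 = T m E p w" by (auto simp: T_def flat_cutoff_def)
      qed
      then show ?thesis using False by (simp add: T_def)
    qed
    then show ?thesis using p'(2) by (intro exI[of _ "\<lambda>v z. p' z v"] conjI allI) assumption+
  qed
  have "C_k k (T m E p)" if "p \<in> re_holomorphic_ring \<Omega>" "E holomorphic_on UNIV" for k m E p
    using that
  proof (induction k arbitrary: m E p)
    case 0
    from der[OF 0, of m] obtain p' where p': "(\<forall>v. p' v \<in> re_holomorphic_ring \<Omega>) \<and>
      (\<forall>z. (T m E p has_derivative (\<lambda>v. T (m + 2) (flat_cutoff_diff e a m E) (\<lambda>z. q' z v * p z) z + T m E (p' v) z)) (at z))" ..
    show ?case by (rule C_k_0_I[OF p'[THEN conjunct2, THEN spec]])
  next
    case (Suc k)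
    from der[OF Suc.prems, of m] obtain p' where "(\<forall>v. p' v \<in> re_holomorphic_ring \<Omega>) \<and>
      (\<forall>z. (T m E p has_derivative (\<lambda>v. T (m + 2) (flat_cutoff_diff e a m E) (\<lambda>z. q' z v * p z) z + T m E (p' v) z)) (at z))" ..
    note p' = this[THEN conjunct1, THEN spec] this[THEN conjunct2, THEN spec]
    show ?case
    proof (rule C_k_Suc_I[OF p'(2)])
      fix v
      show "C_k k (\<lambda>z. T (m + 2) (flat_cutoff_diff e a m E) (\<lambda>z. q' z v * p z) z + T m E (p' v) z)"
        by (intro C_k_add Suc.IH p' re_holomorphic_ring.mult q' Suc.prems flat_cutoff_diff_holomorphic)
    qed
  qed
  moreover have "(\<lambda>z. Re 1) \<in> re_holomorphic_ring \<Omega>"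
    by (rule re_holomorphic_ring.Re[of "\<lambda>_. 1"]) auto
  ultimately have "smooth (T m E (\<lambda>z. Re 1))" using E unfolding smooth_def by blast
  also have "T m E (\<lambda>z. Re 1) = (\<lambda>z. if z \<in> \<Omega> then flat_cutoff e a m E (q z) else 0)"
    by (simp add: T_def fun_eq_iff)
  finally show ?thesis .
qed

section \<open>Smooth functions as competitors for the Robin eigenvalue\<close>

text \<open>
  The difference of the squared norms is at most \<open>|f - u|\<^sup>2 + 2 * |u| * |f - u|\<close>. A weight \<open>e\<close> in the
  arithmetic-geometric mean inequality makes the contribution of \<open>|u|\<^sup>2\<close> to the mixed term small.
\<close>

lemma tendsto_L2_norm:
  fixes f :: "nat \<Rightarrow> complex \<Rightarrow> 'b::euclidean_space"
  assumes f: "\<And>n. square_integrable M (f n)" and u: "square_integrable M u" and lim: "tendsto_L2 M f u"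
  shows "(\<lambda>n. LINT x|M. (norm (f n x))\<^sup>2) \<longlonglongrightarrow> (LINT x|M. (norm (u x))\<^sup>2)"
proof -
  have fm [measurable]: "f n \<in> borel_measurable M" for n using f by (simp add: square_integrable_def)
  have um [measurable]: "u \<in> borel_measurable M" using u by (simp add: square_integrable_def)
  have fi: "integrable M (\<lambda>x. (norm (f n x))\<^sup>2)" for n using f by (simp add: square_integrable_def)
  have ui: "integrable M (\<lambda>x. (norm (u x))\<^sup>2)" using u by (simp add: square_integrable_def)
  have di: "integrable M (\<lambda>x. (norm (f n x - u x))\<^sup>2)" for n
  proof (rule Bochner_Integration.integrable_bound)
    show "integrable M (\<lambda>x. 2 * (norm (f n x))\<^sup>2 + 2 * (norm (u x))\<^sup>2)"
      using fi ui by simp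
    show "AE x in M. norm ((norm (f n x - u x))\<^sup>2) \<le> norm (2 * (norm (f n x))\<^sup>2 + 2 * (norm (u x))\<^sup>2)"
    proof (rule AE_I2)
      fix x
      have "(norm (f n x - u x))\<^sup>2 \<le> (norm (f n x) + norm (u x))\<^sup>2"
        by (intro power_mono norm_triangle_ineq4) auto
      also have "\<dots> \<le> 2 * (norm (f n x))\<^sup>2 + 2 * (norm (u x))\<^sup>2"
        using zero_le_power2[of "norm (f n x) - norm (u x)"] by (simp add: power2_eq_square algebra_simps)
      finally show "norm ((norm (f n x - u x))\<^sup>2) \<le> norm (2 * (norm (f n x))\<^sup>2 + 2 * (norm (u x))\<^sup>2)" by simp
    qed
  qed measurable
  define d where "d n = (LINT x|M. (norm (f n x - u x))\<^sup>2)" for n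
  define A where "A = (LINT x|M. (norm (u x))\<^sup>2)"
  have A0: "0 \<le> A" by (simp add: A_def)
  have d0: "0 \<le> d n" for n by (simp add: d_def)
  have dlim: "d \<longlonglongrightarrow> 0"
  proof -
    have "ennreal (d n) = (\<integral>\<^sup>+ x. ennreal ((norm (f n x - u x))\<^sup>2) \<partial>M)" for n
      unfolding d_def by (rule nn_integral_eq_integral[symmetric]) (use di in auto)
    then have "(\<lambda>n. ennreal (d n)) \<longlonglongrightarrow> ennreal 0" using lim by (simp add: tendsto_L2_def)
    then show ?thesis using d0 by (subst (asm) tendsto_ennreal_iff) auto
  qed
  have bound: "\<bar>(LINT x|M. (norm (f n x))\<^sup>2) - A\<bar> \<le> (1 + 1 / e) * d n + e * A" if "0 < e" for e :: real and n
  proof -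
    have pw: "\<bar>(norm (f n x))\<^sup>2 - (norm (u x))\<^sup>2\<bar> \<le> (1 + 1 / e) * (norm (f n x - u x))\<^sup>2 + e * (norm (u x))\<^sup>2" for x
    proof -
      let ?a = "norm (f n x)" and ?b = "norm (u x)" and ?c = "norm (f n x - u x)"
      have ab: "\<bar>?a - ?b\<bar> \<le> ?c" by (rule norm_triangle_ineq3)
      have "\<bar>?a\<^sup>2 - ?b\<^sup>2\<bar> = \<bar>?a - ?b\<bar> * (?a + ?b)" by (simp add: power2_eq_square square_diff_square_factored abs_mult mult.commute)
      also have "\<dots> \<le> ?c * (2 * ?b + ?c)" using ab by (intro mult_mono) auto
      also have "\<dots> \<le> (1 + 1 / e) * ?c\<^sup>2 + e * ?b\<^sup>2"
      proof -
        have "0 \<le> (?c - e * ?b)\<^sup>2 / e" using that by simp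
        also have "(?c - e * ?b)\<^sup>2 / e = ?c\<^sup>2 / e - 2 * ?c * ?b + e * ?b\<^sup>2"
          using that by (simp add: power2_eq_square field_simps)
        finally show ?thesis by (simp add: algebra_simps power2_eq_square)
      qed
      finally show ?thesis .
    qed
    have "\<bar>(LINT x|M. (norm (f n x))\<^sup>2) - A\<bar> = \<bar>LINT x|M. (norm (f n x))\<^sup>2 - (norm (u x))\<^sup>2\<bar>"
      unfolding A_def using fi ui by simp
    also have "\<dots> \<le> (LINT x|M. \<bar>(norm (f n x))\<^sup>2 - (norm (u x))\<^sup>2\<bar>)" by (rule integral_abs_bound)
    also have "\<dots> \<le> (LINT x|M. (1 + 1 / e) * (norm (f n x - u x))\<^sup>2 + e * (norm (u x))\<^sup>2)"
      using fi ui di pw by (intro integral_mono) auto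
    also have "\<dots> = (1 + 1 / e) * d n + e * A"
      unfolding d_def A_def using di ui by simp
    finally show ?thesis .
  qed
  show ?thesis unfolding A_def[symmetric]
  proof (rule LIMSEQ_I)
    fix r :: real assume "0 < r"
    define e where "e = r / (2 * (A + 1))"
    have e: "0 < e" using \<open>0 < r\<close> A0 by (simp add: e_def)
    have eA: "e * A < r / 2" using \<open>0 < r\<close> A0 by (simp add: e_def field_simps)
    have "(\<lambda>n. (1 + 1 / e) * d n) \<longlonglongrightarrow> (1 + 1 / e) * 0" by (intro tendsto_intros dlim)
    then have "eventually (\<lambda>n. (1 + 1 / e) * d n < r / 2) sequentially"
      using \<open>0 < r\<close> by (intro order_tendstoD) auto
    then obtain N where N: "\<And>n. N \<le> n \<Longrightarrow> (1 + 1 / e) * d n < r / 2" by (auto simp: eventually_sequentially)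
    show "\<exists>no. \<forall>n\<ge>no. norm ((LINT x|M. (norm (f n x))\<^sup>2) - A) < r"
    proof (intro exI allI impI)
      fix n assume "N \<le> n"
      from N[OF this] bound[OF e, of n] eA show "norm ((LINT x|M. (norm (f n x))\<^sup>2) - A) < r"
        unfolding real_norm_def by linarith
    qed
  qed
qed

lemma continuous_grad: "smooth f \<Longrightarrow> continuous_on S (grad f)"
  unfolding grad_def[abs_def] Complex_eq by (intro continuous_intros smoothD)

lemma frechet_derivative_eq_grad:
  assumes "smooth f"
  shows "frechet_derivative f (at x) v = v \<bullet> grad f x"
proof -
  interpret bounded_linear "frechet_derivative f (at x)"
    using smoothD(1)[OF assms] by (rule has_derivative_bounded_linear)
  have "v = Re v *\<^sub>R 1 + Im v *\<^sub>R \<i>" by (simp add: complex_eq_iff)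
  then have "frechet_derivative f (at x) v = frechet_derivative f (at x) (Re v *\<^sub>R 1 + Im v *\<^sub>R \<i>)"
    by (rule arg_cong)
  also have "\<dots> = Re v * frechet_derivative f (at x) 1 + Im v * frechet_derivative f (at x) \<i>"
    by (simp only: add scaleR) simp
  finally show ?thesis by (simp add: grad_def inner_complex_def)
qed

lemma has_derivative_smooth:
  assumes "smooth f"
  shows "(f has_derivative (\<lambda>v. v \<bullet> grad f x)) (at x)"
proof -
  have "(\<lambda>v. v \<bullet> grad f x) = frechet_derivative f (at x)"
    using frechet_derivative_eq_grad[OF assms] by (simp add: fun_eq_iff)
  then show ?thesis using smoothD(1)[OF assms] by simp
qed

lemma grad_eqI:
  assumes "(f has_derivative f') (at x)" "f' 1 = Re g" "f' \<i> = Im g"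
  shows "grad f x = g"
  using frechet_derivative_at[OF assms(1)] assms(2,3) by (simp add: grad_def complex_eq_iff)

lemma bounded_continuous_image_norm:
  fixes g :: "complex \<Rightarrow> 'b::real_normed_vector"
  assumes "bounded \<Omega>" "continuous_on UNIV g"
  obtains B where "\<And>x. x \<in> closure \<Omega> \<Longrightarrow> norm (g x) \<le> B"
proof -
  have "compact (g ` closure \<Omega>)"
    using assms by (intro compact_continuous_image) (auto intro: continuous_on_subset simp: compact_closure)
  then have "bounded (g ` closure \<Omega>)" by (rule compact_imp_bounded)
  then show thesis using that by (auto simp: bounded_iff)
qed

text \<open>
  Area on a bounded open set and arc length on its frontier share these properties, and they suffice
  for every continuous function on the plane to be integrable.
\<close>

definition bounded_finite_measure :: "complex measure \<Rightarrow> bool" where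
  "bounded_finite_measure M \<longleftrightarrow>
     finite_measure M \<and> (\<lambda>x. x) \<in> borel_measurable M \<and> bounded (space M)"

lemma integrable_continuous:
  fixes g :: "complex \<Rightarrow> 'b::euclidean_space"
  assumes M: "bounded_finite_measure M" and g: "continuous_on UNIV g"
  shows "integrable M g"
proof -
  interpret finite_measure M using M by (simp add: bounded_finite_measure_def)
  obtain B where B: "\<And>x. x \<in> closure (space M) \<Longrightarrow> norm (g x) \<le> B"
    using M g bounded_continuous_image_norm[of "space M" g] by (auto simp: bounded_finite_measure_def)
  have "g \<in> borel_measurable borel" using g by (rule borel_measurable_continuous_onI)
  then have "g \<in> borel_measurable M"
    using M measurable_compose[of "\<lambda>x. x" M borel g borel] by (simp add: bounded_finite_measure_def)
  moreover have "AE x in M. norm (g x) \<le> B"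
    using B closure_subset[of "space M"] by (intro AE_I2) auto
  ultimately show ?thesis by (intro integrable_const_bound)
qed

lemma square_integrable_continuous:
  fixes g :: "complex \<Rightarrow> 'b::euclidean_space"
  assumes M: "bounded_finite_measure M" and g: "continuous_on UNIV g"
  shows "square_integrable M g"
  unfolding square_integrable_def using g
  by (auto intro!: borel_measurable_integrable integrable_continuous M continuous_intros)

lemma bounded_finite_lebesgue_on:
  assumes "bounded \<Omega>" "open (\<Omega> :: complex set)"
  shows "bounded_finite_measure (lebesgue_on \<Omega>)"
  unfolding bounded_finite_measure_def
proof (intro conjI finite_measureI)
  have "emeasure (lebesgue_on \<Omega>) (space (lebesgue_on \<Omega>)) = emeasure lborel \<Omega>"
    using assms(2) by (simp add: emeasure_restrict_space)
  also have "\<dots> < top" using emeasure_bounded_finite[OF assms(1)] by simp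
  finally show "emeasure (lebesgue_on \<Omega>) (space (lebesgue_on \<Omega>)) \<noteq> \<infinity>" by simp
  show "(\<lambda>x. x) \<in> borel_measurable (lebesgue_on \<Omega>)"
    by (intro measurable_restrict_space1 measurable_completion) simp
qed (use assms in auto)

lemma bounded_finite_boundary_measure:
  assumes "emeasure hausdorff1 (frontier \<Omega>) < top" "bounded \<Omega>"
  shows "bounded_finite_measure (boundary_measure \<Omega>)"
  unfolding bounded_finite_measure_def
proof (intro conjI finite_measureI)
  show "emeasure (boundary_measure \<Omega>) (space (boundary_measure \<Omega>)) \<noteq> \<infinity>"
    using assms(1) by (simp add: boundary_measure_def emeasure_restrict_space space_restrict_space)
  show "(\<lambda>x. x) \<in> borel_measurable (boundary_measure \<Omega>)"
    unfolding boundary_measure_def by (intro measurable_restrict_space1) simp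
  show "bounded (space (boundary_measure \<Omega>))"
    using bounded_closure[OF assms(2)] by (auto simp: boundary_measure_def space_restrict_space frontier_def intro: bounded_subset)
qed

lemma ennreal_lebesgue_on_integral:
  fixes g :: "complex \<Rightarrow> real"
  assumes O: "bounded \<Omega>" "open \<Omega>" and g: "continuous_on UNIV g" and nn: "\<And>x. 0 \<le> g x"
  shows "ennreal (LINT x|lebesgue_on \<Omega>. g x) = (\<integral>\<^sup>+x\<in>\<Omega>. ennreal (g x) \<partial>lborel)"
proof -
  have "ennreal (LINT x|lebesgue_on \<Omega>. g x) = (\<integral>\<^sup>+x. ennreal (g x) \<partial>lebesgue_on \<Omega>)"
    using integrable_continuous[OF bounded_finite_lebesgue_on[OF O] g] nn by (intro nn_integral_eq_integral[symmetric]) auto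
  also have "\<dots> = (\<integral>\<^sup>+x\<in>\<Omega>. ennreal (g x) \<partial>lebesgue)"
    using O by (subst nn_integral_restrict_space) auto
  also have "\<dots> = (\<integral>\<^sup>+x\<in>\<Omega>. ennreal (g x) \<partial>lborel)" by (rule nn_integral_completion)
  finally show ?thesis .
qed

text \<open>
  By translation invariance the difference quotients \<open>(h (x + v / n) - h x) * n\<close> all have integral \<open>0\<close>.
  They are bounded and supported in a fixed ball, so dominated convergence applies.
\<close>

lemma integral_directional_derivative_eq_0:
  fixes h :: "complex \<Rightarrow> real" and D :: "complex \<Rightarrow> complex \<Rightarrow> real"
  assumes der: "\<And>x. (h has_derivative D x) (at x)" and cont: "continuous_on UNIV (\<lambda>x. D x v)"
    and supp: "\<And>x. R < cmod x \<Longrightarrow> h x = 0"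
  shows "(LINT x|lborel. D x v) = 0"
proof -
  have conth: "continuous_on UNIV h"
    using der by (intro continuous_at_imp_continuous_on ballI has_derivative_continuous) auto
  have hm [measurable]: "h \<in> borel_measurable borel" using conth by (rule borel_measurable_continuous_onI)
  have Dm [measurable]: "(\<lambda>x. D x v) \<in> borel_measurable borel" using cont by (rule borel_measurable_continuous_onI)
  define S where "S = cball (0::complex) (\<bar>R\<bar> + cmod v)"
  define S2 where "S2 = cball (0::complex) (\<bar>R\<bar> + 2 * cmod v)"
  \<comment> \<open>The difference quotient at \<open>x\<close> is \<open>D y v\<close> for some \<open>y\<close> within distance \<open>|v|\<close> of \<open>x\<close>, so two radii are needed.\<close>
  obtain B where B: "\<And>x. x \<in> closure S2 \<Longrightarrow> norm (D x v) \<le> B"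
    by (rule bounded_continuous_image_norm[OF _ cont, of S2]) (auto simp: S2_def)
  have hint: "integrable lborel h"
  proof -
    obtain C where C: "\<And>x. x \<in> closure S2 \<Longrightarrow> norm (h x) \<le> C"
      by (rule bounded_continuous_image_norm[OF _ conth, of S2]) (auto simp: S2_def)
    have "integrable lborel (\<lambda>x. C * indicator S2 x)"
      using emeasure_bounded_finite[of S2] by (intro integrable_mult_right integrable_real_indicator) (auto simp: S2_def)
    then show ?thesis
    proof (rule Bochner_Integration.integrable_bound)
      show "AE x in lborel. norm (h x) \<le> norm (C * indicator S2 x :: real)"
      proof (rule AE_I2)
        fix x show "norm (h x) \<le> norm (C * indicator S2 x :: real)"
        proof (cases "x \<in> S2")
          case True
          then show ?thesis using C[of x] by (simp add: S2_def)
        next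
          case False
          then have "\<bar>R\<bar> + 2 * cmod v < cmod x" by (simp add: S2_def)
          then have "R < cmod x" using norm_ge_zero[of v] by linarith
          then show ?thesis using supp by simp
        qed
      qed
    qed simp
  qed
  define g where "g n x = real (Suc n) * (h (x + (1 / real (Suc n)) *\<^sub>R v) - h x)" for n x
  have g0: "(LINT x|lborel. g n x) = 0" for n
  proof -
    let ?c = "(1 / real (Suc n)) *\<^sub>R v"
    have "lborel = distr lborel borel ((+) ?c)" by (rule lborel_distr_plus[symmetric])
    then have "(LINT x|lborel. h x) = (LINT x|distr lborel borel ((+) ?c). h x)" by simp
    also have "\<dots> = (LINT x|lborel. h (?c + x))" by (rule integral_distr) auto
    finally have e: "(LINT x|lborel. h x) = (LINT x|lborel. h (x + ?c))" by (simp add: add.commute)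
    have "integrable (distr lborel borel ((+) ?c)) h" using hint by (simp add: lborel_distr_plus)
    then have "integrable lborel (\<lambda>x. h (?c + x))" by (subst (asm) integrable_distr_eq) auto
    then have i: "integrable lborel (\<lambda>x. h (x + ?c))" by (simp add: add.commute)
    show ?thesis unfolding g_def using i hint e by simp
  qed
  have mvt: "\<exists>y. cmod (y - x) \<le> cmod v \<and> g n x = D y v" for n x
  proof -
    let ?t = "1 / real (Suc n)"
    have d: "((\<lambda>s. h (x + s *\<^sub>R v)) has_real_derivative D (x + s *\<^sub>R v) v) (at s)" for s
    proof -
      have "((\<lambda>s. x + s *\<^sub>R v) has_derivative (\<lambda>k. k *\<^sub>R v)) (at s)"
        by (auto intro!: derivative_eq_intros)
      then have "((\<lambda>s. h (x + s *\<^sub>R v)) has_derivative (\<lambda>k. D (x + s *\<^sub>R v) (k *\<^sub>R v))) (at s)"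
        by (rule has_derivative_compose) (rule der)
      moreover have "D (x + s *\<^sub>R v) (k *\<^sub>R v) = D (x + s *\<^sub>R v) v * k" for k
        using linear_scale[OF has_derivative_linear[OF der]] by simp
      ultimately show ?thesis by (simp add: has_field_derivative_def)
    qed
    obtain s where s: "0 < s" "s < ?t" "h (x + ?t *\<^sub>R v) - h (x + 0 *\<^sub>R v) = (?t - 0) * D (x + s *\<^sub>R v) v"
      using MVT2[of 0 ?t "\<lambda>s. h (x + s *\<^sub>R v)" "\<lambda>s. D (x + s *\<^sub>R v) v"] d by auto
    have "?t \<le> 1" by simp
    then have "s \<le> 1" using s(2) by linarith
    then have "s * cmod v \<le> 1 * cmod v" by (rule mult_right_mono) simp
    moreover have "g n x = D (x + s *\<^sub>R v) v" using s(3) by (simp add: g_def)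
    ultimately show ?thesis using s(1) by (intro exI[of _ "x + s *\<^sub>R v"]) simp
  qed
  have bnd: "norm (g n x) \<le> B * indicator S x" for n x
  proof (cases "x \<in> S")
    case True
    obtain y where y: "cmod (y - x) \<le> cmod v" "g n x = D y v" using mvt by blast
    have "cmod y \<le> cmod x + cmod (y - x)" using norm_triangle_ineq[of x "y - x"] by simp
    then have "y \<in> closure S2" using True y(1) by (simp add: S_def S2_def)
    then show ?thesis using B y(2) True by simp
  next
    case False
    have "cmod ((1 / real (Suc n)) *\<^sub>R v) \<le> cmod v" by (simp add: field_simps)
    then have "cmod x \<le> cmod (x + (1 / real (Suc n)) *\<^sub>R v) + cmod v"
      using norm_triangle_ineq4[of "x + (1 / real (Suc n)) *\<^sub>R v" "(1 / real (Suc n)) *\<^sub>R v"] by simp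
    moreover have "\<bar>R\<bar> + cmod v < cmod x" using False by (simp add: S_def)
    ultimately have "R < cmod (x + (1 / real (Suc n)) *\<^sub>R v)" "R < cmod x"
      using norm_ge_zero[of v] by linarith+
    then show ?thesis using False supp by (simp add: g_def)
  qed
  have "(\<lambda>n. LINT x|lborel. g n x) \<longlonglongrightarrow> (LINT x|lborel. D x v)"
  proof (rule integral_dominated_convergence[where w = "\<lambda>x. B * indicator S x"])
    show "integrable lborel (\<lambda>x. B * indicator S x)"
      using emeasure_bounded_finite[of S] by (intro integrable_mult_right integrable_real_indicator) (auto simp: S_def)
    show "AE x in lborel. (\<lambda>n. g n x) \<longlonglongrightarrow> D x v"
    proof (rule AE_I2)
      fix x
      have "((\<lambda>s. h (x + s *\<^sub>R v)) has_derivative (\<lambda>k. D (x + 0 *\<^sub>R v) (k *\<^sub>R v))) (at 0)"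
        by (rule has_derivative_compose[of "\<lambda>s. x + s *\<^sub>R v" "\<lambda>k. k *\<^sub>R v", OF _ der]) (auto intro!: derivative_eq_intros)
      moreover have "D x (k *\<^sub>R v) = D x v * k" for k
        using linear_scale[OF has_derivative_linear[OF der]] by simp
      ultimately have "((\<lambda>s. h (x + s *\<^sub>R v)) has_real_derivative D x v) (at 0)"
        by (simp add: has_field_derivative_def)
      then have L: "((\<lambda>s. (h (x + s *\<^sub>R v) - h x) / s) \<longlongrightarrow> D x v) (at 0)"
        by (simp add: has_field_derivative_iff)
      have "filterlim (\<lambda>n. 1 / real (Suc n)) (at 0) sequentially"
        by real_asymp
      from filterlim_compose[OF L this] show "(\<lambda>n. g n x) \<longlonglongrightarrow> D x v"
        by (simp add: g_def mult.commute)
    qed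
  qed (use bnd in \<open>auto simp: g_def[abs_def]\<close>)
  then show ?thesis by (simp add: g0 LIMSEQ_const_iff)
qed

text \<open>
  Integration by parts: the gradient of \<open>f * p\<close> has integral \<open>0\<close> for every test function \<open>p\<close>.
\<close>

lemma smooth_sobolev_H1:
  assumes f: "smooth f" and O: "bounded \<Omega>" "open \<Omega>"
  shows "sobolev_H1 \<Omega> f (grad f)"
  unfolding sobolev_H1_def
proof (intro conjI allI impI)
  show "square_integrable (lebesgue_on \<Omega>) f"
    by (intro square_integrable_continuous bounded_finite_lebesgue_on O smoothD f)
  show "square_integrable (lebesgue_on \<Omega>) (grad f)"
    by (intro square_integrable_continuous bounded_finite_lebesgue_on O continuous_grad f)
  fix p assume "test_function \<Omega> p"
  then have p: "smooth p" and cpt: "compact (closure {x. p x \<noteq> 0})" and sub: "closure {x. p x \<noteq> 0} \<subseteq> \<Omega>"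
    by (auto simp: test_function_def)
  define K where "K = closure {x. p x \<noteq> 0}"
  have p0: "p x = 0" if "x \<notin> K" for x
    using that closure_subset[of "{x. p x \<noteq> 0}"] by (auto simp: K_def)
  have gp0: "grad p x = 0" if "x \<notin> K" for x
  proof (rule grad_eqI)
    have "((\<lambda>x. 0) has_derivative (\<lambda>v. 0)) (at x)" by simp
    then show "(p has_derivative (\<lambda>v. 0)) (at x)"
    proof (rule has_derivative_transform_within_open[of _ _ _ _ "- K"])
      show "open (- K)" by (simp add: K_def open_Compl)
      show "x \<in> - K" using that by simp
      show "0 = p y" if "y \<in> - K" for y using that p0[of y] by simp
    qed
  qed auto
  define D where "D x v = f x * (v \<bullet> grad p x) + (v \<bullet> grad f x) * p x" for x v
  have der: "((\<lambda>x. f x * p x) has_derivative D x) (at x)" for x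
    unfolding D_def[abs_def] by (intro has_derivative_mult has_derivative_smooth f p)
  have contD: "continuous_on UNIV (\<lambda>x. D x v)" for v
    unfolding D_def by (intro continuous_intros smoothD continuous_grad f p)
  obtain R where R: "\<And>x. x \<in> K \<Longrightarrow> cmod x \<le> R"
    using compact_imp_bounded[OF cpt] by (auto simp: bounded_iff K_def)
  have zero: "(LINT x|lborel. D x v) = 0" for v
    by (rule integral_directional_derivative_eq_0[OF der contD, of R]) (use R p0 in force)
  have zeroO: "(LINT x|lebesgue_on \<Omega>. D x v) = 0" for v
  proof -
    have Dm: "(\<lambda>x. D x v) \<in> borel_measurable borel" using contD by (rule borel_measurable_continuous_onI)
    have "(LINT x|lebesgue_on \<Omega>. D x v) = (LINT x|lebesgue. indicator \<Omega> x *\<^sub>R D x v)"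
      using O by (subst integral_restrict_space) auto
    also have "(\<lambda>x. indicator \<Omega> x *\<^sub>R D x v) = (\<lambda>x. D x v)"
    proof
      fix x show "indicator \<Omega> x *\<^sub>R D x v = D x v"
      proof (cases "x \<in> \<Omega>")
        case False
        then have "x \<notin> K" using sub by (auto simp: K_def)
        then show ?thesis by (simp add: D_def p0 gp0)
      qed auto
    qed
    also have "(LINT x|lebesgue. D x v) = (LINT x|lborel. D x v)"
      using Dm by (intro integral_completion) auto
    finally show ?thesis by (simp add: zero)
  qed
  have i1: "integrable (lebesgue_on \<Omega>) (\<lambda>x. f x *\<^sub>R grad p x)"
    by (intro integrable_continuous bounded_finite_lebesgue_on O continuous_intros smoothD continuous_grad f p)
  have i2: "integrable (lebesgue_on \<Omega>) (\<lambda>x. p x *\<^sub>R grad f x)"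
    by (intro integrable_continuous bounded_finite_lebesgue_on O continuous_intros smoothD continuous_grad f p)
  have "v \<bullet> ((LINT x|lebesgue_on \<Omega>. f x *\<^sub>R grad p x) + (LINT x|lebesgue_on \<Omega>. p x *\<^sub>R grad f x)) = 0" for v
  proof -
    have "(LINT x|lebesgue_on \<Omega>. D x v) = (LINT x|lebesgue_on \<Omega>. v \<bullet> (f x *\<^sub>R grad p x + p x *\<^sub>R grad f x))"
      by (intro Bochner_Integration.integral_cong) (auto simp: D_def inner_add_right mult.commute)
    also have "\<dots> = v \<bullet> (LINT x|lebesgue_on \<Omega>. f x *\<^sub>R grad p x + p x *\<^sub>R grad f x)"
      by (rule integral_inner_right) (use i1 i2 in auto)
    finally show ?thesis using i1 i2 by (simp add: zeroO)
  qed
  from this[of "(LINT x|lebesgue_on \<Omega>. f x *\<^sub>R grad p x) + (LINT x|lebesgue_on \<Omega>. p x *\<^sub>R grad f x)"]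
  show "(LINT x|lebesgue_on \<Omega>. f x *\<^sub>R grad p x) = - (LINT x|lebesgue_on \<Omega>. p x *\<^sub>R grad f x)"
    by (simp add: eq_neg_iff_add_eq_0)
qed

lemma smooth_has_trace:
  assumes f: "smooth f" and O: "bounded \<Omega>" and fin: "emeasure hausdorff1 (frontier \<Omega>) < top"
  shows "has_trace \<Omega> f (grad f) f"
  unfolding has_trace_def
proof
  show "square_integrable (boundary_measure \<Omega>) f"
    by (intro square_integrable_continuous bounded_finite_boundary_measure fin O smoothD f)
  show "\<exists>\<phi>. (\<forall>n. smooth (\<phi> n)) \<and> tendsto_L2 (lebesgue_on \<Omega>) \<phi> f \<and>
        tendsto_L2 (lebesgue_on \<Omega>) (\<lambda>n. grad (\<phi> n)) (grad f) \<and> tendsto_L2 (boundary_measure \<Omega>) \<phi> f"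
    by (intro exI[of _ "\<lambda>_. f"]) (simp add: f tendsto_L2_def)
qed

lemma robin_lambda1_le:
  assumes f: "smooth f" and O: "bounded \<Omega>" "open \<Omega>" and fin: "emeasure hausdorff1 (frontier \<Omega>) < top"
    and nz: "\<not> (AE x in lebesgue_on \<Omega>. f x = 0)" and "0 \<le> b"
  shows "robin_lambda1 \<Omega> b \<le> robin_rayleigh \<Omega> b f (grad f) f"
  unfolding robin_lambda1_def
proof (rule cInf_lower)
  show "robin_rayleigh \<Omega> b f (grad f) f \<in> {robin_rayleigh \<Omega> b u g t |u g t.
       sobolev_H1 \<Omega> u g \<and> has_trace \<Omega> u g t \<and> \<not> (AE x in lebesgue_on \<Omega>. u x = 0)}"
    using smooth_sobolev_H1[OF f O] smooth_has_trace[OF f O(1) fin] nz by blast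
  show "bdd_below {robin_rayleigh \<Omega> b u g t |u g t.
       sobolev_H1 \<Omega> u g \<and> has_trace \<Omega> u g t \<and> \<not> (AE x in lebesgue_on \<Omega>. u x = 0)}"
    using \<open>0 \<le> b\<close> by (intro bdd_belowI[of _ 0]) (auto simp: robin_rayleigh_def intro!: divide_nonneg_nonneg add_nonneg_nonneg mult_nonneg_nonneg)
qed

lemma integral_square_pos:
  fixes u :: "complex \<Rightarrow> real"
  assumes "square_integrable M u" and nz: "\<not> (AE x in M. u x = 0)"
  shows "0 < (LINT x|M. (u x)\<^sup>2)"
proof -
  have ui: "integrable M (\<lambda>x. (u x)\<^sup>2)" using assms(1) by (simp add: square_integrable_def)
  have "(LINT x|M. (u x)\<^sup>2) \<noteq> 0"
  proof
    assume "(LINT x|M. (u x)\<^sup>2) = 0"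
    then have "AE x in M. (u x)\<^sup>2 = 0"
      using integral_nonneg_eq_0_iff_AE[OF ui] by simp
    then show False using nz by simp
  qed
  moreover have "0 \<le> (LINT x|M. (u x)\<^sup>2)" by simp
  ultimately show ?thesis by linarith
qed

lemma not_AE_zero:
  assumes "open \<Omega>" "\<Omega> \<noteq> {}" and nz: "\<And>x. x \<in> \<Omega> \<Longrightarrow> f x \<noteq> (0::real)"
  shows "\<not> (AE x in lebesgue_on \<Omega>. f x = 0)"
proof
  assume "AE x in lebesgue_on \<Omega>. f x = 0"
  then have "AE x in lebesgue. x \<in> \<Omega> \<longrightarrow> f x = 0"
    using \<open>open \<Omega>\<close> by (subst (asm) AE_restrict_space_iff) auto
  then have "AE x in lebesgue. x \<notin> \<Omega>" by eventually_elim (use nz in blast)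
  then have "\<Omega> \<in> null_sets lebesgue"
    using \<open>open \<Omega>\<close> by (subst AE_iff_null_sets) auto
  then show False
    using open_not_negligible[OF assms(1,2)] by (simp add: negligible_iff_null_sets)
qed

text \<open>
  The trace of a Sobolev function comes with smooth functions that approximate the function, its
  gradient and its trace at the same time. An inequality between the three quadratic
  expressions therefore passes from smooth functions to all competitors.
\<close>

lemma robin_lambda1_ge:
  assumes O: "bounded \<Omega>" "open \<Omega>" "\<Omega> \<noteq> {}" and fin: "emeasure hausdorff1 (frontier \<Omega>) < top"
    and ineq: "\<And>f. smooth f \<Longrightarrow> c * (LINT x|lebesgue_on \<Omega>. (f x)\<^sup>2)
        \<le> (LINT x|lebesgue_on \<Omega>. (norm (grad f x))\<^sup>2) + b * (LINT x|boundary_measure \<Omega>. (f x)\<^sup>2)"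
  shows "c \<le> robin_lambda1 \<Omega> b"
  unfolding robin_lambda1_def
proof (rule cInf_greatest)
  have "\<not> (AE x in lebesgue_on \<Omega>. (1::real) = 0)"
    using O by (intro not_AE_zero) auto
  then show "{robin_rayleigh \<Omega> b u g t |u g t.
       sobolev_H1 \<Omega> u g \<and> has_trace \<Omega> u g t \<and> \<not> (AE x in lebesgue_on \<Omega>. u x = 0)} \<noteq> {}"
    using smooth_sobolev_H1[OF smooth_const[of 1] O(1,2)] smooth_has_trace[OF smooth_const[of 1] O(1) fin] by blast
next
  fix r assume "r \<in> {robin_rayleigh \<Omega> b u g t |u g t.
       sobolev_H1 \<Omega> u g \<and> has_trace \<Omega> u g t \<and> \<not> (AE x in lebesgue_on \<Omega>. u x = 0)}"
  then obtain u g t where r: "r = robin_rayleigh \<Omega> b u g t" and H: "sobolev_H1 \<Omega> u g" and T: "has_trace \<Omega> u g t"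
      and nz: "\<not> (AE x in lebesgue_on \<Omega>. u x = 0)" by blast
  have u: "square_integrable (lebesgue_on \<Omega>) u" and g: "square_integrable (lebesgue_on \<Omega>) g"
    using H by (auto simp: sobolev_H1_def)
  from T obtain p where t: "square_integrable (boundary_measure \<Omega>) t" and p: "\<And>n. smooth (p n)"
      and lim: "tendsto_L2 (lebesgue_on \<Omega>) p u" "tendsto_L2 (lebesgue_on \<Omega>) (\<lambda>n. grad (p n)) g"
        "tendsto_L2 (boundary_measure \<Omega>) p t" unfolding has_trace_def by blast
  have l1: "(\<lambda>n. LINT x|lebesgue_on \<Omega>. (norm (p n x))\<^sup>2) \<longlonglongrightarrow> (LINT x|lebesgue_on \<Omega>. (norm (u x))\<^sup>2)"
    by (rule tendsto_L2_norm[OF _ u lim(1)]) (intro square_integrable_continuous bounded_finite_lebesgue_on O smoothD p)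
  have l2: "(\<lambda>n. LINT x|lebesgue_on \<Omega>. (norm (grad (p n) x))\<^sup>2) \<longlonglongrightarrow> (LINT x|lebesgue_on \<Omega>. (norm (g x))\<^sup>2)"
    by (rule tendsto_L2_norm[OF _ g lim(2)]) (intro square_integrable_continuous bounded_finite_lebesgue_on O continuous_grad p)
  have l3: "(\<lambda>n. LINT x|boundary_measure \<Omega>. (norm (p n x))\<^sup>2) \<longlonglongrightarrow> (LINT x|boundary_measure \<Omega>. (norm (t x))\<^sup>2)"
    by (rule tendsto_L2_norm[OF _ t lim(3)]) (intro square_integrable_continuous bounded_finite_boundary_measure fin O smoothD p)
  have le: "c * (LINT x|lebesgue_on \<Omega>. (norm (u x))\<^sup>2)
      \<le> (LINT x|lebesgue_on \<Omega>. (norm (g x))\<^sup>2) + b * (LINT x|boundary_measure \<Omega>. (norm (t x))\<^sup>2)"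
    by (rule LIMSEQ_le[OF tendsto_mult[OF tendsto_const l1] tendsto_add[OF l2 tendsto_mult[OF tendsto_const l3]]])
       (use ineq[OF p] in simp)
  have "0 < (LINT x|lebesgue_on \<Omega>. (u x)\<^sup>2)" using u nz by (rule integral_square_pos)
  with le show "c \<le> r" by (simp add: r robin_rayleigh_def field_simps)
qed

section \<open>The lower bound on disks\<close>

lemma nn_integral_Ioo_continuous:
  fixes g :: "real \<Rightarrow> real"
  assumes "continuous_on {a..b} g" and nn: "\<And>x. x \<in> {a..b} \<Longrightarrow> 0 \<le> g x"
  shows "(\<integral>\<^sup>+x\<in>{a<..<b}. ennreal (g x) \<partial>lborel) = ennreal (integral {a..b} g)"
proof (rule nn_integral_has_integral_lebesgue')
  have "(g has_integral integral {a..b} g) {a..b}"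
    using assms(1) by (intro integrable_integral integrable_continuous_real)
  then show "(g has_integral integral {a..b} g) {a<..<b}" by (simp add: has_integral_Icc_iff_Ioo)
qed (use nn in auto)

lemma measurable_nn_integral_section:
  fixes h :: "real \<Rightarrow> real \<Rightarrow> real"
  assumes h: "continuous_on UNIV (\<lambda>p. h (fst p) (snd p))" and I: "I \<in> sets borel"
  shows "(\<lambda>t. \<integral>\<^sup>+x\<in>I. ennreal (h t x) \<partial>lborel) \<in> borel_measurable borel"
proof -
  have "(\<lambda>p. h (fst p) (snd p)) \<in> borel_measurable (borel \<Otimes>\<^sub>M borel)"
    unfolding borel_prod using h by (rule borel_measurable_continuous_onI)
  then have "(\<lambda>p. ennreal (h (fst p) (snd p)) * indicator I (snd p)) \<in> borel_measurable (borel \<Otimes>\<^sub>M borel)"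
    using I by measurable
  then have "(\<lambda>(t, x). ennreal (h t x) * indicator I x) \<in> borel_measurable (borel \<Otimes>\<^sub>M lborel)"
    by (simp add: split_def cong: measurable_cong_sets)
  then show ?thesis by (rule lborel.borel_measurable_nn_integral)
qed

context radial_ground_state
begin

text \<open>
  On each ray from the centre, the restriction of a smooth function \<open>f\<close> obeys the one-dimensional
  inequality, and its radial derivative is at most \<open>r * |grad f|\<close>. Integration over the rays gives the
  inequality for Rayleigh quotients on the disk. Admitting every radius covers the
  images of the unit disk under linear maps.
\<close>

lemma robin_lambda1_ball_ge:
  assumes r: "0 < r" and br: "b \<le> \<beta> * r"
  shows "l / r\<^sup>2 \<le> robin_lambda1 (ball c r) \<beta>"
proof (rule robin_lambda1_ge)
  show fin: "emeasure hausdorff1 (frontier (ball c r)) < top"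
    using r by (simp add: frontier_ball emeasure_hausdorff1_sphere)
  have \<beta>: "0 < \<beta>" using r br b_pos by (metis less_le_trans zero_less_mult_pos2)
  fix f assume f: "smooth f"
  define P where "P t x = c + of_real (r * x) * cis t" for t x :: real
  have contP: "continuous_on UNIV (\<lambda>p. P (fst p) (snd p))" unfolding P_def by (intro continuous_intros)
  have contPt: "continuous_on S (P t)" for S t unfolding P_def by (intro continuous_intros)
  have contf: "continuous_on S f" for S by (rule smoothD[OF f])
  have contg: "continuous_on S (\<lambda>z. norm (grad f z))" for S by (intro continuous_intros continuous_grad f)
  define a where "a t = (\<integral>\<^sup>+x\<in>{0<..<1}. ennreal (r\<^sup>2 * (x * (f (P t x))\<^sup>2)) \<partial>lborel)" for t
  define g where "g t = (\<integral>\<^sup>+x\<in>{0<..<1}. ennreal (r\<^sup>2 * (x * (norm (grad f (P t x)))\<^sup>2)) \<partial>lborel)" for t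
  have am [measurable]: "a \<in> borel_measurable borel" unfolding a_def
    by (rule measurable_nn_integral_section) (auto intro!: continuous_intros continuous_on_compose2[OF contf contP])
  have gm [measurable]: "g \<in> borel_measurable borel" unfolding g_def
    by (rule measurable_nn_integral_section) (auto intro!: continuous_intros continuous_on_compose2[OF contg contP])
  have per: "ennreal (l / r\<^sup>2) * a t \<le> g t + ennreal (b * (f (P t 1))\<^sup>2)" for t
  proof -
    define F where "F x = f (P t x)" for x
    define F' where "F' x = (of_real r * cis t) \<bullet> grad f (P t x)" for x
    have dF: "(F has_real_derivative F' x) (at x)" for x
    proof -
      have "(P t has_derivative (\<lambda>k. k *\<^sub>R (of_real r * cis t))) (at x)"
        unfolding P_def[abs_def] by (auto intro!: derivative_eq_intros simp: scaleR_conv_of_real)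
      then have "(F has_derivative (\<lambda>k. (k *\<^sub>R (of_real r * cis t)) \<bullet> grad f (P t x))) (at x)"
        unfolding F_def[abs_def] by (rule has_derivative_compose) (rule has_derivative_smooth[OF f])
      then show ?thesis unfolding has_field_derivative_def F'_def
        by (rule has_derivative_eq_rhs) (simp add: fun_eq_iff mult.commute)
    qed
    have cF: "continuous_on {0..1} F" unfolding F_def[abs_def] by (rule continuous_on_compose2[OF contf contPt]) auto
    have cF': "continuous_on {0..1} F'" unfolding F'_def[abs_def]
      by (intro continuous_intros continuous_on_compose2[OF continuous_grad[OF f, of UNIV] contPt]) auto
    have a: "a t = ennreal (integral {0..1} (\<lambda>x. r\<^sup>2 * (x * (F x)\<^sup>2)))"
      unfolding a_def F_def[symmetric] by (rule nn_integral_Ioo_continuous) (auto intro!: continuous_intros cF)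
    have "ennreal (l / r\<^sup>2) * a t = ennreal (l * integral {0..1} (\<lambda>x. x * (F x)\<^sup>2))"
      unfolding a using r l_pos by (subst ennreal_mult'[symmetric]) auto
    also have "\<dots> \<le> ennreal (integral {0..1} (\<lambda>x. x * (F' x)\<^sup>2) + b * (F 1)\<^sup>2)"
      by (intro ennreal_leI radial_inequality dF cF')
    also have "\<dots> = ennreal (integral {0..1} (\<lambda>x. x * (F' x)\<^sup>2)) + ennreal (b * (F 1)\<^sup>2)"
      using b_pos by (intro ennreal_plus integral_nonneg integrable_continuous_real continuous_intros cF') auto
    also have "ennreal (integral {0..1} (\<lambda>x. x * (F' x)\<^sup>2)) = (\<integral>\<^sup>+x\<in>{0<..<1}. ennreal (x * (F' x)\<^sup>2) \<partial>lborel)"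
      by (rule nn_integral_Ioo_continuous[symmetric]) (auto intro!: continuous_intros cF')
    also have "\<dots> \<le> g t" unfolding g_def
    proof (rule nn_integral_mono)
      fix x
      have "\<bar>F' x\<bar> \<le> norm (of_real r * cis t) * norm (grad f (P t x))"
        unfolding F'_def by (rule Cauchy_Schwarz_ineq2)
      also have "norm (of_real r * cis t) = r" using r by (simp add: norm_mult)
      finally have "\<bar>F' x\<bar>\<^sup>2 \<le> (r * norm (grad f (P t x)))\<^sup>2" by (intro power_mono) auto
      then have "(F' x)\<^sup>2 \<le> r\<^sup>2 * (norm (grad f (P t x)))\<^sup>2" by (simp add: power_mult_distrib)
      then have "0 \<le> x \<Longrightarrow> x * (F' x)\<^sup>2 \<le> r\<^sup>2 * (x * (norm (grad f (P t x)))\<^sup>2)"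
        by (metis mult.left_commute mult_left_mono)
      then show "ennreal (x * (F' x)\<^sup>2) * indicator {0<..<1} x
          \<le> ennreal (r\<^sup>2 * (x * (norm (grad f (P t x)))\<^sup>2)) * indicator {0<..<1} x"
        by (auto simp: indicator_def intro!: ennreal_leI)
    qed
    finally show ?thesis by (simp add: F_def add_right_mono)
  qed
  have fP1m [measurable]: "(\<lambda>t. (f (c + of_real r * cis t))\<^sup>2) \<in> borel_measurable borel"
    by (intro borel_measurable_continuous_onI continuous_intros continuous_on_compose2[OF contf]) auto
  have fm: "(\<lambda>z. (f z)\<^sup>2) \<in> borel_measurable borel" and gfm: "(\<lambda>z. (norm (grad f z))\<^sup>2) \<in> borel_measurable borel"
    by (intro borel_measurable_continuous_onI continuous_intros contf contg)+
  let ?I = "indicator {0<..<2 * pi} :: real \<Rightarrow> ennreal"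
  have mass: "ennreal (LINT x|lebesgue_on (ball c r). (f x)\<^sup>2) = (\<integral>\<^sup>+t. a t * ?I t \<partial>lborel)"
    unfolding a_def P_def
  proof (subst nn_integral_polar(1)[OF fm _ r, symmetric])
    show "ennreal (LINT x|lebesgue_on (ball c r). (f x)\<^sup>2) = (\<integral>\<^sup>+z\<in>ball c r. ennreal ((f z)\<^sup>2) \<partial>lborel)"
      by (rule ennreal_lebesgue_on_integral) (auto intro!: continuous_intros contf)
  qed simp
  have energy: "ennreal (LINT x|lebesgue_on (ball c r). (norm (grad f x))\<^sup>2) = (\<integral>\<^sup>+t. g t * ?I t \<partial>lborel)"
    unfolding g_def P_def
  proof (subst nn_integral_polar(1)[OF gfm _ r, symmetric])
    show "ennreal (LINT x|lebesgue_on (ball c r). (norm (grad f x))\<^sup>2) = (\<integral>\<^sup>+z\<in>ball c r. ennreal ((norm (grad f z))\<^sup>2) \<partial>lborel)"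
      by (rule ennreal_lebesgue_on_integral) (auto intro!: continuous_intros contg)
  qed simp
  have bint: "integrable (boundary_measure (ball c r)) (\<lambda>z. (f z)\<^sup>2)"
    by (intro integrable_continuous bounded_finite_boundary_measure fin continuous_intros contf) auto
  have bdry: "ennreal (LINT x|boundary_measure (ball c r). (f x)\<^sup>2)
      = ennreal r * (\<integral>\<^sup>+t\<in>{0..<2 * pi}. ennreal ((f (c + of_real r * cis t))\<^sup>2) \<partial>lborel)"
    using nn_integral_eq_integral[OF bint] nn_integral_boundary_measure_ball[OF r, of "\<lambda>z. ennreal ((f z)\<^sup>2)" c] fm
    by simp
  have "ennreal (l / r\<^sup>2 * (LINT x|lebesgue_on (ball c r). (f x)\<^sup>2)) = ennreal (l / r\<^sup>2) * (\<integral>\<^sup>+t. a t * ?I t \<partial>lborel)"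
    using l_pos by (subst ennreal_mult') (auto simp: mass)
  also have "\<dots> = (\<integral>\<^sup>+t. ennreal (l / r\<^sup>2) * (a t * ?I t) \<partial>lborel)"
    by (rule nn_integral_cmult[symmetric]) measurable
  also have "\<dots> \<le> (\<integral>\<^sup>+t. g t * ?I t + ennreal b * (ennreal ((f (c + of_real r * cis t))\<^sup>2) * indicator {0..<2 * pi} t) \<partial>lborel)"
  proof (rule nn_integral_mono)
    fix t
    show "ennreal (l / r\<^sup>2) * (a t * ?I t) \<le> g t * ?I t + ennreal b * (ennreal ((f (c + of_real r * cis t))\<^sup>2) * indicator {0..<2 * pi} t)"
    proof (cases "t \<in> {0<..<2 * pi}")
      case True
      then have "?I t = 1" "indicator {0..<2 * pi} t = (1::ennreal)" by auto
      then show ?thesis using per[of t] b_pos by (simp add: P_def ennreal_mult')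
    next
      case False
      then have "?I t = 0" by simp
      then show ?thesis by simp
    qed
  qed
  also have "\<dots> = (\<integral>\<^sup>+t. g t * ?I t \<partial>lborel)
      + ennreal b * (\<integral>\<^sup>+t\<in>{0..<2 * pi}. ennreal ((f (c + of_real r * cis t))\<^sup>2) \<partial>lborel)"
  proof -
    have m: "(\<lambda>t. ennreal ((f (c + of_real r * cis t))\<^sup>2) * indicator {0..<2 * pi} t) \<in> borel_measurable lborel"
      by measurable
    show ?thesis
      by (subst nn_integral_add) (simp_all add: nn_integral_cmult[OF m] borel_measurable_times_ennreal fP1m)
  qed
  also have "\<dots> \<le> ennreal (LINT x|lebesgue_on (ball c r). (norm (grad f x))\<^sup>2)
      + ennreal (\<beta> * r) * (\<integral>\<^sup>+t\<in>{0..<2 * pi}. ennreal ((f (c + of_real r * cis t))\<^sup>2) \<partial>lborel)"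
    using br unfolding energy by (intro add_left_mono mult_right_mono ennreal_leI) auto
  also have "\<dots> = ennreal (LINT x|lebesgue_on (ball c r). (norm (grad f x))\<^sup>2)
      + ennreal \<beta> * ennreal (LINT x|boundary_measure (ball c r). (f x)\<^sup>2)"
    unfolding bdry using \<beta> r by (simp add: ennreal_mult mult.assoc)
  also have "\<dots> = ennreal ((LINT x|lebesgue_on (ball c r). (norm (grad f x))\<^sup>2)
      + \<beta> * (LINT x|boundary_measure (ball c r). (f x)\<^sup>2))"
    using \<beta> by (simp add: ennreal_mult' ennreal_plus)
  finally show "l / r\<^sup>2 * (LINT x|lebesgue_on (ball c r). (f x)\<^sup>2)
      \<le> (LINT x|lebesgue_on (ball c r). (norm (grad f x))\<^sup>2) + \<beta> * (LINT x|boundary_measure (ball c r). (f x)\<^sup>2)"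
    using \<beta> by (subst (asm) ennreal_le_iff) auto
qed (use r in auto)

end

section \<open>Transplantation by a conformal map\<close>

text \<open>
  Expand the square around \<open>H 0\<close>. The mixed term integrates to \<open>0\<close> by the mean value property,
  which is Cauchy's formula on the circle of radius \<open>x\<close>.
\<close>

lemma circle_mean_square:
  assumes H: "H holomorphic_on ball 0 1" and x: "0 < x" "x < 1"
  shows "(\<integral>\<^sup>+t\<in>{0<..<2 * pi}. ennreal ((cmod (H (of_real x * cis t)))\<^sup>2) \<partial>lborel)
     = ennreal (2 * pi * (cmod (H 0))\<^sup>2)
       + (\<integral>\<^sup>+t\<in>{0<..<2 * pi}. ennreal ((cmod (H (of_real x * cis t) - H 0))\<^sup>2) \<partial>lborel)"
proof -
  have contH: "continuous_on UNIV (\<lambda>t. H (of_real x * cis t))"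
    by (rule continuous_on_compose2[OF holomorphic_on_imp_continuous_on[OF H]])
       (use x in \<open>auto intro!: continuous_intros simp: norm_mult\<close>)
  have "((\<lambda>u. H u / (u - 0)) has_contour_integral (2 * of_real pi * \<i> * H 0)) (circlepath 0 x)"
    using x by (intro Cauchy_integral_circlepath)
      (auto intro!: holomorphic_on_imp_continuous_on holomorphic_on_subset[OF H])
  then have "((\<lambda>t. H (of_real x * cis t) / (of_real x * cis t) * of_real x * \<i> * cis t) has_integral 2 * of_real pi * \<i> * H 0) {0..2 * pi}"
    unfolding circlepath_def by (subst (asm) has_contour_integral_part_circlepath_iff) auto
  then have "((\<lambda>t. \<i> * H (of_real x * cis t)) has_integral 2 * of_real pi * \<i> * H 0) {0..2 * pi}"
    using x by (simp add: field_simps)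
  then have "((\<lambda>t. (- \<i>) * (\<i> * H (of_real x * cis t))) has_integral (- \<i>) * (2 * of_real pi * \<i> * H 0)) {0..2 * pi}"
    by (rule has_integral_mult_right)
  then have m: "((\<lambda>t. H (of_real x * cis t)) has_integral 2 * of_real pi * H 0) {0..2 * pi}"
    by (simp add: mult_ac)
  have c: "((\<lambda>t. H 0) has_integral of_real (2 * pi) * H 0) {0..2 * pi}"
    using has_integral_const_real[of "H 0" 0 "2 * pi"] by (simp add: scaleR_conv_of_real)
  have "((\<lambda>t. H (of_real x * cis t) - H 0) has_integral 0) {0..2 * pi}"
    using has_integral_diff[OF m c] by simp
  then have "((\<lambda>t. cnj (H 0) * (H (of_real x * cis t) - H 0)) has_integral cnj (H 0) * 0) {0..2 * pi}"
    by (rule has_integral_mult_right)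
  then have "((\<lambda>t. Re (cnj (H 0) * (H (of_real x * cis t) - H 0))) has_integral Re (cnj (H 0) * 0)) {0..2 * pi}"
    by (rule has_integral_Re)
  then have z: "integral {0..2 * pi} (\<lambda>t. Re (cnj (H 0) * (H (of_real x * cis t) - H 0))) = 0"
    by (auto simp: has_integral_iff)
  have e: "(cmod w)\<^sup>2 = (cmod a)\<^sup>2 + (2 * Re (cnj a * (w - a)) + (cmod (w - a))\<^sup>2)" for w a
    unfolding cmod_power2 by (simp add: power2_eq_square algebra_simps)
  have cont: "continuous_on S (\<lambda>t. H (of_real x * cis t))" for S using contH by (rule continuous_on_subset) simp
  have "integral {0..2 * pi} (\<lambda>t. (cmod (H (of_real x * cis t)))\<^sup>2)
      = integral {0..2 * pi} (\<lambda>t. (cmod (H 0))\<^sup>2 + (2 * Re (cnj (H 0) * (H (of_real x * cis t) - H 0))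
            + (cmod (H (of_real x * cis t) - H 0))\<^sup>2))"
    by (subst e[of _ "H 0"]) simp
  also have "\<dots> = integral {0..2 * pi} (\<lambda>t. (cmod (H 0))\<^sup>2) + integral {0..2 * pi} (\<lambda>t. 2 * Re (cnj (H 0) * (H (of_real x * cis t) - H 0))
            + (cmod (H (of_real x * cis t) - H 0))\<^sup>2)"
    by (rule Henstock_Kurzweil_Integration.integral_add; intro integrable_continuous_real continuous_intros cont)
  also have "integral {0..2 * pi} (\<lambda>t. 2 * Re (cnj (H 0) * (H (of_real x * cis t) - H 0))
            + (cmod (H (of_real x * cis t) - H 0))\<^sup>2)
      = integral {0..2 * pi} (\<lambda>t. 2 * Re (cnj (H 0) * (H (of_real x * cis t) - H 0)))
        + integral {0..2 * pi} (\<lambda>t. (cmod (H (of_real x * cis t) - H 0))\<^sup>2)"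
    by (rule Henstock_Kurzweil_Integration.integral_add; intro integrable_continuous_real continuous_intros cont)
  also have "integral {0..2 * pi} (\<lambda>t. 2 * Re (cnj (H 0) * (H (of_real x * cis t) - H 0))) = 0"
    using z by (subst integral_mult_right) simp
  finally have main: "integral {0..2 * pi} (\<lambda>t. (cmod (H (of_real x * cis t)))\<^sup>2)
      = 2 * pi * (cmod (H 0))\<^sup>2 + integral {0..2 * pi} (\<lambda>t. (cmod (H (of_real x * cis t) - H 0))\<^sup>2)"
    by simp
  have n1: "(\<integral>\<^sup>+t\<in>{0<..<2 * pi}. ennreal ((cmod (H (of_real x * cis t)))\<^sup>2) \<partial>lborel)
      = ennreal (integral {0..2 * pi} (\<lambda>t. (cmod (H (of_real x * cis t)))\<^sup>2))"
    by (rule nn_integral_Ioo_continuous) (auto intro!: continuous_intros cont)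
  have n2: "(\<integral>\<^sup>+t\<in>{0<..<2 * pi}. ennreal ((cmod (H (of_real x * cis t) - H 0))\<^sup>2) \<partial>lborel)
      = ennreal (integral {0..2 * pi} (\<lambda>t. (cmod (H (of_real x * cis t) - H 0))\<^sup>2))"
    by (rule nn_integral_Ioo_continuous) (auto intro!: continuous_intros cont)
  have "0 \<le> integral {0..2 * pi} (\<lambda>t. (cmod (H (of_real x * cis t) - H 0))\<^sup>2)"
    by (intro integral_nonneg integrable_continuous_real continuous_intros cont) auto
  then show ?thesis unfolding n1 n2 main by (subst ennreal_plus) auto
qed

lemma continuous_flat_cutoff:
  "E holomorphic_on UNIV \<Longrightarrow> 0 < e \<Longrightarrow> continuous_on S (flat_cutoff e a m E)"
  using DERIV_isCont[OF flat_cutoff_has_derivative] by (simp add: continuous_at_imp_continuous_on)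

text \<open>
  The composition of a radial function on the disk with the inverse \<open>G\<close> of \<open>F\<close>. The map \<open>F\<close> need not extend
  to the closed disk, but a profile that is constant for \<open>|w|\<^sup>2 \<ge> a\<close> gives a function on \<open>\<Omega>\<close> which is
  constant off a compact subset, and which is therefore smooth on the whole plane. The last property is the conformal
  invariance of the energy density.
\<close>

lemma radial_trial_function:
  assumes conf: "conformal_map_of_disk F \<Omega>" and "open \<Omega>"
    and E: "E holomorphic_on UNIV" and e: "0 < e" and a: "0 < a" "a < 1"
  obtains \<phi> where "smooth \<phi>" and "\<And>z. z \<notin> \<Omega> \<Longrightarrow> \<phi> z = k"
    and "\<And>w. w \<in> ball 0 1 \<Longrightarrow> \<phi> (F w) = k + flat_cutoff e a 0 E ((cmod w)\<^sup>2)"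
    and "\<And>w. w \<in> ball 0 1 \<Longrightarrow> (cmod (deriv F w))\<^sup>2 * (norm (grad \<phi> (F w)))\<^sup>2
           = (2 * cmod w * flat_cutoff e a 2 (flat_cutoff_diff e a 0 E) ((cmod w)\<^sup>2))\<^sup>2"
proof -
  have hol: "F holomorphic_on ball 0 1" and bij: "bij_betw F (ball 0 1) \<Omega>"
    using conf by (auto simp: conformal_map_of_disk_def)
  have img: "F ` ball 0 1 = \<Omega>" and inj: "inj_on F (ball 0 1)" using bij by (auto simp: bij_betw_def)
  obtain G where G: "G holomorphic_on \<Omega>" "\<And>w. w \<in> ball 0 1 \<Longrightarrow> deriv F w * deriv G (F w) = 1"
      "\<And>w. w \<in> ball 0 1 \<Longrightarrow> G (F w) = w"
    using holomorphic_has_inverse[OF hol open_ball inj] unfolding img by metis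
  define q where "q z = (cmod (G z))\<^sup>2" for z
  define \<phi> where "\<phi> z = k + (if z \<in> \<Omega> then flat_cutoff e a 0 E (q z) else 0)" for z
  define \<theta>' where "\<theta>' = flat_cutoff e a 2 (flat_cutoff_diff e a 0 E)"
  define K where "K = F ` cball 0 (sqrt a)"
  have sub: "cball 0 (sqrt a) \<subseteq> ball (0::complex) 1"
    using a by (simp add: cball_subset_ball_iff)
  have "compact K" unfolding K_def
    using continuous_on_subset[OF holomorphic_on_imp_continuous_on[OF hol] sub]
    by (intro compact_continuous_image) auto
  moreover have "K \<subseteq> \<Omega>" using sub img by (auto simp: K_def)
  moreover have "z \<in> K" if "z \<in> \<Omega>" "q z < a" for z
  proof -
    have "z \<in> F ` ball 0 1" using that(1) img by simp
    then obtain w where w: "w \<in> ball 0 1" "z = F w" by blast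
    then have "(cmod w)\<^sup>2 \<le> a" using that(2) G(3) by (simp add: q_def)
    then have "cmod w \<le> sqrt a" by (rule real_le_rsqrt)
    then show ?thesis using w by (auto simp: K_def)
  qed
  moreover have "q \<in> re_holomorphic_ring \<Omega>" unfolding q_def[abs_def] using G(1) by (rule cmod_square_in_ring)
  ultimately have "smooth (\<lambda>z. if z \<in> \<Omega> then flat_cutoff e a 0 E (q z) else 0)"
    using E e \<open>open \<Omega>\<close> by (intro flat_cutoff_smooth)
  then have sm: "smooth \<phi>" unfolding \<phi>_def[abs_def] by (rule smooth_add[OF smooth_const])
  have grad: "grad \<phi> z = \<theta>' (q z) *\<^sub>R (2 * G z * cnj (deriv G z))" if z: "z \<in> \<Omega>" for z
  proof (rule grad_eqI)
    let ?q' = "\<lambda>v. G z \<bullet> (deriv G z * v) + (deriv G z * v) \<bullet> G z"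
    have dG: "(G has_derivative (*) (deriv G z)) (at z)"
      using holomorphic_derivI[OF G(1) \<open>open \<Omega>\<close> z] by (simp add: has_field_derivative_def)
    have "(q has_derivative ?q') (at z)"
      unfolding q_def[abs_def] power2_norm_eq_inner by (rule has_derivative_inner[OF dG dG])
    moreover have "(flat_cutoff e a 0 E has_derivative (*) (\<theta>' (q z))) (at (q z))"
      using flat_cutoff_has_derivative[OF E e, of a 0 "q z"] unfolding has_field_derivative_def \<theta>'_def
      by (simp only: add_0)
    ultimately have "((\<lambda>z. flat_cutoff e a 0 E (q z)) has_derivative (\<lambda>v. \<theta>' (q z) * ?q' v)) (at z)"
      by (rule has_derivative_compose)
    then have "((\<lambda>z. k + flat_cutoff e a 0 E (q z)) has_derivative (\<lambda>v. 0 + \<theta>' (q z) * ?q' v)) (at z)"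
      by (intro has_derivative_add has_derivative_const)
    then show "(\<phi> has_derivative (\<lambda>v. 0 + \<theta>' (q z) * ?q' v)) (at z)"
      by (rule has_derivative_transform_within_open[OF _ \<open>open \<Omega>\<close> z]) (simp add: \<phi>_def)
  qed (simp_all add: inner_complex_def algebra_simps)
  show thesis
  proof
    show "smooth \<phi>" by fact
    show "\<phi> z = k" if "z \<notin> \<Omega>" for z using that by (simp add: \<phi>_def)
    fix w :: complex assume w: "w \<in> ball 0 1"
    have FO: "F w \<in> \<Omega>" using w img by auto
    show "\<phi> (F w) = k + flat_cutoff e a 0 E ((cmod w)\<^sup>2)" using FO G(3)[OF w] by (simp add: \<phi>_def q_def)
    have "cmod (deriv F w) * cmod (deriv G (F w)) = 1" using G(2)[OF w] by (metis norm_mult norm_one)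
    then have one: "(cmod (deriv F w))\<^sup>2 * (cmod (deriv G (F w)))\<^sup>2 = 1" by (metis power_mult_distrib power_one)
    have "(norm (grad \<phi> (F w)))\<^sup>2 = (2 * cmod w * \<theta>' ((cmod w)\<^sup>2))\<^sup>2 * (cmod (deriv G (F w)))\<^sup>2"
      using G(3)[OF w] by (simp add: grad[OF FO] q_def norm_mult power_mult_distrib)
    then have "(cmod (deriv F w))\<^sup>2 * (norm (grad \<phi> (F w)))\<^sup>2
        = (2 * cmod w * \<theta>' ((cmod w)\<^sup>2))\<^sup>2 * ((cmod (deriv F w))\<^sup>2 * (cmod (deriv G (F w)))\<^sup>2)" by simp
    then show "(cmod (deriv F w))\<^sup>2 * (norm (grad \<phi> (F w)))\<^sup>2
           = (2 * cmod w * flat_cutoff e a 2 (flat_cutoff_diff e a 0 E) ((cmod w)\<^sup>2))\<^sup>2"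
      unfolding one \<theta>'_def by simp
  qed
qed

lemma nn_integral_radial:
  assumes h: "continuous_on UNIV h" and nn: "\<And>x. 0 \<le> h x"
  shows "(\<integral>\<^sup>+z\<in>ball 0 1. ennreal (h (cmod z)) \<partial>lborel)
       = ennreal (2 * pi * integral {0..1} (\<lambda>x. x * h x))"
proof -
  have ch: "continuous_on S h" for S using h by (rule continuous_on_subset) simp
  have "(\<lambda>z. h (cmod z)) \<in> borel_measurable borel"
    by (intro borel_measurable_continuous_onI continuous_on_compose2[OF h]) (auto intro: continuous_intros)
  note nn_integral_polar(1)[OF this, of 0 1]
  then have "(\<integral>\<^sup>+z\<in>ball 0 1. ennreal (h (cmod z)) \<partial>lborel)
     = (\<integral>\<^sup>+t. (\<integral>\<^sup>+x\<in>{0<..<1}. ennreal (x * h \<bar>x\<bar>) \<partial>lborel) * indicator {0<..<2 * pi} t \<partial>lborel)"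
    using nn by (simp add: norm_mult)
  also have "(\<lambda>x. ennreal (x * h \<bar>x\<bar>) * indicator {0<..<1} x) = (\<lambda>x. ennreal (x * h x) * indicator {0<..<1::real} x)"
    by (auto simp: indicator_def fun_eq_iff)
  also have "(\<integral>\<^sup>+x\<in>{0<..<1}. ennreal (x * h x) \<partial>lborel) = ennreal (integral {0..1} (\<lambda>x. x * h x))"
  proof (rule nn_integral_Ioo_continuous)
    show "0 \<le> x * h x" if "x \<in> {0..1}" for x using that nn[of x] by simp
  qed (intro continuous_intros ch)
  also have "(\<integral>\<^sup>+t\<in>{0<..<2 * pi}. ennreal (integral {0..1} (\<lambda>x. x * h x)) \<partial>lborel)
      = ennreal (integral {0..1} (\<lambda>x. x * h x)) * ennreal (2 * pi)"
    by (subst nn_integral_cmult_indicator) auto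
  also have "\<dots> = ennreal (2 * pi * integral {0..1} (\<lambda>x. x * h x))"
    by (subst ennreal_mult''[symmetric]) (auto simp: mult.commute)
  finally show ?thesis .
qed

lemma nn_integral_conformal_disk:
  assumes conf: "conformal_map_of_disk F \<Omega>" and "open \<Omega>" and g: "continuous_on UNIV g" and nn: "\<And>x. 0 \<le> g x"
  shows "(\<integral>\<^sup>+z\<in>\<Omega>. ennreal (g z) \<partial>lborel)
       = (\<integral>\<^sup>+z\<in>ball 0 1. ennreal ((cmod (deriv F z))\<^sup>2 * g (F z)) \<partial>lborel)"
proof -
  have hol: "F holomorphic_on ball 0 1" and img: "F ` ball 0 1 = \<Omega>" and inj: "inj_on F (ball 0 1)"
    using conf by (auto simp: conformal_map_of_disk_def bij_betw_def)
  have "g \<in> borel_measurable borel" using g by (rule borel_measurable_continuous_onI)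
  moreover have "indicator \<Omega> \<in> borel_measurable borel" using \<open>open \<Omega>\<close> by (intro borel_measurable_indicator) auto
  ultimately have "(\<lambda>x. g x * indicator (F ` ball 0 1) x) \<in> borel_measurable borel"
    unfolding img by (rule borel_measurable_times)
  from nn_integral_conformal[OF open_ball hol inj this nn] show ?thesis unfolding img .
qed

text \<open>
  The Dirichlet integral is conformally invariant, so it is computed on the disk.
\<close>

lemma trial_energy:
  assumes conf: "conformal_map_of_disk F \<Omega>" and O: "open \<Omega>" "bounded \<Omega>" and sm: "smooth \<phi>"
    and \<theta>: "continuous_on UNIV \<theta>'"
    and grad: "\<And>w. w \<in> ball 0 1 \<Longrightarrow> (cmod (deriv F w))\<^sup>2 * (norm (grad \<phi> (F w)))\<^sup>2 = (2 * cmod w * \<theta>' ((cmod w)\<^sup>2))\<^sup>2"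
  shows "(LINT z|lebesgue_on \<Omega>. (norm (grad \<phi> z))\<^sup>2) = 2 * pi * integral {0..1} (\<lambda>x. x * (2 * x * \<theta>' (x\<^sup>2))\<^sup>2)"
proof -
  have cg: "continuous_on UNIV (\<lambda>z. (norm (grad \<phi> z))\<^sup>2)" by (intro continuous_intros continuous_grad sm)
  have ch: "continuous_on S (\<lambda>x. (2 * x * \<theta>' (x\<^sup>2))\<^sup>2)" for S
    by (intro continuous_intros continuous_on_compose2[OF \<theta>]) auto
  have "ennreal (LINT z|lebesgue_on \<Omega>. (norm (grad \<phi> z))\<^sup>2) = (\<integral>\<^sup>+z\<in>\<Omega>. ennreal ((norm (grad \<phi> z))\<^sup>2) \<partial>lborel)"
    using O cg by (intro ennreal_lebesgue_on_integral) auto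
  also have "\<dots> = (\<integral>\<^sup>+z\<in>ball 0 1. ennreal ((cmod (deriv F z))\<^sup>2 * (norm (grad \<phi> (F z)))\<^sup>2) \<partial>lborel)"
    using conf O(1) cg by (rule nn_integral_conformal_disk) auto
  also have "\<dots> = (\<integral>\<^sup>+z\<in>ball 0 1. ennreal ((2 * cmod z * \<theta>' ((cmod z)\<^sup>2))\<^sup>2) \<partial>lborel)"
  proof (rule nn_integral_cong)
    fix z show "ennreal ((cmod (deriv F z))\<^sup>2 * (norm (grad \<phi> (F z)))\<^sup>2) * indicator (ball 0 1) z
      = ennreal ((2 * cmod z * \<theta>' ((cmod z)\<^sup>2))\<^sup>2) * indicator (ball 0 1) z"
      by (cases "z \<in> ball 0 1") (simp_all only: grad indicator_simps mult_zero_right not_False_eq_True)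
  qed
  also have "\<dots> = ennreal (2 * pi * integral {0..1} (\<lambda>x. x * (2 * x * \<theta>' (x\<^sup>2))\<^sup>2))"
    using ch by (rule nn_integral_radial) auto
  finally show ?thesis
    by (subst (asm) ennreal_inj) (auto intro!: mult_nonneg_nonneg integral_nonneg integrable_continuous_real continuous_intros ch)
qed

lemma measurable_polar_section:
  fixes d :: "complex \<Rightarrow> real"
  assumes [measurable]: "d \<in> borel_measurable borel"
  shows "(\<lambda>x. \<integral>\<^sup>+t\<in>{0<..<2 * pi}. ennreal (x * d (of_real x * cis t)) \<partial>lborel) \<in> borel_measurable borel"
proof -
  have [measurable]: "(\<lambda>p. of_real (fst p) * cis (snd p)) \<in> borel_measurable (borel \<Otimes>\<^sub>M borel)"
    unfolding borel_prod by (intro borel_measurable_continuous_onI continuous_intros)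
  have "(\<lambda>p. ennreal (fst p * d (of_real (fst p) * cis (snd p))) * indicator {0<..<2 * pi} (snd p)) \<in> borel_measurable (borel \<Otimes>\<^sub>M borel)"
    by measurable
  then have "(\<lambda>(x, t). ennreal (x * d (of_real x * cis t)) * indicator {0<..<2 * pi} t) \<in> borel_measurable (borel \<Otimes>\<^sub>M lborel)"
    by (simp add: split_def cong: measurable_cong_sets)
  then show ?thesis by (rule lborel.borel_measurable_nn_integral)
qed

lemma borel_measurable_on_disk:
  fixes H :: "complex \<Rightarrow> real"
  assumes "continuous_on (ball 0 1) H"
  shows "(\<lambda>z. if z \<in> ball 0 1 then H z else 0) \<in> borel_measurable borel"
  using assms by (intro borel_measurable_continuous_on_if) (auto intro: borel_open)

text \<open>
  Under the conformal map the mass acquires the weight \<open>|F'|\<^sup>2\<close>. Its mean over each circle is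
  \<open>|F' 0|\<^sup>2\<close> plus the mean of \<open>|F' - F' 0|\<^sup>2\<close>. The second part contributes at least \<open>k\<^sup>2 * c\<close>, a
  gain that does not depend on the profile \<open>\<psi>\<close> as long as \<open>\<psi> \<ge> k\<close>. This makes the final inequality strict
  although the trial functions only approach the optimal one.
\<close>

lemma trial_mass:
  assumes conf: "conformal_map_of_disk F \<Omega>" and O: "open \<Omega>" "bounded \<Omega>" and sm: "smooth \<phi>"
    and \<psi>: "continuous_on UNIV \<psi>" and k: "0 \<le> k" "\<And>s. s \<in> {0..1} \<Longrightarrow> k \<le> \<psi> s"
    and \<phi>: "\<And>w. w \<in> ball 0 1 \<Longrightarrow> \<phi> (F w) = \<psi> ((cmod w)\<^sup>2)"
    and c: "0 \<le> c" "ennreal c \<le> (\<integral>\<^sup>+z\<in>ball 0 1. ennreal ((cmod (deriv F z - deriv F 0))\<^sup>2) \<partial>lborel)"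
  shows "(cmod (deriv F 0))\<^sup>2 * (2 * pi * integral {0..1} (\<lambda>x. x * (\<psi> (x\<^sup>2))\<^sup>2)) + k\<^sup>2 * c
           \<le> (LINT z|lebesgue_on \<Omega>. (\<phi> z)\<^sup>2)"
proof -
  have hol: "F holomorphic_on ball 0 1" using conf by (simp add: conformal_map_of_disk_def)
  have holF': "deriv F holomorphic_on ball 0 1" using hol by (rule holomorphic_deriv) simp
  have cF': "continuous_on (ball 0 1) (deriv F)" using holF' by (rule holomorphic_on_imp_continuous_on)
  have c\<psi>: "continuous_on S \<psi>" for S using \<psi> by (rule continuous_on_subset) simp
  have cw: "continuous_on S (\<lambda>x. (\<psi> (x\<^sup>2))\<^sup>2)" for S
    by (intro continuous_intros continuous_on_compose2[OF \<psi>]) auto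
  define d where "d z = (if z \<in> ball 0 1 then (cmod (deriv F z))\<^sup>2 * (\<psi> ((cmod z)\<^sup>2))\<^sup>2 else 0)" for z
  define d2 where "d2 z = (if z \<in> ball 0 1 then (cmod (deriv F z - deriv F 0))\<^sup>2 else 0)" for z
  have dm: "d \<in> borel_measurable borel" unfolding d_def[abs_def]
    by (intro borel_measurable_on_disk continuous_intros cF' continuous_on_compose2[OF \<psi>]) auto
  have d2m: "d2 \<in> borel_measurable borel" unfolding d2_def[abs_def]
    by (intro borel_measurable_on_disk continuous_intros cF')
  let ?J = "indicator {0<..<2 * pi} :: real \<Rightarrow> ennreal" and ?I = "indicator {0<..<1} :: real \<Rightarrow> ennreal"
  define M where "M x = (\<integral>\<^sup>+t. ennreal (x * d2 (of_real x * cis t)) * ?J t \<partial>lborel)" for x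
  have Mm [measurable]: "M \<in> borel_measurable borel"
    unfolding M_def by (rule measurable_polar_section[OF d2m])
  have "(\<integral>\<^sup>+z\<in>ball 0 1. ennreal ((cmod (deriv F z - deriv F 0))\<^sup>2) \<partial>lborel)
      = (\<integral>\<^sup>+z\<in>ball 0 1. ennreal (d2 z) \<partial>lborel)"
    by (intro nn_integral_cong) (auto simp: d2_def indicator_def)
  also have "\<dots> = (\<integral>\<^sup>+x. M x * ?I x \<partial>lborel)"
    using nn_integral_polar(2)[OF d2m, of 0 1] by (simp add: d2_def M_def)
  finally have cM: "ennreal c \<le> (\<integral>\<^sup>+x. M x * ?I x \<partial>lborel)" using c(2) by simp
  define m where "m x = (cmod (deriv F 0))\<^sup>2 * (2 * pi) * (x * (\<psi> (x\<^sup>2))\<^sup>2)" for x :: real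
  have cm: "continuous_on S m" for S unfolding m_def by (intro continuous_intros cw)
  have mm [measurable]: "m \<in> borel_measurable borel" using cm by (rule borel_measurable_continuous_onI)
  have circle: "ennreal (m x) * ?I x + ennreal (k\<^sup>2) * (M x * ?I x)
      \<le> (\<integral>\<^sup>+t. ennreal (x * d (of_real x * cis t)) * ?J t \<partial>lborel) * ?I x" for x
  proof (cases "x \<in> {0<..<1}")
    case True
    then have x: "0 < x" "x < 1" by auto
    then have x2: "x\<^sup>2 \<in> {0..1}" by (simp add: power_le_one)
    have inb: "of_real x * cis t \<in> ball 0 1" for t using x by (simp add: norm_mult)
    have [measurable]: "(\<lambda>t. ennreal ((cmod (deriv F (of_real x * cis t)))\<^sup>2)) \<in> borel_measurable borel"
        "(\<lambda>t. ennreal ((cmod (deriv F (of_real x * cis t) - deriv F 0))\<^sup>2)) \<in> borel_measurable borel"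
      using inb by (intro measurable_compose[OF _ measurable_ennreal] borel_measurable_continuous_onI
         continuous_intros continuous_on_compose2[OF cF']; auto intro!: continuous_intros)+
    let ?N = "\<integral>\<^sup>+t. ennreal ((cmod (deriv F (of_real x * cis t) - deriv F 0))\<^sup>2) * ?J t \<partial>lborel"
    have M: "M x = ennreal x * ?N"
    proof -
      have "M x = (\<integral>\<^sup>+t. ennreal x * (ennreal ((cmod (deriv F (of_real x * cis t) - deriv F 0))\<^sup>2) * ?J t) \<partial>lborel)"
        unfolding M_def d2_def using inb x by (intro nn_integral_cong) (simp add: ennreal_mult' mult.assoc del: mem_ball)
      also have "\<dots> = ennreal x * ?N" by (rule nn_integral_cmult) measurable
      finally show ?thesis .
    qed
    have "(\<integral>\<^sup>+t. ennreal (x * d (of_real x * cis t)) * ?J t \<partial>lborel)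
        = (\<integral>\<^sup>+t. ennreal (x * (\<psi> (x\<^sup>2))\<^sup>2) * (ennreal ((cmod (deriv F (of_real x * cis t)))\<^sup>2) * ?J t) \<partial>lborel)"
    proof (rule nn_integral_cong)
      fix t
      have "d (of_real x * cis t) = (cmod (deriv F (of_real x * cis t)))\<^sup>2 * (\<psi> (x\<^sup>2))\<^sup>2"
        using inb[of t] x by (simp add: d_def norm_mult del: mem_ball)
      then have "x * d (of_real x * cis t) = (x * (\<psi> (x\<^sup>2))\<^sup>2) * (cmod (deriv F (of_real x * cis t)))\<^sup>2"
        by simp
      then have "ennreal (x * d (of_real x * cis t))
          = ennreal (x * (\<psi> (x\<^sup>2))\<^sup>2) * ennreal ((cmod (deriv F (of_real x * cis t)))\<^sup>2)"
        by (simp only: ennreal_mult''[OF zero_le_power2])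
      then show "ennreal (x * d (of_real x * cis t)) * ?J t
          = ennreal (x * (\<psi> (x\<^sup>2))\<^sup>2) * (ennreal ((cmod (deriv F (of_real x * cis t)))\<^sup>2) * ?J t)"
        by (simp only: mult.assoc)
    qed
    also have "\<dots> = ennreal (x * (\<psi> (x\<^sup>2))\<^sup>2) * (\<integral>\<^sup>+t. ennreal ((cmod (deriv F (of_real x * cis t)))\<^sup>2) * ?J t \<partial>lborel)"
      by (rule nn_integral_cmult) measurable
    also have "\<dots> = ennreal (x * (\<psi> (x\<^sup>2))\<^sup>2) * (ennreal (2 * pi * (cmod (deriv F 0))\<^sup>2) + ?N)"
      using circle_mean_square[OF holF' x] by simp
    also have "\<dots> = ennreal (x * (\<psi> (x\<^sup>2))\<^sup>2) * ennreal (2 * pi * (cmod (deriv F 0))\<^sup>2) + ennreal (x * (\<psi> (x\<^sup>2))\<^sup>2) * ?N"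
      by (rule distrib_left)
    also have "ennreal (x * (\<psi> (x\<^sup>2))\<^sup>2) * ennreal (2 * pi * (cmod (deriv F 0))\<^sup>2) = ennreal (m x)"
      using x by (subst ennreal_mult''[symmetric]) (auto simp: m_def mult_ac)
    finally have eq: "(\<integral>\<^sup>+t. ennreal (x * d (of_real x * cis t)) * ?J t \<partial>lborel)
        = ennreal (m x) + ennreal (x * (\<psi> (x\<^sup>2))\<^sup>2) * ?N" .
    have "k\<^sup>2 \<le> (\<psi> (x\<^sup>2))\<^sup>2" using k x2 by (intro power_mono) auto
    then have "k\<^sup>2 * x \<le> x * (\<psi> (x\<^sup>2))\<^sup>2" using x by (simp add: mult.commute)
    then have "ennreal (k\<^sup>2) * M x \<le> ennreal (x * (\<psi> (x\<^sup>2))\<^sup>2) * ?N"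
      unfolding M mult.assoc[symmetric] using x by (intro mult_right_mono) (auto simp flip: ennreal_mult' intro!: ennreal_leI)
    then show ?thesis using True unfolding eq by (simp add: add_left_mono)
  qed auto
  have "ennreal ((cmod (deriv F 0))\<^sup>2 * (2 * pi * integral {0..1} (\<lambda>x. x * (\<psi> (x\<^sup>2))\<^sup>2)) + k\<^sup>2 * c)
      = ennreal (integral {0..1} m) + ennreal (k\<^sup>2) * ennreal c"
  proof -
    have "integral {0..1} m = (cmod (deriv F 0))\<^sup>2 * (2 * pi) * integral {0..1} (\<lambda>x. x * (\<psi> (x\<^sup>2))\<^sup>2)"
      unfolding m_def[abs_def] by (rule integral_mult_right)
    moreover have "0 \<le> integral {0..1} m"
      by (intro integral_nonneg integrable_continuous_real cm) (auto simp: m_def)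
    ultimately show ?thesis using c(1) by (simp add: ennreal_plus ennreal_mult mult.assoc)
  qed
  also have "ennreal (integral {0..1} m) = (\<integral>\<^sup>+x. ennreal (m x) * ?I x \<partial>lborel)"
    by (rule nn_integral_Ioo_continuous[symmetric]) (auto simp: m_def intro!: cm[unfolded m_def])
  also have "(\<integral>\<^sup>+x. ennreal (m x) * ?I x \<partial>lborel) + ennreal (k\<^sup>2) * ennreal c
      \<le> (\<integral>\<^sup>+x. ennreal (m x) * ?I x \<partial>lborel) + ennreal (k\<^sup>2) * (\<integral>\<^sup>+x. M x * ?I x \<partial>lborel)"
    by (intro add_left_mono mult_left_mono cM) auto
  also have "\<dots> = (\<integral>\<^sup>+x. ennreal (m x) * ?I x + ennreal (k\<^sup>2) * (M x * ?I x) \<partial>lborel)"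
    by (subst nn_integral_add) (simp_all add: nn_integral_cmult)
  also have "\<dots> \<le> (\<integral>\<^sup>+x. (\<integral>\<^sup>+t. ennreal (x * d (of_real x * cis t)) * ?J t \<partial>lborel) * ?I x \<partial>lborel)"
    by (intro nn_integral_mono circle)
  also have "\<dots> = (\<integral>\<^sup>+z\<in>ball 0 1. ennreal (d z) \<partial>lborel)"
    using nn_integral_polar(2)[OF dm, of 0 1] by (simp add: d_def)
  also have "\<dots> = (\<integral>\<^sup>+z\<in>ball 0 1. ennreal ((cmod (deriv F z))\<^sup>2 * (\<phi> (F z))\<^sup>2) \<partial>lborel)"
    by (intro nn_integral_cong) (auto simp: d_def indicator_def \<phi>)
  also have "\<dots> = (\<integral>\<^sup>+z\<in>\<Omega>. ennreal ((\<phi> z)\<^sup>2) \<partial>lborel)"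
    by (rule nn_integral_conformal_disk[OF conf O(1), symmetric]) (auto intro!: continuous_on_power smoothD(2)[OF sm])
  also have "\<dots> = ennreal (LINT z|lebesgue_on \<Omega>. (\<phi> z)\<^sup>2)"
    using O by (intro ennreal_lebesgue_on_integral[symmetric]) (auto intro!: continuous_on_power smoothD(2)[OF sm])
  finally show ?thesis by (subst (asm) ennreal_le_iff) auto
qed

text \<open>
  If the integral vanished, the open set where \<open>F'\<close> differs from \<open>F' 0\<close> would be a null set, hence empty,
  and \<open>F\<close> would be linear.
\<close>

lemma nonlinear_derivative_variation:
  assumes hol: "F holomorphic_on ball 0 1" and nl: "\<not> linear_on_disk F"
  shows "0 < (\<integral>\<^sup>+z\<in>ball 0 1. ennreal ((cmod (deriv F z - deriv F 0))\<^sup>2) \<partial>lborel)"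
proof (rule ccontr)
  have cF': "continuous_on (ball 0 1) (deriv F)"
    using hol by (intro holomorphic_on_imp_continuous_on holomorphic_deriv) auto
  let ?U = "{z \<in> ball 0 1. deriv F z \<noteq> deriv F 0}"
  have oU: "open ?U"
  proof -
    have "open (ball 0 1 \<inter> (deriv F) -` (- {deriv F 0}))"
      by (rule continuous_open_preimage[OF cF']) auto
    also have "ball 0 1 \<inter> (deriv F) -` (- {deriv F 0}) = ?U" by auto
    finally show ?thesis .
  qed
  have neU: "?U \<noteq> {}"
  proof
    assume "?U = {}"
    then have d: "deriv F z = deriv F 0" if "z \<in> ball 0 1" for z using that by blast
    have "\<exists>c. \<forall>z\<in>ball 0 1. F z - deriv F 0 * z = c"
    proof (rule has_field_derivative_zero_constant)
      fix z :: complex assume z: "z \<in> ball 0 1"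
      have "(F has_field_derivative deriv F 0) (at z)"
        using holomorphic_derivI[OF hol open_ball z] d[OF z] by simp
      then have "((\<lambda>z. F z - deriv F 0 * z) has_field_derivative 0) (at z)"
        by (auto intro!: derivative_eq_intros)
      then show "((\<lambda>z. F z - deriv F 0 * z) has_field_derivative 0) (at z within ball 0 1)"
        by (rule DERIV_subset) simp
    qed simp
    then obtain c where "\<forall>z\<in>ball 0 1. F z = c + deriv F 0 * z" by (auto simp: algebra_simps)
    with nl show False unfolding linear_on_disk_def by blast
  qed
  assume "\<not> ?thesis"
  then have z: "(\<integral>\<^sup>+z\<in>ball 0 1. ennreal ((cmod (deriv F z - deriv F 0))\<^sup>2) \<partial>lborel) = 0" by simp
  have m: "(\<lambda>z. ennreal ((cmod (deriv F z - deriv F 0))\<^sup>2) * indicator (ball 0 1) z) \<in> borel_measurable borel"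
  proof -
    have "(\<lambda>z. if z \<in> ball 0 1 then (cmod (deriv F z - deriv F 0))\<^sup>2 else 0) \<in> borel_measurable borel"
      by (intro borel_measurable_on_disk continuous_intros cF')
    then have "(\<lambda>z. ennreal (if z \<in> ball 0 1 then (cmod (deriv F z - deriv F 0))\<^sup>2 else 0)) \<in> borel_measurable borel"
      by simp
    also have "(\<lambda>z. ennreal (if z \<in> ball 0 1 then (cmod (deriv F z - deriv F 0))\<^sup>2 else 0))
       = (\<lambda>z. ennreal ((cmod (deriv F z - deriv F 0))\<^sup>2) * indicator (ball 0 1) z)"
      by (auto simp: indicator_def fun_eq_iff)
    finally show ?thesis .
  qed
  have "AE z in lborel. ennreal ((cmod (deriv F z - deriv F 0))\<^sup>2) * indicator (ball 0 1) z = 0"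
    using z m by (subst (asm) nn_integral_0_iff_AE) auto
  then have "AE z in lborel. z \<notin> ?U"
    by eventually_elim (auto simp: indicator_def)
  then have "?U \<in> null_sets lborel" using oU by (subst AE_iff_null_sets) auto
  then have "negligible ?U" by (simp add: negligible_iff_null_sets null_sets_completionI)
  with open_not_negligible[OF oU neU] show False by simp
qed

section \<open>The limit of the trial functions\<close>

lemma radial_integral_tendsto:
  fixes g :: "nat \<Rightarrow> real \<Rightarrow> real"
  assumes cont: "\<And>n. continuous_on {0..1} (g n)"
    and bound: "\<And>n x. x \<in> {0<..<1} \<Longrightarrow> \<bar>g n x\<bar> \<le> M"
    and lim: "\<And>x. x \<in> {0<..<1} \<Longrightarrow> (\<lambda>n. g n x) \<longlonglongrightarrow> g0 x"
  shows "(\<lambda>n. integral {0..1} (\<lambda>x. x * (g n x)\<^sup>2)) \<longlonglongrightarrow> integral {0..1} (\<lambda>x. x * (g0 x)\<^sup>2)"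
proof -
  have "(\<lambda>n. integral {0<..<1} (\<lambda>x. x * (g n x)\<^sup>2)) \<longlonglongrightarrow> integral {0<..<1} (\<lambda>x. x * (g0 x)\<^sup>2)"
  proof (rule dominated_convergence(2)[where h = "\<lambda>x. M\<^sup>2"])
    show "(\<lambda>x. x * (g n x)\<^sup>2) integrable_on {0<..<1}" for n
      by (subst integrable_on_Icc_iff_Ioo[symmetric])
         (intro integrable_continuous_real continuous_intros cont)
    show "(\<lambda>x. M\<^sup>2) integrable_on {0<..<1::real}"
      by (subst integrable_on_Icc_iff_Ioo[symmetric]) auto
    fix x :: real assume x: "x \<in> {0<..<1}"
    show "norm (x * (g n x)\<^sup>2) \<le> M\<^sup>2" for n
    proof -
      have "\<bar>g n x\<bar>\<^sup>2 \<le> M\<^sup>2" using bound[OF x] by (intro power_mono) auto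
      then have "x * (g n x)\<^sup>2 \<le> 1 * M\<^sup>2" using x by (intro mult_mono) auto
      then show ?thesis using x by simp
    qed
    show "(\<lambda>n. x * (g n x)\<^sup>2) \<longlonglongrightarrow> x * (g0 x)\<^sup>2" by (intro tendsto_intros lim x)
  qed
  then show ?thesis by (simp add: integral_open_interval_real)
qed

context radial_ground_state
begin

text \<open>
  The profiles \<open>U 1 + bump n\<close> approximate \<open>U\<close> on \<open>[0, 1)\<close> and are constant from \<open>cut_radius n\<close> on;
  \<open>bump' n\<close> is the derivative of \<open>bump n\<close>.
\<close>

definition "cut_radius n = 1 - 1 / (real n + 2)"
definition "cut_scale n = 1 / (real n + 2)"
definition "cut_entire n z = E z - of_real (U (cut_radius n))"
definition "bump n = flat_cutoff (cut_scale n) (cut_radius n) 0 (cut_entire n)"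
definition "bump' n = flat_cutoff (cut_scale n) (cut_radius n) 2
                        (flat_cutoff_diff (cut_scale n) (cut_radius n) 0 (cut_entire n))"

lemma cut_bounds: "0 < cut_radius n" "cut_radius n < 1" "0 < cut_scale n"
  by (auto simp: cut_radius_def cut_scale_def field_simps)

lemma cut_entire_holomorphic: "cut_entire n holomorphic_on UNIV"
  unfolding cut_entire_def[abs_def] by (intro holomorphic_intros entire)

lemma continuous_bump: "continuous_on S (bump n)" "continuous_on S (bump' n)"
  unfolding bump_def bump'_def
  by (intro continuous_flat_cutoff cut_entire_holomorphic flat_cutoff_diff_holomorphic cut_bounds)+

lemma bump_eq:
  assumes "s < cut_radius n"
  shows "bump n s = (U s - U (cut_radius n)) * exp (- (cut_scale n / (cut_radius n - s)))"
    and "bump' n s = (U' s - cut_scale n * (U s - U (cut_radius n)) / (cut_radius n - s)\<^sup>2)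
                       * exp (- (cut_scale n / (cut_radius n - s)))"
proof -
  show "bump n s = (U s - U (cut_radius n)) * exp (- (cut_scale n / (cut_radius n - s)))"
    using assms by (simp add: bump_def flat_cutoff_def cut_entire_def U_def)
  have "deriv (cut_entire n) z = deriv E z" for z
    unfolding cut_entire_def[abs_def]
    by (subst deriv_diff) (use entire holomorphic_on_imp_differentiable_at[of E UNIV] in auto)
  moreover have "complex_of_real (cut_radius n) - of_real s = of_real (cut_radius n - s)" by simp
  ultimately have "Re (flat_cutoff_diff (cut_scale n) (cut_radius n) 0 (cut_entire n) (of_real s))
     = (cut_radius n - s)\<^sup>2 * U' s - cut_scale n * (U s - U (cut_radius n))"
    unfolding flat_cutoff_diff_def cut_entire_def U_def U'_def
    by (simp only: flip: of_real_power) simp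
  then show "bump' n s = (U' s - cut_scale n * (U s - U (cut_radius n)) / (cut_radius n - s)\<^sup>2)
                       * exp (- (cut_scale n / (cut_radius n - s)))"
    using assms unfolding bump'_def flat_cutoff_def by (simp add: diff_divide_distrib left_diff_distrib)
qed

lemma bump_eq_0: "cut_radius n \<le> s \<Longrightarrow> bump n s = 0" "cut_radius n \<le> s \<Longrightarrow> bump' n s = 0"
  by (simp_all add: bump_def bump'_def flat_cutoff_def)

lemma bump_nonneg: "s \<in> {0..1} \<Longrightarrow> 0 \<le> bump n s"
  using U_decreasing[of s "cut_radius n"] cut_bounds[of n]
  by (cases "s < cut_radius n") (auto simp: bump_eq bump_eq_0)

lemma bump_le: "s \<in> {0..1} \<Longrightarrow> bump n s \<le> U 0"
proof (cases "s < cut_radius n")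
  case True
  assume s: "s \<in> {0..1}"
  have pos: "0 < U (cut_radius n)" using U_pos[of "cut_radius n"] cut_bounds[of n] by (simp add: U_def)
  have "bump n s \<le> (U s - U (cut_radius n)) * 1"
    unfolding bump_eq(1)[OF True] using U_decreasing[of s "cut_radius n"] cut_bounds[of n] s True
    by (intro mult_left_mono) auto
  also have "\<dots> \<le> U 0" using U_decreasing[of 0 s] s pos by simp
  finally show ?thesis .
next
  case False
  then show ?thesis using U_pos[of 0] by (simp add: bump_eq_0 U_def)
qed

lemma U'_bound:
  obtains M where "0 < M" "\<And>s. s \<in> {0..1} \<Longrightarrow> \<bar>U' s\<bar> \<le> M"
proof -
  have "compact (U' ` {0..1})" by (intro compact_continuous_image cont_U') auto
  then obtain B where "\<And>s. s \<in> {0..1} \<Longrightarrow> \<bar>U' s\<bar> \<le> B"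
    using compact_imp_bounded bounded_iff by (metis image_eqI real_norm_def)
  then show thesis by (intro that[of "max 1 B"]) (auto simp: le_max_iff_disj less_max_iff_disj)
qed

text \<open>
  With \<open>y = cut_scale n / (cut_radius n - s)\<close> the derivative is at most \<open>M * (1 + y) * exp (- y)\<close>: the
  cutoff has a large derivative only where \<open>U s - U (cut_radius n)\<close> is small.
\<close>

lemma bump'_bounded:
  obtains M where "\<And>n s. s \<in> {0..1} \<Longrightarrow> \<bar>bump' n s\<bar> \<le> M"
proof -
  obtain M where M: "0 < M" "\<And>s. s \<in> {0..1} \<Longrightarrow> \<bar>U' s\<bar> \<le> M" by (rule U'_bound) blast
  have "\<bar>bump' n s\<bar> \<le> 2 * M" if s: "s \<in> {0..1}" for n s
  proof (cases "s < cut_radius n")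
    case True
    define h where "h = cut_radius n - s"
    define y where "y = cut_scale n / h"
    have h: "0 < h" using True by (simp add: h_def)
    have y: "0 < y" using h cut_bounds by (simp add: y_def)
    have "\<bar>U s - U (cut_radius n)\<bar> \<le> M * h"
    proof -
      obtain \<xi> where "s < \<xi>" "\<xi> < cut_radius n" "U (cut_radius n) - U s = (cut_radius n - s) * U' \<xi>"
        using MVT2[OF True, of U U'] dU by blast
      moreover from this have "\<bar>U' \<xi>\<bar> \<le> M" using M(2)[of \<xi>] s cut_bounds[of n] by auto
      ultimately show ?thesis using h
        by (simp add: abs_minus_commute[of "U s"] abs_mult h_def[symmetric] mult.commute mult_left_mono)
    qed
    then have "\<bar>cut_scale n * (U s - U (cut_radius n)) / h\<^sup>2\<bar> \<le> cut_scale n * (M * h) / h\<^sup>2"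
      using cut_bounds[of n] h by (simp add: abs_mult divide_right_mono)
    also have "\<dots> = M * y" using h by (simp add: y_def power2_eq_square)
    finally have "\<bar>U' s - cut_scale n * (U s - U (cut_radius n)) / h\<^sup>2\<bar> \<le> M + M * y"
      using M(2)[OF s] by linarith
    then have "\<bar>bump' n s\<bar> \<le> (M + M * y) * exp (- y)"
      unfolding bump_eq(2)[OF True] h_def[symmetric] y_def[symmetric] by (simp add: abs_mult)
    also have "\<dots> = M * ((1 + y) * exp (- y))" by (simp add: algebra_simps)
    also have "(1 + y) * exp (- y) \<le> 1"
      using exp_ge_add_one_self[of y] by (simp add: exp_minus field_simps)
    finally show ?thesis using M(1) by (simp add: mult_left_mono)
  next
    case False
    then show ?thesis using M by (simp add: bump_eq_0)
  qed
  then show thesis by (rule that)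
qed

lemma bump_tendsto:
  assumes s: "0 < s" "s < 1"
  shows "(\<lambda>n. bump n s) \<longlonglongrightarrow> U s - U 1" and "(\<lambda>n. bump' n s) \<longlonglongrightarrow> U' s"
proof -
  have r: "cut_radius \<longlonglongrightarrow> 1" unfolding cut_radius_def[abs_def] by real_asymp
  have e: "cut_scale \<longlonglongrightarrow> 0" unfolding cut_scale_def[abs_def] by real_asymp
  have Ur: "(\<lambda>n. U (cut_radius n)) \<longlonglongrightarrow> U 1"
    using DERIV_isCont[OF dU] r by (rule isCont_tendsto_compose)
  have ev: "eventually (\<lambda>n. s < cut_radius n) sequentially" using r s(2) by (rule order_tendstoD)
  have ex: "(\<lambda>n. exp (- (cut_scale n / (cut_radius n - s)))) \<longlonglongrightarrow> exp (- (0 / (1 - s)))"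
    using s by (intro tendsto_intros r e) auto
  have "(\<lambda>n. (U s - U (cut_radius n)) * exp (- (cut_scale n / (cut_radius n - s)))) \<longlonglongrightarrow> (U s - U 1) * exp (- (0 / (1 - s)))"
    by (intro tendsto_intros Ur ex)
  then have "(\<lambda>n. bump n s) \<longlonglongrightarrow> (U s - U 1) * exp (- (0 / (1 - s)))"
    by (rule Lim_transform_eventually) (use ev in \<open>eventually_elim, simp add: bump_eq\<close>)
  then show "(\<lambda>n. bump n s) \<longlonglongrightarrow> U s - U 1" by simp
  have "(\<lambda>n. (U' s - cut_scale n * (U s - U (cut_radius n)) / (cut_radius n - s)\<^sup>2) * exp (- (cut_scale n / (cut_radius n - s))))
      \<longlonglongrightarrow> (U' s - 0 * (U s - U 1) / (1 - s)\<^sup>2) * exp (- (0 / (1 - s)))"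
    using s by (intro tendsto_intros Ur ex r e) auto
  then have "(\<lambda>n. bump' n s) \<longlonglongrightarrow> (U' s - 0 * (U s - U 1) / (1 - s)\<^sup>2) * exp (- (0 / (1 - s)))"
    by (rule Lim_transform_eventually) (use ev in \<open>eventually_elim, simp add: bump_eq\<close>)
  then show "(\<lambda>n. bump' n s) \<longlonglongrightarrow> U' s" by simp
qed

lemma bump_energy_tendsto:
  "(\<lambda>n. integral {0..1} (\<lambda>x. x * (2 * x * bump' n (x\<^sup>2))\<^sup>2)) \<longlonglongrightarrow> integral {0..1} (\<lambda>x. x * (2 * x * U' (x\<^sup>2))\<^sup>2)"
proof -
  obtain M where M: "\<And>n s. s \<in> {0..1} \<Longrightarrow> \<bar>bump' n s\<bar> \<le> M" by (rule bump'_bounded) blast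
  show ?thesis
  proof (rule radial_integral_tendsto[where M = "2 * M"])
    show "continuous_on {0..1} (\<lambda>x. 2 * x * bump' n (x\<^sup>2))" for n
      by (intro continuous_intros continuous_on_compose2[OF continuous_bump(2)[of UNIV]]) auto
    show "\<bar>2 * x * bump' n (x\<^sup>2)\<bar> \<le> 2 * M" if "x \<in> {0<..<1}" for n and x :: real
    proof -
      have "\<bar>2 * x * bump' n (x\<^sup>2)\<bar> \<le> 2 * 1 * M"
        unfolding abs_mult using that by (intro mult_mono M) (auto simp: power_le_one)
      then show ?thesis by simp
    qed
    show "(\<lambda>n. 2 * x * bump' n (x\<^sup>2)) \<longlonglongrightarrow> 2 * x * U' (x\<^sup>2)" if "x \<in> {0<..<1}" for x
      using that by (intro tendsto_intros bump_tendsto) (auto simp: power_less_one_iff)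
  qed
qed

lemma bump_mass_tendsto:
  "(\<lambda>n. integral {0..1} (\<lambda>x. x * (U 1 + bump n (x\<^sup>2))\<^sup>2)) \<longlonglongrightarrow> integral {0..1} (\<lambda>x. x * (U (x\<^sup>2))\<^sup>2)"
proof (rule radial_integral_tendsto[where M = "U 1 + U 0"])
  show "continuous_on {0..1} (\<lambda>x. U 1 + bump n (x\<^sup>2))" for n
    by (intro continuous_intros continuous_on_compose2[OF continuous_bump(1)[of UNIV]]) auto
  show "\<bar>U 1 + bump n (x\<^sup>2)\<bar> \<le> U 1 + U 0" if "x \<in> {0<..<1}" for n x
    using that bump_nonneg[of "x\<^sup>2" n] bump_le[of "x\<^sup>2" n] U_pos[of 1] by (simp add: U_def power_le_one)
  show "(\<lambda>n. U 1 + bump n (x\<^sup>2)) \<longlonglongrightarrow> U (x\<^sup>2)" if "x \<in> {0<..<1}" for x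
  proof -
    have "(\<lambda>n. U 1 + bump n (x\<^sup>2)) \<longlonglongrightarrow> U 1 + (U (x\<^sup>2) - U 1)"
      using that by (intro tendsto_intros bump_tendsto) (auto simp: power_less_one_iff)
    then show ?thesis by simp
  qed
qed

text \<open>
  The trial functions with profile \<open>U 1 + bump n\<close> have boundary values \<open>U 1\<close>, so their boundary term is at
  most \<open>2 * pi * b * (U 1)\<^sup>2\<close>. In the limit the numerator of the Rayleigh quotient becomes that of the
  ground state of the disk, which is \<open>l\<close> times its mass, while the denominator is at least
  \<open>|F' 0|\<^sup>2\<close> times that mass plus a term that is positive unless \<open>F\<close> is linear.
\<close>

lemma robin_lambda1_conformal_le:
  assumes conf: "conformal_map_of_disk F \<Omega>" and O: "open \<Omega>" "bounded \<Omega>" "\<Omega> \<noteq> {}"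
    and fin: "emeasure hausdorff1 (frontier \<Omega>) < top"
    and \<beta>: "0 \<le> \<beta>" "\<beta> * perimeter \<Omega> \<le> 2 * pi * b"
  shows "robin_lambda1 \<Omega> \<beta> * (cmod (deriv F 0))\<^sup>2 \<le> l"
    and "\<not> linear_on_disk F \<Longrightarrow> robin_lambda1 \<Omega> \<beta> * (cmod (deriv F 0))\<^sup>2 < l"
proof -
  have hol: "F holomorphic_on ball 0 1" using conf by (simp add: conformal_map_of_disk_def)
  define mu where "mu = robin_lambda1 \<Omega> \<beta>"
  define A where "A n = integral {0..1} (\<lambda>x. x * (2 * x * bump' n (x\<^sup>2))\<^sup>2)" for n
  define B where "B n = integral {0..1} (\<lambda>x. x * (U 1 + bump n (x\<^sup>2))\<^sup>2)" for n
  define B0 where "B0 = integral {0..1} (\<lambda>x. x * (U (x\<^sup>2))\<^sup>2)"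
  define V where "V = (\<integral>\<^sup>+z\<in>ball 0 1. ennreal ((cmod (deriv F z - deriv F 0))\<^sup>2) \<partial>lborel)"
  \<comment> \<open>The minimum only serves to have a finite number; its positivity is what matters.\<close>
  define c where "c = enn2real (min V 1)"
  have c: "0 \<le> c" "ennreal c \<le> V"
    by (auto simp: c_def min_less_iff_disj ennreal_enn2real_if)
  have U1: "0 < U 1" using U_pos[of 1] by (simp add: U_def)
  have mu0: "0 \<le> mu" unfolding mu_def
    by (rule robin_lambda1_ge) (use O fin \<beta> in auto)
  have bound: "mu * ((cmod (deriv F 0))\<^sup>2 * (2 * pi * B n) + (U 1)\<^sup>2 * c) \<le> 2 * pi * A n + 2 * pi * b * (U 1)\<^sup>2" for n
  proof -
    obtain \<phi> where sm: "smooth \<phi>" and out: "\<And>z. z \<notin> \<Omega> \<Longrightarrow> \<phi> z = U 1"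
      and val: "\<And>w. w \<in> ball 0 1 \<Longrightarrow> \<phi> (F w) = U 1 + bump n ((cmod w)\<^sup>2)"
      and gr: "\<And>w. w \<in> ball 0 1 \<Longrightarrow> (cmod (deriv F w))\<^sup>2 * (norm (grad \<phi> (F w)))\<^sup>2 = (2 * cmod w * bump' n ((cmod w)\<^sup>2))\<^sup>2"
      using radial_trial_function[where E = "cut_entire n" and k = "U 1",
          OF conf O(1) cut_entire_holomorphic cut_bounds(3,1,2)[of n]]
      unfolding bump_def[symmetric] bump'_def[symmetric] by blast
    define N where "N = (LINT z|lebesgue_on \<Omega>. (\<phi> z)\<^sup>2)"
    have energy: "(LINT z|lebesgue_on \<Omega>. (norm (grad \<phi> z))\<^sup>2) = 2 * pi * A n"
      unfolding A_def by (rule trial_energy[OF conf O(1,2) sm continuous_bump(2) gr])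
    have mass: "(cmod (deriv F 0))\<^sup>2 * (2 * pi * B n) + (U 1)\<^sup>2 * c \<le> N"
      unfolding B_def N_def
    proof (rule trial_mass[OF conf O(1,2) sm, of "\<lambda>s. U 1 + bump n s"])
      show "ennreal c \<le> (\<integral>\<^sup>+z\<in>ball 0 1. ennreal ((cmod (deriv F z - deriv F 0))\<^sup>2) \<partial>lborel)"
        using c(2) by (simp add: V_def)
    qed (use U1 c val bump_nonneg in \<open>auto intro!: continuous_intros continuous_bump\<close>)
    have \<phi>nz: "\<phi> z \<noteq> 0" if "z \<in> \<Omega>" for z
    proof -
      have "z \<in> F ` ball 0 1" using that conf by (simp add: conformal_map_of_disk_def bij_betw_def)
      then obtain w where w: "w \<in> ball 0 1" "z = F w" by blast
      have "(cmod w)\<^sup>2 \<in> {0..1}" using w(1) by (simp add: power_le_one)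
      then show ?thesis using val[OF w(1)] bump_nonneg[of "(cmod w)\<^sup>2" n] U1 w(2) by auto
    qed
    have nz: "\<not> (AE z in lebesgue_on \<Omega>. \<phi> z = 0)" using O \<phi>nz by (intro not_AE_zero) auto
    have Npos: "0 < N"
      unfolding N_def using nz
      by (intro integral_square_pos square_integrable_continuous bounded_finite_lebesgue_on O smoothD(2)[OF sm])
    have bd: "(LINT z|boundary_measure \<Omega>. (\<phi> z)\<^sup>2) = (U 1)\<^sup>2 * perimeter \<Omega>"
    proof -
      have "(LINT z|boundary_measure \<Omega>. (\<phi> z)\<^sup>2) = (LINT z|boundary_measure \<Omega>. (U 1)\<^sup>2)"
        using O(1) by (intro Bochner_Integration.integral_cong refl)
          (auto simp: boundary_measure_def space_restrict_space frontier_def interior_open out)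
      also have "\<dots> = (U 1)\<^sup>2 * perimeter \<Omega>"
        by (simp add: boundary_measure_def perimeter_def measure_restrict_space space_restrict_space)
      finally show ?thesis .
    qed
    have "mu \<le> (2 * pi * A n + \<beta> * ((U 1)\<^sup>2 * perimeter \<Omega>)) / N"
      using robin_lambda1_le[OF sm O(2,1) fin nz \<beta>(1)]
      unfolding robin_rayleigh_def energy bd N_def[symmetric] mu_def .
    then have "mu * N \<le> 2 * pi * A n + \<beta> * perimeter \<Omega> * (U 1)\<^sup>2"
      using Npos by (simp add: field_simps)
    also have "\<dots> \<le> 2 * pi * A n + 2 * pi * b * (U 1)\<^sup>2"
      using \<beta>(2) by (intro add_left_mono mult_right_mono) auto
    finally show ?thesis using mult_left_mono[OF mass mu0] by linarith
  qed
  have eq: "l * B0 = integral {0..1} (\<lambda>x. x * (2 * x * U' (x\<^sup>2))\<^sup>2) + b * (U 1)\<^sup>2"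
    unfolding B0_def by (rule radial_equality)
  have lim: "mu * ((cmod (deriv F 0))\<^sup>2 * (2 * pi * B0) + (U 1)\<^sup>2 * c) \<le> 2 * pi * (l * B0)"
  proof -
    have "mu * ((cmod (deriv F 0))\<^sup>2 * (2 * pi * B0) + (U 1)\<^sup>2 * c)
        \<le> 2 * pi * integral {0..1} (\<lambda>x. x * (2 * x * U' (x\<^sup>2))\<^sup>2) + 2 * pi * b * (U 1)\<^sup>2"
    proof (rule LIMSEQ_le)
      show "(\<lambda>n. mu * ((cmod (deriv F 0))\<^sup>2 * (2 * pi * B n) + (U 1)\<^sup>2 * c))
          \<longlonglongrightarrow> mu * ((cmod (deriv F 0))\<^sup>2 * (2 * pi * B0) + (U 1)\<^sup>2 * c)"
        unfolding B_def B0_def by (intro tendsto_intros bump_mass_tendsto)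
      show "(\<lambda>n. 2 * pi * A n + 2 * pi * b * (U 1)\<^sup>2)
          \<longlonglongrightarrow> 2 * pi * integral {0..1} (\<lambda>x. x * (2 * x * U' (x\<^sup>2))\<^sup>2) + 2 * pi * b * (U 1)\<^sup>2"
        unfolding A_def by (intro tendsto_intros bump_energy_tendsto)
    qed (use bound in auto)
    also have "\<dots> = 2 * pi * (l * B0)" unfolding eq by (simp add: algebra_simps)
    finally show ?thesis .
  qed
  have B0: "0 < B0"
  proof -
    have "0 \<le> integral {0..1} (\<lambda>x. x * (2 * x * U' (x\<^sup>2))\<^sup>2)"
      by (intro integral_nonneg integrable_continuous_real continuous_intros continuous_on_compose2[OF cont_U'[of UNIV]]) auto
    moreover have "0 < b * (U 1)\<^sup>2" using b_pos U1 by simp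
    ultimately have "0 < l * B0" using eq by linarith
    then show ?thesis using l_pos by (simp add: zero_less_mult_iff)
  qed
  have lim': "mu * (cmod (deriv F 0))\<^sup>2 * (2 * pi * B0) + mu * ((U 1)\<^sup>2 * c) \<le> l * (2 * pi * B0)"
    using lim by (simp add: algebra_simps)
  have p: "0 < 2 * pi * B0" using B0 by simp
  show "robin_lambda1 \<Omega> \<beta> * (cmod (deriv F 0))\<^sup>2 \<le> l"
  proof -
    have "0 \<le> mu * ((U 1)\<^sup>2 * c)" using mu0 c(1) by simp
    with lim' have "mu * (cmod (deriv F 0))\<^sup>2 * (2 * pi * B0) \<le> l * (2 * pi * B0)" by linarith
    then show ?thesis using p unfolding mu_def by (rule mult_right_le_imp_le)
  qed
  assume nl: "\<not> linear_on_disk F"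
  have "0 < V" unfolding V_def by (rule nonlinear_derivative_variation[OF hol nl])
  then have "0 < c" by (auto simp: c_def enn2real_positive_iff min_less_iff_disj)
  show "robin_lambda1 \<Omega> \<beta> * (cmod (deriv F 0))\<^sup>2 < l"
  proof (cases "mu = 0")
    case True
    then show ?thesis using l_pos by (simp add: mu_def)
  next
    case False
    then have "0 < mu * ((U 1)\<^sup>2 * c)" using mu0 U1 \<open>0 < c\<close> by simp
    with lim' have "mu * (cmod (deriv F 0))\<^sup>2 * (2 * pi * B0) < l * (2 * pi * B0)" by linarith
    then show ?thesis using p unfolding mu_def by (rule mult_right_less_imp_less[OF _ less_imp_le])
  qed
qed

end

section \<open>The sharp inequality\<close>

theorem theoremE:
  fixes \<alpha> :: real and F :: "complex \<Rightarrow> complex" and \<Omega> :: "complex set"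
  assumes "\<alpha> > 0"
    and "jordan_lipschitz_domain \<Omega>"
    and "conformal_map_of_disk F \<Omega>"
  shows "robin_lambda1 \<Omega> (\<alpha> / perimeter \<Omega>) * (norm (deriv F 0))\<^sup>2
           \<le> robin_lambda1 (ball 0 1) (\<alpha> / (2 * pi))
       \<and> (robin_lambda1 \<Omega> (\<alpha> / perimeter \<Omega>) * (norm (deriv F 0))\<^sup>2
            = robin_lambda1 (ball 0 1) (\<alpha> / (2 * pi))
          \<longleftrightarrow> linear_on_disk F)
       \<and> (linear_on_disk F \<longrightarrow> (\<exists>c r. 0 < r \<and> \<Omega> = ball c r))"
proof -
  define b where "b = \<alpha> / (2 * pi)"
  have b: "0 < b" using \<open>\<alpha> > 0\<close> by (simp add: b_def)
  from radial_ground_state_exists[OF b] obtain l E where "radial_ground_state l b E" by blast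
  then interpret radial_ground_state l b E .
  have O: "open \<Omega>" "bounded \<Omega>" "\<Omega> \<noteq> {}" and lip: "lipschitz_boundary \<Omega>"
    using \<open>jordan_lipschitz_domain \<Omega>\<close> by (auto simp: jordan_lipschitz_domain_def)
  have fin: "emeasure hausdorff1 (frontier \<Omega>) < top"
    using lip O by (intro hausdorff1_frontier_finite)
  have per: "0 \<le> perimeter \<Omega>" by (simp add: perimeter_def)
  have \<beta>: "0 \<le> \<alpha> / perimeter \<Omega>" "\<alpha> / perimeter \<Omega> * perimeter \<Omega> \<le> 2 * pi * b"
    using \<open>\<alpha> > 0\<close> per by (auto simp: b_def)
  note upper = robin_lambda1_conformal_le[OF \<open>conformal_map_of_disk F \<Omega>\<close> O fin \<beta>]
  have disk: "robin_lambda1 (ball 0 1) (\<alpha> / (2 * pi)) = l"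
  proof (rule antisym)
    have id: "conformal_map_of_disk (\<lambda>z. z) (ball 0 1)"
      by (auto simp: conformal_map_of_disk_def bij_betw_def intro: holomorphic_intros)
    have "robin_lambda1 (ball 0 1) (\<alpha> / (2 * pi)) * (cmod (deriv (\<lambda>z. z) 0))\<^sup>2 \<le> l"
      by (rule robin_lambda1_conformal_le(1)[OF id])
         (use \<open>\<alpha> > 0\<close> in \<open>auto simp: frontier_ball emeasure_hausdorff1_sphere perimeter_ball b_def\<close>)
    then show "robin_lambda1 (ball 0 1) (\<alpha> / (2 * pi)) \<le> l" by simp
    show "l \<le> robin_lambda1 (ball 0 1) (\<alpha> / (2 * pi))"
      using robin_lambda1_ball_ge[of 1 "\<alpha> / (2 * pi)" 0] by (simp add: b_def)
  qed
  have linear: "(\<exists>c r. 0 < r \<and> \<Omega> = ball c r) \<and> l \<le> robin_lambda1 \<Omega> (\<alpha> / perimeter \<Omega>) * (norm (deriv F 0))\<^sup>2"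
    if lin: "linear_on_disk F"
  proof -
    obtain a0 a1 where F: "\<And>z. z \<in> ball 0 1 \<Longrightarrow> F z = a0 + a1 * z"
      using lin by (auto simp: linear_on_disk_def)
    have inj: "inj_on F (ball 0 1)" and img: "F ` ball 0 1 = \<Omega>"
      using \<open>conformal_map_of_disk F \<Omega>\<close> by (auto simp: conformal_map_of_disk_def bij_betw_def)
    have a1: "a1 \<noteq> 0"
    proof
      assume "a1 = 0"
      then have "F 0 = F (1 / 2)" using F by simp
      then show False using inj_onD[OF inj, of 0 "1 / 2"] by simp
    qed
    have "\<Omega> = (\<lambda>z. a0 + a1 * z) ` ball 0 1"
      unfolding img[symmetric] using F by (intro image_cong) auto
    also have "\<dots> = ball a0 (cmod a1)"
    proof (intro set_eqI iffI)
      fix z assume "z \<in> ball a0 (cmod a1)"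
      then have "cmod ((z - a0) / a1) < 1"
        using a1 by (simp add: dist_norm norm_divide norm_minus_commute)
      moreover have "z = a0 + a1 * ((z - a0) / a1)" using a1 by simp
      ultimately show "z \<in> (\<lambda>z. a0 + a1 * z) ` ball 0 1" by (intro image_eqI[of _ _ "(z - a0) / a1"]) auto
    next
      fix z assume "z \<in> (\<lambda>z. a0 + a1 * z) ` ball 0 1"
      then show "z \<in> ball a0 (cmod a1)" using a1 by (auto simp: dist_norm norm_mult)
    qed
    finally have ball: "\<Omega> = ball a0 (cmod a1)" .
    have "(F has_field_derivative a1) (at 0)"
    proof (rule has_field_derivative_transform_within_open[of "\<lambda>z. a0 + a1 * z" _ _ "ball 0 1"])
      show "((\<lambda>z. a0 + a1 * z) has_field_derivative a1) (at 0)" by (auto intro!: derivative_eq_intros)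
    qed (use F in auto)
    then have d: "deriv F 0 = a1" by (rule DERIV_imp_deriv)
    have "l / (cmod a1)\<^sup>2 \<le> robin_lambda1 \<Omega> (\<alpha> / perimeter \<Omega>)"
      unfolding ball by (rule robin_lambda1_ball_ge) (use a1 in \<open>auto simp: perimeter_ball b_def\<close>)
    then have "l \<le> robin_lambda1 \<Omega> (\<alpha> / perimeter \<Omega>) * (norm (deriv F 0))\<^sup>2"
      using a1 by (simp add: d field_simps)
    moreover have "0 < cmod a1" using a1 by simp
    ultimately show ?thesis using ball by blast
  qed
  show ?thesis
    unfolding disk
  proof (intro conjI)
    show "robin_lambda1 \<Omega> (\<alpha> / perimeter \<Omega>) * (norm (deriv F 0))\<^sup>2 \<le> l" by (rule upper(1))
    show "robin_lambda1 \<Omega> (\<alpha> / perimeter \<Omega>) * (norm (deriv F 0))\<^sup>2 = l \<longleftrightarrow> linear_on_disk F"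
      using upper linear by force
    show "linear_on_disk F \<longrightarrow> (\<exists>c r. 0 < r \<and> \<Omega> = ball c r)" using linear by blast
  qed
qed

end
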